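(* Given an SLP $\mathcal{S}$ of size $n$ representing a string $S$ of length $N$, and a pattern $P$ of length $m$ (with $m\le N$), we can compute an $O(\min\{nm,\,N-\alpha\})$-size representation of the convolution $C$ for $S$ and $P$ in $O(\min\{nm,\,N-\alpha\}\log m)$ time, where $\alpha\ge 0$. Here $$C[i]=\sum_{j=1}^{m} P[j]\cdot S[i+j-1]\qquad (1\le i\le N-m+1),$$ and $\alpha$ is a value representing the amount of redundancy that the SLP captures with respect to the length-$m$ substrings, defined by $$\alpha=\sum\{(\mathrm{vOcc}(X_j)-1)\cdot(|t_j|-(m-1)) \mid |X_j|\ge m,\ j=1,\dots,n\}.$$ Moreover, given a text position $i$ with $1\le i\le N-m+1$, this representation returns $C[i]$ in $O(\log N)$ time.
   Context: Strings $S$ and $P$ are over an integer alphabet $\Sigma$ (characters are treated as numerical values); the pattern $P$ is given uncompressed. $S[i]$ denotes the $i$-th character of $S$ (1-indexed) and $|S|$ its length. A straight-line program (SLP) of size $n$ is a set of assignments $\mathcal{S}=\{X_1\to expr_1,\dots,X_n\to expr_n\}$, where each $X_i$ is a variable and each $expr_i$ is either a single character $a\in\Sigma$ or a pair $X_{\ell(i)}X_{r(i)}$ with $\ell(i),r(i)<i$. Each variable $X_i$ derives a string $\mathrm{val}(X_i)$: $\mathrm{val}(X_i)=a$ if $expr_i=a$, and $\mathrm{val}(X_i)=\mathrm{val}(X_{\ell(i)})\,\mathrm{val}(X_{r(i)})$ if $expr_i=X_{\ell(i)}X_{r(i)}$. The SLP represents the string $S=\mathrm{val}(X_n)$. Write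 $|X_i|=|\mathrm{val}(X_i)|$. The derivation tree of $\mathcal{S}$ is the labeled ordered tree with root labeled $X_n$, in which a node labeled $X_i$ has a left child labeled $X_{\ell(i)}$ and a right child labeled $X_{r(i)}$ if $expr_i=X_{\ell(i)}X_{r(i)}$, and a single child, a leaf labeled $a$, if $expr_i=a\in\Sigma$. $\mathrm{vOcc}(X_j)$ is the number of times the variable $X_j$ occurs in the derivation tree, i.e. the number of its nodes labeled $X_j$. For a variable $X_j\to X_\ell X_r$, $t_j$ is the concatenation of the suffix of $\mathrm{val}(X_\ell)$ of length at most $m-1$ (that is, of length $\min\{m-1,|X_\ell|\}$) and the prefix of $\mathrm{val}(X_r)$ of length at most $m-1$ (that is, of length $\min\{m-1,|X_r|\}$). Model of computation: the word RAM with computer word size at least $\log_2|S|$, so that standard operations on values representing lengths and positions of $S$ take constant time. Space and representation sizes are measured in computer words. The convolution of a vector of length $N'$ with a vector of length $m'\le N'$ is taken to be computable in $O(N'\log m')$ time by FFT.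
   Formalization: α ≥ 0 is claimed only when every variable occurs in the derivation tree: it fails for X1→a, X2→X1X1, X3→X1X1, m=2 (α=−1). Word size is also at least 1 and log2 n, so that variable indices fit in words; log m and log N are read as at least 1. *)

theory Defs
  imports Complex_Main
begin

section \<open>Straight-line programs\<close>

text \<open>
  The variables of an SLP \<open>G\<close> of size \<open>n = length G\<close> are \<open>X\<^sub>1, \<dots>, X\<^sub>n\<close>; variable \<open>X\<^sub>i\<close> is
  represented by its index \<open>i \<in> {1..n}\<close> and its right-hand side is the list entry number \<open>i - 1\<close>.
  The alphabet is the set of all integers.
\<close>

datatype rhs = Char int | Pair nat nat

type_synonym slp = "rhs list"

abbreviation rhs_of :: "slp \<Rightarrow> nat \<Rightarrow> rhs" where
  "rhs_of G i \<equiv> G ! (i - 1)"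

definition is_slp :: "slp \<Rightarrow> bool" where
  "is_slp G \<longleftrightarrow> G \<noteq> [] \<and>
     (\<forall>i\<in>{1..length G}. \<forall>l r. rhs_of G i = Pair l r \<longrightarrow> l \<in> {1..<i} \<and> r \<in> {1..<i})"

text \<open>
  The test \<open>l < i \<and> r < i\<close> in the next two functions only makes them total; it always succeeds
  when \<^term>\<open>is_slp G\<close> holds and \<open>i \<in> {1..length G}\<close>.
\<close>

function val :: "slp \<Rightarrow> nat \<Rightarrow> int list" where
  "val G i = (case rhs_of G i of
      Char a \<Rightarrow> [a]
    | Pair l r \<Rightarrow> if l < i \<and> r < i then val G l @ val G r else [])"
  by pat_completeness auto
termination by (relation "measure snd") auto

declare val.simps [simp del]

datatype dtree = Leaf int | Node1 nat dtree | Node2 nat dtree dtree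

function derivation_tree :: "slp \<Rightarrow> nat \<Rightarrow> dtree" where
  "derivation_tree G i = (case rhs_of G i of
      Char a \<Rightarrow> Node1 i (Leaf a)
    | Pair l r \<Rightarrow> if l < i \<and> r < i
                 then Node2 i (derivation_tree G l) (derivation_tree G r) else Leaf 0)"
  by pat_completeness auto
termination by (relation "measure snd") auto

declare derivation_tree.simps [simp del]

fun count_label :: "nat \<Rightarrow> dtree \<Rightarrow> nat" where
  "count_label j (Leaf a) = 0"
| "count_label j (Node1 i t) = (if i = j then 1 else 0) + count_label j t"
| "count_label j (Node2 i t u) = (if i = j then 1 else 0) + count_label j t + count_label j u"

definition slp_string :: "slp \<Rightarrow> int list" where
  "slp_string G = val G (length G)"

definition vOcc :: "slp \<Rightarrow> nat \<Rightarrow> nat" where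
  "vOcc G j = count_label j (derivation_tree G (length G))"

definition suffix_upto :: "nat \<Rightarrow> 'a list \<Rightarrow> 'a list" where
  "suffix_upto k xs = drop (length xs - k) xs"

text \<open>
  The string \<open>t\<^sub>j\<close> exists only for variables of the form \<open>X\<^sub>j \<rightarrow> X\<^sub>l X\<^sub>r\<close>, and the sum defining
  \<open>\<alpha>\<close> ranges over these only. A variable \<open>X\<^sub>j \<rightarrow> a\<close> could satisfy \<open>|X\<^sub>j| \<ge> m\<close> only for \<open>m = 1\<close>.
\<close>

definition t_string :: "slp \<Rightarrow> nat \<Rightarrow> nat \<Rightarrow> nat \<Rightarrow> int list" where
  "t_string G m l r = suffix_upto (m - 1) (val G l) @ take (m - 1) (val G r)"

definition alpha :: "slp \<Rightarrow> nat \<Rightarrow> int" where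
  "alpha G m = (\<Sum>j\<in>{j\<in>{1..length G}. length (val G j) \<ge> m}.
      case rhs_of G j of
        Char a \<Rightarrow> 0
      | Pair l r \<Rightarrow> (int (vOcc G j) - 1) * (int (length (t_string G m l r)) - (int m - 1)))"

section \<open>Convolution\<close>

text \<open>The argument \<open>i\<close> is a 1-based position, \<open>1 \<le> i \<le> length S - length P + 1\<close>.\<close>

definition conv :: "int list \<Rightarrow> int list \<Rightarrow> nat \<Rightarrow> int" where
  "conv S P i = (\<Sum>j=1..length P. P ! (j - 1) * S ! (i + j - 1 - 1))"

section \<open>The word RAM\<close>

text \<open>
  The machine has word registers, and memory organised in arrays whose names are fixed by the
  program text; a program mentions only finitely many arrays, so interleaving them gives
  one linear memory. There are two kinds of memory cells.

  \<^item> Word cells hold natural numbers below a bound \<open>B\<close>, on which arithmetic is modulo \<open>B\<close>.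
    They hold lengths, positions, variable indices and addresses, and are the only values that can
    be tested or used as addresses. The bound \<open>B = 2 ^ (k * w)\<close> means that a cell consists of
    \<open>k\<close> consecutive computer words of \<open>w\<close> bits; with \<open>k\<close> constant, this changes time and
    space by a constant factor only, and a value like \<open>N\<close> or \<open>2 * N\<close> fits in a cell even if
    \<open>w = log\<^sub>2 N\<close>.

  \<^item> Number cells hold characters and convolution values. They can only be copied, combined by ring
    operations, and convolved. In particular no number can be converted to a word or compared,
    so the unbounded size of numbers cannot be used to speed up other computations.
\<close>

datatype wop = WAdd | WSub | WMul | WDiv | WMod | WAnd | WOr | WXor | WShl | WShr

fun wop_result :: "wop \<Rightarrow> nat \<Rightarrow> nat \<Rightarrow> nat \<Rightarrow> nat" where
  "wop_result WAdd B a b = (a + b) mod B"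
| "wop_result WSub B a b = (a + (B - b)) mod B"
| "wop_result WMul B a b = (a * b) mod B"
| "wop_result WDiv B a b = (a div b) mod B"
| "wop_result WMod B a b = (a mod b) mod B"
| "wop_result WAnd B a b = and a b mod B"
| "wop_result WOr B a b = or a b mod B"
| "wop_result WXor B a b = xor a b mod B"
| "wop_result WShl B a b = push_bit b a mod B"
| "wop_result WShr B a b = drop_bit b a mod B"

datatype nop = NAdd | NSub | NMul

fun nop_result :: "nop \<Rightarrow> int \<Rightarrow> int \<Rightarrow> int" where
  "nop_result NAdd x y = x + y"
| "nop_result NSub x y = x - y"
| "nop_result NMul x y = x * y"

datatype test = TEq nat nat | TLess nat nat

record state =
  reg :: "nat \<Rightarrow> nat"
  wmem :: "nat \<Rightarrow> nat \<Rightarrow> nat"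
  nmem :: "nat \<Rightarrow> nat \<Rightarrow> int"

fun holds :: "test \<Rightarrow> state \<Rightarrow> bool" where
  "holds (TEq r s) \<sigma> \<longleftrightarrow> reg \<sigma> r = reg \<sigma> s"
| "holds (TLess r s) \<sigma> \<longleftrightarrow> reg \<sigma> r < reg \<sigma> s"

type_synonym cell = "nat \<times> nat" \<comment> \<open>an array name, and the register holding the index\<close>

datatype com =
    Const nat nat             \<comment> \<open>register, constant\<close>
  | WOp wop nat nat nat       \<comment> \<open>target register, two argument registers\<close>
  | Load nat cell
  | Store cell nat
  | NConst cell int
  | NCopy cell cell
  | NOp nop cell cell cell
  | Convolve cell cell nat cell nat
      \<comment> \<open>target, text vector and register with its length, pattern vector and register with its length\<close>
  | Skip
  | Seq com com
  | If test com com
  | While test com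

definition set_reg :: "nat \<Rightarrow> nat \<Rightarrow> state \<Rightarrow> state" where
  "set_reg r v \<sigma> = \<sigma>\<lparr>reg := (reg \<sigma>)(r := v)\<rparr>"

definition get_word :: "cell \<Rightarrow> state \<Rightarrow> nat" where
  "get_word x \<sigma> = wmem \<sigma> (fst x) (reg \<sigma> (snd x))"

definition set_word :: "cell \<Rightarrow> nat \<Rightarrow> state \<Rightarrow> state" where
  "set_word x v \<sigma> =
     \<sigma>\<lparr>wmem := (wmem \<sigma>)(fst x := (wmem \<sigma> (fst x))(reg \<sigma> (snd x) := v))\<rparr>"

definition get_num :: "cell \<Rightarrow> state \<Rightarrow> int" where
  "get_num x \<sigma> = nmem \<sigma> (fst x) (reg \<sigma> (snd x))"

definition set_num :: "cell \<Rightarrow> int \<Rightarrow> state \<Rightarrow> state" where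
  "set_num x v \<sigma> =
     \<sigma>\<lparr>nmem := (nmem \<sigma>)(fst x := (nmem \<sigma> (fst x))(reg \<sigma> (snd x) := v))\<rparr>"

definition get_nums :: "cell \<Rightarrow> nat \<Rightarrow> state \<Rightarrow> int list" where
  "get_nums x k \<sigma> = map (\<lambda>i. nmem \<sigma> (fst x) (reg \<sigma> (snd x) + i)) [0..<k]"

definition set_nums :: "cell \<Rightarrow> int list \<Rightarrow> state \<Rightarrow> state" where
  "set_nums x vs \<sigma> =
     (let a = fst x; s = reg \<sigma> (snd x) in
      \<sigma>\<lparr>nmem := (nmem \<sigma>)(a := (\<lambda>i. if s \<le> i \<and> i < s + length vs then vs ! (i - s)
                                   else nmem \<sigma> a i))\<rparr>)"

text \<open>
  The logarithm occurring in a time bound is at least 1; \<open>lg x\<close> is \<open>log\<^sub>2 x\<close> for \<open>x \<ge> 2\<close>,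
  and differs from it only for \<open>x \<le> 1\<close>.
\<close>

definition lg :: "nat \<Rightarrow> real" where
  "lg x = max 1 (log 2 (real x))"

text \<open>
  \<open>exec B c \<sigma> t \<tau>\<close>: started in state \<open>\<sigma>\<close>, program \<open>c\<close> terminates in state \<open>\<tau>\<close> after time \<open>t\<close>.
  All operations and tests take unit time, except for the convolution of a vector of length
  \<open>N'\<close> with a vector of length \<open>m'\<close>, which takes time \<open>N' log m'\<close>.
\<close>

inductive exec :: "nat \<Rightarrow> com \<Rightarrow> state \<Rightarrow> nat \<Rightarrow> state \<Rightarrow> bool" for B :: nat where
  "exec B (Const r v) \<sigma> 1 (set_reg r (v mod B) \<sigma>)"
| "exec B (WOp f r s u) \<sigma> 1 (set_reg r (wop_result f B (reg \<sigma> s) (reg \<sigma> u)) \<sigma>)"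
| "exec B (Load r x) \<sigma> 1 (set_reg r (get_word x \<sigma>) \<sigma>)"
| "exec B (Store x r) \<sigma> 1 (set_word x (reg \<sigma> r) \<sigma>)"
| "exec B (NConst x v) \<sigma> 1 (set_num x v \<sigma>)"
| "exec B (NCopy x y) \<sigma> 1 (set_num x (get_num y \<sigma>) \<sigma>)"
| "exec B (NOp f x y z) \<sigma> 1 (set_num x (nop_result f (get_num y \<sigma>) (get_num z \<sigma>)) \<sigma>)"
| "\<lbrakk> N' = reg \<sigma> len; m' = reg \<sigma> plen; 1 \<le> m'; m' \<le> N';
     reg \<sigma> (snd y) + N' \<le> B; reg \<sigma> (snd z) + m' \<le> B;
     reg \<sigma> (snd x) + (N' - m' + 1) \<le> B;
     vs = map (conv (get_nums y N' \<sigma>) (get_nums z m' \<sigma>)) [1..<N' - m' + 2] \<rbrakk>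
   \<Longrightarrow> exec B (Convolve x y len z plen) \<sigma> (nat \<lceil>real N' * lg m'\<rceil>) (set_nums x vs \<sigma>)"
| "exec B Skip \<sigma> 1 \<sigma>"
| "exec B c \<sigma> t1 \<sigma>' \<Longrightarrow> exec B d \<sigma>' t2 \<tau> \<Longrightarrow> exec B (Seq c d) \<sigma> (t1 + t2) \<tau>"
| "holds b \<sigma> \<Longrightarrow> exec B c \<sigma> t \<tau> \<Longrightarrow> exec B (If b c d) \<sigma> (1 + t) \<tau>"
| "\<not> holds b \<sigma> \<Longrightarrow> exec B d \<sigma> t \<tau> \<Longrightarrow> exec B (If b c d) \<sigma> (1 + t) \<tau>"
| "holds b \<sigma> \<Longrightarrow> exec B c \<sigma> t1 \<sigma>' \<Longrightarrow> exec B (While b c) \<sigma>' t2 \<tau> \<Longrightarrow>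
     exec B (While b c) \<sigma> (1 + t1 + t2) \<tau>"
| "\<not> holds b \<sigma> \<Longrightarrow> exec B (While b c) \<sigma> 1 \<sigma>"

lemma exec_deterministic:
  "exec B c \<sigma> t \<tau> \<Longrightarrow> exec B c \<sigma> t' \<tau>' \<Longrightarrow> t' = t \<and> \<tau>' = \<tau>"
proof (induction arbitrary: t' \<tau>' rule: exec.induct)
  case (10 c \<sigma> t1 \<sigma>' d t2 \<tau>)
  from 10(5) show ?case by cases (use 10 in blast)
next
  case (11 b \<sigma> c t \<tau> d)
  from 11(4) show ?case by cases (use 11 in blast)+
next
  case (12 b \<sigma> d t \<tau> c)
  from 12(4) show ?case by cases (use 12 in blast)+
next
  case (13 b \<sigma> c t1 \<sigma>' t2 \<tau>)
  from 13(6) show ?case by cases (use 13 in blast)+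
qed (erule exec.cases; simp)+

text \<open>
  Data of a program: a sequence of words and a sequence of numbers. Input is
  placed in the arrays named 0, with a few further words in the first registers; all other registers
  and cells are initially 0. Output is read from the initial segments of the arrays named 1,
  whose lengths are given by registers 0 and 1.
\<close>

type_synonym mem_data = "nat list \<times> int list"

definition mem_size :: "mem_data \<Rightarrow> nat" where
  "mem_size D = length (fst D) + length (snd D)"

definition start :: "nat list \<Rightarrow> mem_data \<Rightarrow> state" where
  "start args D =
     \<lparr>reg = (\<lambda>r. if r < length args then args ! r else 0),
      wmem = (\<lambda>a i. if a = 0 \<and> i < length (fst D) then fst D ! i else 0),
      nmem = (\<lambda>a i. if a = 0 \<and> i < length (snd D) then snd D ! i else 0)\<rparr>"

definition result_of :: "state \<Rightarrow> mem_data" where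
  "result_of \<tau> = (map (wmem \<tau> 1) [0..<reg \<tau> 0], map (nmem \<tau> 1) [0..<reg \<tau> 1])"

definition run :: "nat \<Rightarrow> com \<Rightarrow> nat list \<Rightarrow> mem_data \<Rightarrow> nat \<Rightarrow> mem_data \<Rightarrow> bool" where
  "run B c args D t E \<longleftrightarrow> (\<exists>\<tau>. exec B c (start args D) t \<tau> \<and> result_of \<tau> = E)"

text \<open>
  Two words and one number per variable (the words are 0 for \<open>X\<^sub>i \<rightarrow> a\<close>, the number is 0 for
  \<open>X\<^sub>i \<rightarrow> X\<^sub>l X\<^sub>r\<close>), followed by the characters of the pattern.
\<close>

definition encode :: "slp \<Rightarrow> int list \<Rightarrow> mem_data" where
  "encode G P =
     (concat (map (\<lambda>e. case e of Char a \<Rightarrow> [0, 0] | Pair l r \<Rightarrow> [l, r]) G),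
      map (\<lambda>e. case e of Char a \<Rightarrow> a | Pair l r \<Rightarrow> 0) G @ P)"

end

theory Submission
  imports Defs
begin

text \<open>
  A depth-first traversal of the SLP emits a text \<open>T\<close>: the first visit of a variable expands it, and every later
  visit copies a fragment of \<open>O(m)\<close> characters, the two borders of its value, from the part of \<open>T\<close> already written.
  Every length-\<open>m\<close> window of \<open>S\<close> that crosses the border of the two halves of some variable then occurs in \<open>T\<close>,
  and \<open>|T|\<close> is \<open>O(min {n m, N - \<alpha>})\<close>: for \<open>m \<ge> 2\<close>, up to \<open>m - 1\<close>, \<open>N - \<alpha>\<close> is the sum over the variables of length
  at least \<open>m\<close> of the number of windows that they have across their border. One convolution of \<open>T\<close> with the pattern
  therefore contains all entries of \<open>C\<close>.

  It remains to find, for a position of \<open>S\<close>, the variable whose border its window crosses. The grammar of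
  the variables of length at least \<open>m\<close> may be deep. Its edges along which the bit lengths of the number of windows
  and of the number of occurrences in the derivation tree both stay the same form disjoint paths. A path is left at most
  \<open>O(log N)\<close> times, since one of the bit lengths changes each time. Inside a path, the place where the
  query leaves it is found in a search tree, in which the node of largest level becomes the root, the level of a node being
  the largest power of two of which a multiple separates its length from that of its successor.
  The steps telescope with the bit lengths, so that all searches together take \<open>O(log N)\<close> steps.
\<close>

section \<open>Bit lengths\<close>

text \<open>Two obstacles shape the query part. Following from each node the child with more windows
  gives forests instead of paths, because a variable can be the larger child of many parents.
  Comparing occurrence counts as well leaves at most one predecessor; this is the symmetric centroid
  decomposition of a grammar. Moreover, a plain binary search on each path would cost a logarithm
  per path and its square in total. The trees are therefore biased: a node that splits many windows
  off its path gets a high level, hence a place near the root. The machine cannot compute bit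
  lengths. It tests their equality by comparing an xor with an and, and it compares the xors
  themselves instead of the levels, which is sound because ties of levels can be excluded. Word
  arithmetic is modular, so absence of overflow has to be shown everywhere. To this end the
  traversal is first a function with a known final state; all its counters only grow, so that bounds
  on the final state cover every intermediate one. The case \<open>m = 1\<close> is exceptional: no
  window crosses a border, \<alpha> is 0, and the windows are the single characters.\<close>

definition bl :: "nat \<Rightarrow> nat" where
  "bl z = (LEAST h. z < 2 ^ h)"

lemma less_2_bl: "z < 2 ^ bl z"
  unfolding bl_def by (rule LeastI[of _ z]) simp

lemma bl_le_iff: "bl z \<le> h \<longleftrightarrow> z < 2 ^ h"
proof
  assume "bl z \<le> h"
  then have "(2::nat) ^ bl z \<le> 2 ^ h" by simp
  then show "z < 2 ^ h" using less_2_bl[of z] by linarith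
qed (auto simp: bl_def intro: Least_le)

lemma bl_mono: "x \<le> y \<Longrightarrow> bl x \<le> bl y"
  unfolding bl_le_iff using less_2_bl[of y] by linarith

lemma bl_0_iff: "bl z = 0 \<longleftrightarrow> z = 0"
  using bl_le_iff[of z 0] by simp

lemma bl_ge: "1 \<le> z \<Longrightarrow> 1 \<le> bl z \<and> 2 ^ (bl z - 1) \<le> z"
  using bl_0_iff[of z] bl_le_iff[of z "bl z - 1"] by linarith

text \<open>Both numbers have the same top bit, so their sum carries beyond it.\<close>

lemma bl_add:
  assumes "1 \<le> x" "bl x = bl y" shows "bl x < bl (x + y)"
proof -
  have "1 \<le> y" using assms bl_0_iff[of x] bl_0_iff[of y] by linarith
  then have ge: "2 ^ (bl x - 1) \<le> x" "2 ^ (bl x - 1) \<le> y" "1 \<le> bl x"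
    using bl_ge[of x] bl_ge[of y] assms by metis+
  have "(2::nat) ^ bl x = 2 ^ (bl x - 1) + 2 ^ (bl x - 1)" using ge(3) by (cases "bl x") simp_all
  then have "2 ^ bl x \<le> x + y" using ge(1,2) by linarith
  then show ?thesis using bl_le_iff[of "x + y" "bl x"] by linarith
qed

lemma bl_log: "1 \<le> z \<Longrightarrow> real (bl z) \<le> log 2 (real z) + 1"
proof -
  assume z: "1 \<le> z"
  then have "2 ^ (bl z - 1) \<le> z" "1 \<le> bl z" using bl_ge by auto
  then have "real (bl z - 1) \<le> log 2 (real z)" by (intro le_log2_of_power) simp
  then show ?thesis using \<open>1 \<le> bl z\<close> by (simp add: of_nat_diff)
qed

lemma div_0_iff_bl: "z div 2 ^ h = 0 \<longleftrightarrow> bl z \<le> h"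
  by (simp add: bl_le_iff div_eq_0_iff)

lemma xor_div: "xor s e div 2 ^ h = xor (s div 2 ^ h) (e div 2 ^ h)" for s e :: nat
  by (simp flip: drop_bit_eq_div)

lemma and_div: "and s e div 2 ^ h = and (s div 2 ^ h) (e div 2 ^ h)" for s e :: nat
  by (simp flip: drop_bit_eq_div)

text \<open>The bit length of a xor marks the highest bit in which two numbers differ. Through this
  equivalence, levels are handled by divisions, and bits no longer occur.\<close>

lemma bl_xor_le_iff: "bl (xor s e) \<le> h \<longleftrightarrow> s div 2 ^ h = e div 2 ^ h"
proof -
  have "xor x y = 0 \<longleftrightarrow> x = y" for x y :: nat
    by (metis xor.assoc xor.left_neutral xor.right_neutral xor_self_eq)
  then show ?thesis unfolding div_0_iff_bl[symmetric] xor_div by simp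
qed

text \<open>Numbers that agree above bit \<open>h\<close> lie in one aligned block of length
  \<open>2 ^ h\<close>. This is what bounds the size of a subtree hanging off a path by the level of
  the node where it hangs.\<close>

lemma bl_diff_le_xor: "s \<le> e \<Longrightarrow> bl (e - s) \<le> bl (xor s e)"
proof -
  assume "s \<le> e"
  let ?h = "bl (xor s e)"
  have "s div 2 ^ ?h = e div 2 ^ ?h" using bl_xor_le_iff[of s e ?h] by simp
  moreover have "e - s < d" if "e < d + k" "k \<le> s" "0 < d" for d k :: nat using that by linarith
  ultimately have "e - s < 2 ^ ?h"
    using dividend_less_div_times[of "2 ^ ?h" e] div_times_less_eq_dividend[of s "2 ^ ?h"] by simp
  then show ?thesis by (simp add: bl_le_iff)
qed

lemma bl_xor_le: "s \<le> e \<Longrightarrow> bl (xor s e) \<le> bl e"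
  using bl_xor_le_iff[of s e "bl e"] bl_mono[of s e] div_0_iff_bl[of s "bl e"] div_0_iff_bl[of e "bl e"] by simp

text \<open>A constant-time test for equal bit lengths of positive numbers: a common top bit
  vanishes in the xor and survives in the and, whereas the larger of two different top bits does the
  opposite.\<close>

definition same :: "nat \<Rightarrow> nat \<Rightarrow> bool" where
  "same a b \<longleftrightarrow> xor a b < and a b"

lemma same_iff: "same a b \<longleftrightarrow> 1 \<le> a \<and> 1 \<le> b \<and> bl a = bl b"
proof -
  have eq: "bl a = bl b \<Longrightarrow> 1 \<le> a \<Longrightarrow> same a b" for a b
  proof -
    assume a: "bl a = bl b" "1 \<le> a"
    then have "bl a \<noteq> 0" using bl_0_iff[of a] by simp
    then obtain h where h: "bl a = Suc h" using not0_implies_Suc by blast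
    have "1 \<le> b" using a bl_0_iff[of a] bl_0_iff[of b] by linarith
    have one: "z div 2 ^ h = 1" if "bl z = Suc h" "1 \<le> z" for z
    proof -
      have "2 ^ h \<le> z" "z < 2 ^ h * 2" using bl_ge[OF that(2)] less_2_bl[of z] that by auto
      then show ?thesis by (simp add: div_nat_eqI)
    qed
    have "a div 2 ^ h = 1" "b div 2 ^ h = 1" using one h a \<open>1 \<le> b\<close> by auto
    then have "xor a b div 2 ^ h = 0" "and a b div 2 ^ h \<noteq> 0" by (simp_all add: xor_div and_div)
    then have "xor a b < 2 ^ h" "2 ^ h \<le> and a b" unfolding div_0_iff_bl bl_le_iff by simp_all
    then show "same a b" by (simp add: same_def)
  qed
  have ne: "\<not> same a b" if "bl a < bl b" for a b
  proof -
    have "bl b \<noteq> 0" using that by linarith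
    then obtain h where h: "bl b = Suc h" using not0_implies_Suc by blast
    have "a div 2 ^ h = 0" using that h div_0_iff_bl by auto
    moreover have "b div 2 ^ h \<noteq> 0" using h div_0_iff_bl by auto
    ultimately have "xor a b div 2 ^ h \<noteq> 0" "and a b div 2 ^ h = 0" by (simp_all add: xor_div and_div)
    then have "2 ^ h \<le> xor a b" "and a b < 2 ^ h" unfolding div_0_iff_bl bl_le_iff by simp_all
    then show ?thesis by (simp add: same_def)
  qed
  have sym: "same a b = same b a" for a b by (simp add: same_def and.commute xor.commute)
  have "same a b \<Longrightarrow> 1 \<le> a" for a b by (cases a) (auto simp: same_def)
  then show ?thesis using eq[of a b] ne[of a b] ne[of b a] sym[of a b] by (metis nat_neq_iff)
qed

section \<open>Paths with balanced search trees\<close>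

text \<open>Node \<open>i\<close> stands for a sequence of \<open>g i\<close> values, which is the sequence of its left child, the positions
  \<open>g (L i) \<le> y < M i\<close> of its own, and the sequence of its right child; the child 0 is empty.
  The weight \<open>oc\<close> counts occurrences.\<close>

locale grammar_shape =
  fixes q :: nat and L R g M :: "nat \<Rightarrow> nat"
  assumes L_less: "i \<in> {1..q} \<Longrightarrow> L i < i" and R_less: "i \<in> {1..q} \<Longrightarrow> R i < i"
    and g_pos: "i \<in> {1..q} \<Longrightarrow> 1 \<le> g i" and g_0: "g 0 = 0"
    and gL: "i \<in> {1..q} \<Longrightarrow> g (L i) \<le> M i" and gR: "i \<in> {1..q} \<Longrightarrow> M i + g (R i) = g i"
    and gL_less: "i \<in> {1..q} \<Longrightarrow> g (L i) < g i" and gR_less: "i \<in> {1..q} \<Longrightarrow> g (R i) < g i"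

text \<open>Of the occurrence counts only this much is required: a child occurs at least as often as
  a parent, and at least as often as two different parents together.\<close>

locale block_grammar = grammar_shape +
  fixes oc :: "nat \<Rightarrow> nat"
  assumes oc_child: "i \<in> {1..q} \<Longrightarrow> c \<noteq> 0 \<Longrightarrow> L i = c \<or> R i = c \<Longrightarrow> oc i \<le> oc c"
    and oc_children: "i \<in> {1..q} \<Longrightarrow> j \<in> {1..q} \<Longrightarrow> i \<noteq> j \<Longrightarrow> c \<noteq> 0 \<Longrightarrow>
       L i = c \<or> R i = c \<Longrightarrow> L j = c \<or> R j = c \<Longrightarrow> oc i + oc j \<le> oc c"
begin

text \<open>A sum of two positive numbers of the same bit length has a larger bit length. Hence at most one child of \<open>v\<close>
  has the same bit length of \<open>g\<close> as \<open>v\<close>, and at most one parent the same bit length of \<open>oc\<close>, so that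
  these edges form vertex-disjoint paths.\<close>

definition on_path :: "nat \<Rightarrow> nat \<Rightarrow> bool" where
  "on_path v c \<longleftrightarrow> same (oc v) (oc c) \<and> same (g v) (g c)"

definition nxt :: "nat \<Rightarrow> nat" where
  "nxt v = (if on_path v (L v) then L v else if on_path v (R v) then R v else 0)"

text \<open>The bit length of \<open>z v\<close> is the largest \<open>h\<close> such that a multiple of \<open>2 ^ (h - 1)\<close> lies in
  \<open>{g (nxt v)<..g v}\<close>; the node of largest level in a segment of a path becomes the root of its search tree.\<close>

definition z :: "nat \<Rightarrow> nat" where
  "z v = xor (g v) (g (nxt v))"

definition lev :: "nat \<Rightarrow> nat" where
  "lev v = bl (z v)"

definition E :: "(nat \<times> nat) set" where
  "E = {(u, nxt u) |u. u \<in> {1..q} \<and> nxt u \<noteq> 0}"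

lemma not_on_path_0: "\<not> on_path v 0"
  by (simp add: on_path_def same_iff g_0)

lemma nxt_cases:
  assumes "nxt v \<noteq> 0"
  shows "on_path v (nxt v) \<and> (nxt v = L v \<or> nxt v = R v)"
  using assms by (auto simp: nxt_def split: if_splits)

lemma E_iff: "(u, k) \<in> E \<longleftrightarrow> u \<in> {1..q} \<and> k = nxt u \<and> nxt u \<noteq> 0"
  by (auto simp: E_def)

lemma E_edge:
  assumes "(u, k) \<in> E" shows "k < u" "g k < g u" "k \<in> {1..q}" "u \<in> {1..q}" "on_path u k"
proof -
  have u: "u \<in> {1..q}" "k = nxt u" "nxt u \<noteq> 0" using assms by (auto simp: E_iff)
  then have "k = L u \<or> k = R u" "on_path u k" using nxt_cases by auto
  then show "k < u" "g k < g u" "on_path u k" using u L_less R_less gL_less gR_less by auto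
  then show "k \<in> {1..q}" "u \<in> {1..q}" using u by auto
qed

lemma E_trancl:
  assumes "(u, k) \<in> E\<^sup>+"
  shows "k < u \<and> g k < g u \<and> k \<in> {1..q} \<and> u \<in> {1..q}"
  using assms
proof (induction rule: trancl_induct)
  case (base y)
  then show ?case using E_edge[OF base] by simp
next
  case (step y k)
  then show ?case using E_edge[OF step.hyps(2)] by simp
qed

lemma E_rtrancl:
  assumes "(u, k) \<in> E\<^sup>*" "u \<in> {1..q}"
  shows "k \<le> u \<and> g k \<le> g u \<and> k \<in> {1..q} \<and> bl (g k) = bl (g u) \<and> bl (oc k) = bl (oc u) \<and> (1 \<le> oc u \<longrightarrow> 1 \<le> oc k)"
  using assms
proof (induction rule: rtrancl_induct)
  case (step y k)
  then show ?case using E_edge[OF step.hyps(2)] by (auto simp: on_path_def same_iff)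
qed auto

lemma single_child:
  assumes v: "v \<in> {1..q}" and "L v \<noteq> 0" "R v \<noteq> 0" "same (g v) (g (L v))" "same (g v) (g (R v))"
  shows False
proof -
  have "1 \<le> g (L v)" "bl (g (L v)) = bl (g (R v))" "bl (g v) = bl (g (L v))" using assms by (auto simp: same_iff)
  moreover have "g (L v) + g (R v) \<le> g v" using gL[OF v] gR[OF v] by linarith
  ultimately show False using bl_add[of "g (L v)" "g (R v)"] bl_mono[of "g (L v) + g (R v)" "g v"] by linarith
qed

text \<open>If both sides are the same variable, then neither continues the path, since two children
  with the bit length of their parent are impossible. Hence comparing node numbers tells on which
  side a path goes on.\<close>

lemma nxt_child:
  assumes i: "i \<in> {1..q}" "nxt i \<noteq> 0" shows "nxt i = R i \<and> nxt i \<noteq> L i \<or> nxt i = L i \<and> nxt i \<noteq> R i"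
proof -
  have "L i = R i \<Longrightarrow> False"
    using single_child[OF i(1)] nxt_cases[OF i(2)] i(2) unfolding on_path_def by metis
  then show ?thesis using nxt_cases[OF i(2)] by auto
qed

lemma off_path_iff:
  assumes v: "v \<in> {1..q}" and c: "c = L v \<or> c = R v" "c \<noteq> 0" and n: "nxt v \<noteq> c"
  shows "\<not> on_path v c"
proof
  assume on: "on_path v c"
  then have "c = R v" "c \<noteq> L v" "on_path v (L v)" using c n by (auto simp: nxt_def split: if_splits)
  then show False using single_child[OF v] on not_on_path_0[of v] unfolding on_path_def by metis
qed

lemma unique_parent:
  assumes "(u, k) \<in> E" "(u', k) \<in> E" shows "u = u'"
proof (rule ccontr)
  assume ne: "u \<noteq> u'"
  have k: "k \<noteq> 0" "L u = k \<or> R u = k" "L u' = k \<or> R u' = k" "u \<in> {1..q}" "u' \<in> {1..q}"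
    using assms nxt_cases[of u] nxt_cases[of u'] by (auto simp: E_iff)
  have "oc u + oc u' \<le> oc k" using oc_children[OF k(4,5) ne k(1-3)] .
  moreover have "1 \<le> oc u" "bl (oc u) = bl (oc k)" "bl (oc u') = bl (oc k)"
    using E_edge(5)[OF assms(1)] E_edge(5)[OF assms(2)] by (auto simp: on_path_def same_iff)
  ultimately show False using bl_add[of "oc u" "oc u'"] bl_mono[of "oc u + oc u'" "oc k"] by linarith
qed

lemma linear_down:
  assumes "(u, k) \<in> E\<^sup>*" "(u, k') \<in> E\<^sup>*" shows "(k, k') \<in> E\<^sup>* \<or> (k', k) \<in> E\<^sup>*"
  by (rule single_valued_confluent[OF _ assms]) (auto simp: single_valued_def E_iff)

lemma linear_up:
  assumes "(u, k) \<in> E\<^sup>*" "(u', k) \<in> E\<^sup>*" shows "(u, u') \<in> E\<^sup>* \<or> (u', u) \<in> E\<^sup>*"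
proof -
  have "single_valued (E\<inverse>)" using unique_parent by (auto simp: single_valued_def)
  then show ?thesis using single_valued_confluent[of "E\<inverse>" k u u'] assms by (auto simp: rtrancl_converse)
qed

lemma not_both: "(u, k) \<in> E\<^sup>* \<Longrightarrow> (k, u) \<in> E\<^sup>+ \<Longrightarrow> False"
  using E_trancl[OF rtrancl_trancl_trancl[of u k E u]] by simp

lemma rtrancl_cases: "(u, k) \<in> E\<^sup>* \<longleftrightarrow> u = k \<or> (u, k) \<in> E\<^sup>+"
  by (auto dest: rtranclD)

lemma trancl_nxt: "(u, k) \<in> E\<^sup>+ \<longleftrightarrow> u \<in> {1..q} \<and> nxt u \<noteq> 0 \<and> (nxt u, k) \<in> E\<^sup>*"
  by (subst trancl_unfold_left) (auto simp: E_iff relcomp_unfold)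

section \<open>Levels along a path and the exclusion of ties\<close>

lemma lev_pos: "u \<in> {1..q} \<Longrightarrow> g (nxt u) < g u"
  using E_edge(2)[of u "nxt u"] g_pos[of u] g_0 by (cases "nxt u = 0") (auto simp: E_iff)

text \<open>A discrete intermediate value principle. It is applied to \<open>g\<close> divided by a
  power of two, where a change across an edge means that its upper node has a larger level.\<close>

lemma div_change:
  assumes "(x, y) \<in> E\<^sup>*" "f x \<noteq> f y"
  shows "\<exists>w. (x, w) \<in> E\<^sup>* \<and> (w, y) \<in> E\<^sup>+ \<and> f w \<noteq> f (nxt w)"
  using assms
proof (induction rule: rtrancl_induct)
  case (step y k)
  show ?case
  proof (cases "f x = f y")
    case True
    then show ?thesis using step by (intro exI[of _ y]) (auto simp: E_iff)
  next
    case False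
    then show ?thesis using step by (meson trancl.trancl_into_trancl)
  qed
qed auto

text \<open>As for the marks of a ruler: a node of level \<open>Suc h\<close> steps across an odd
  multiple of \<open>2 ^ h\<close>, and between two odd multiples there is an even one. The node
  that steps across the latter has a larger level.\<close>

lemma no_tie:
  assumes "(u, e) \<in> E\<^sup>+" "lev u = lev e"
  shows "\<exists>w. (u, w) \<in> E\<^sup>+ \<and> (w, e) \<in> E\<^sup>+ \<and> lev u < lev w"
proof -
  have u: "u \<in> {1..q}" "nxt u \<noteq> 0" "(nxt u, e) \<in> E\<^sup>*" using assms(1) by (auto simp: trancl_nxt)
  have e: "e \<in> {1..q}" using E_trancl[OF assms(1)] by simp
  let ?s = "g (nxt u)" and ?t = "g e"
  have le: "?t \<le> ?s" using E_rtrancl[OF u(3)] E_edge(3)[of u "nxt u"] u by (auto simp: E_iff)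
  define H where "H = lev u"
  have eq: "g u div 2 ^ H = ?s div 2 ^ H" "?t div 2 ^ H = g (nxt e) div 2 ^ H"
    using bl_xor_le_iff[of "g u" ?s H] bl_xor_le_iff[of ?t "g (nxt e)" H] assms(2) by (auto simp: H_def lev_def z_def)
  have "H \<noteq> 0" using bl_xor_le_iff[of "g u" ?s 0] lev_pos[OF u(1)] by (auto simp: H_def lev_def z_def)
  then obtain h where h: "H = Suc h" using not0_implies_Suc by blast
  have ne: "g u div 2 ^ h \<noteq> ?s div 2 ^ h" "?t div 2 ^ h \<noteq> g (nxt e) div 2 ^ h"
    using bl_xor_le_iff[of "g u" ?s h] bl_xor_le_iff[of ?t "g (nxt e)" h] h assms(2) by (auto simp: H_def lev_def z_def)
  have halves: "x div 2 ^ H = x div 2 ^ h div 2" for x :: nat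
    by (simp add: h div_mult2_eq[symmetric] mult.commute)
  \<comment> \<open>Otherwise the quotients by \<open>2 ^ h\<close> of all four numbers lie in a
    single pair of an even number and its successor, although two strict descents give them at least
    three values.\<close>
  have "?s div 2 ^ H \<noteq> ?t div 2 ^ H"
  proof
    assume "?s div 2 ^ H = ?t div 2 ^ H"
    moreover have "?s div 2 ^ h < g u div 2 ^ h" "g (nxt e) div 2 ^ h < ?t div 2 ^ h" "?t div 2 ^ h \<le> ?s div 2 ^ h"
      using ne lev_pos[OF u(1)] lev_pos[OF e] le
      by (simp_all add: div_le_mono order.strict_iff_order)
    ultimately show False using eq unfolding halves by linarith
  qed
  then obtain w where w: "(nxt u, w) \<in> E\<^sup>*" "(w, e) \<in> E\<^sup>+" "g w div 2 ^ H \<noteq> g (nxt w) div 2 ^ H"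
    using div_change[OF u(3), of "\<lambda>x. g x div 2 ^ H"] by auto
  then have "\<not> lev w \<le> H" unfolding lev_def z_def bl_xor_le_iff by simp
  moreover have "(u, w) \<in> E\<^sup>+" using u w(1) by (auto simp: trancl_nxt)
  ultimately show ?thesis using w by (auto simp: H_def)
qed

text \<open>A weak maximum is a strict one, because a tie would force a still larger level in
  between.\<close>

lemma lev_less:
  assumes "(u, e) \<in> E\<^sup>+" "lev e \<le> lev u" "\<And>w. (u, w) \<in> E\<^sup>+ \<Longrightarrow> (w, e) \<in> E\<^sup>+ \<Longrightarrow> lev w \<le> lev u"
  shows "lev e < lev u"
  using no_tie[OF assms(1)] assms(2,3) by fastforce

lemma lev_less':
  assumes "(u, e) \<in> E\<^sup>+" "lev u \<le> lev e" "\<And>w. (u, w) \<in> E\<^sup>+ \<Longrightarrow> (w, e) \<in> E\<^sup>+ \<Longrightarrow> lev w \<le> lev u"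
  shows "lev u < lev e"
  using no_tie[OF assms(1)] assms(2,3) by fastforce

section \<open>Cartesian trees of the paths, built from below\<close>

definition between :: "nat \<Rightarrow> nat \<Rightarrow> nat set" where
  "between v k = {w. (v, w) \<in> E\<^sup>+ \<and> (k = 0 \<or> (w, k) \<in> E\<^sup>+)}"

definition is_top :: "nat set \<Rightarrow> nat \<Rightarrow> bool" where
  "is_top S w \<longleftrightarrow> (S = {} \<and> w = 0) \<or> (w \<in> S \<and> (\<forall>u\<in>S. lev u \<le> lev w))"

text \<open>The next greater element below \<open>v\<close> on its path with respect to levels, or 0
  if there is none. The search tree is the Cartesian tree of the path, so the top of
  \<open>between v k\<close> is the child of \<open>v\<close> on this side.\<close>

definition ng_ok :: "nat \<Rightarrow> nat \<Rightarrow> bool" where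
  "ng_ok v k \<longleftrightarrow> (k = 0 \<or> (v, k) \<in> E\<^sup>+ \<and> lev v < lev k) \<and> (\<forall>w\<in>between v k. lev w < lev v)"

text \<open>Here \<open>k\<close> is the current candidate and \<open>ch\<close> the last rejected
  one. When the scan stops, \<open>ch\<close> is the root of everything skipped, so one scan yields
  both pointers.\<close>

definition pop_inv :: "nat \<Rightarrow> nat \<Rightarrow> nat \<Rightarrow> bool" where
  "pop_inv v k ch \<longleftrightarrow> (k = 0 \<or> (v, k) \<in> E\<^sup>+) \<and> (\<forall>w\<in>between v k. lev w < lev v) \<and>
     (k \<noteq> 0 \<longrightarrow> (\<forall>w\<in>between v k. lev w < lev k)) \<and> is_top (between v k) ch"

lemma pop_init:
  assumes "v \<in> {1..q}" shows "pop_inv v (nxt v) 0"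
proof -
  have "between v (nxt v) = {}" unfolding between_def using not_both by (auto simp: trancl_nxt[of v])
  then show ?thesis using assms by (auto simp: pop_inv_def is_top_def trancl_nxt)
qed

text \<open>This is why the machine may compare \<open>z\<close> in place of levels. A smaller
  \<open>z\<close> gives a level that is at most as large by monotonicity of the bit length, and
  equality is excluded by \<open>no_tie\<close>.\<close>

lemma pop_less:
  assumes "pop_inv v k ch" "k \<noteq> 0" "z k < z v" shows "lev k < lev v"
  by (rule lev_less) (use assms bl_mono[of "z k" "z v"] in \<open>auto simp: pop_inv_def lev_def between_def less_imp_le\<close>)

lemma between_split:
  assumes "(v, k) \<in> E\<^sup>+" "w \<in> between v k'" shows "w \<in> between v k \<or> w = k \<or> w \<in> between k k'"
proof -
  have "(v, w) \<in> E\<^sup>*" "(v, k) \<in> E\<^sup>*" using assms by (auto simp: between_def)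
  then have "(w, k) \<in> E\<^sup>* \<or> (k, w) \<in> E\<^sup>*" by (rule linear_down)
  then show ?thesis using assms(2) by (auto simp: between_def rtrancl_cases)
qed

text \<open>All nodes between \<open>k\<close> and its own next greater node are lower than
  \<open>k\<close>, so the scan may jump over them and \<open>k\<close> is the highest node
  passed.\<close>

lemma pop_step:
  assumes inv: "pop_inv v k ch" and k: "k \<noteq> 0" "z k < z v" and ng: "ng_ok k k'"
  shows "pop_inv v k' k"
proof -
  have less: "lev k < lev v" using pop_less inv k by blast
  have vk: "(v, k) \<in> E\<^sup>+" using inv k by (auto simp: pop_inv_def)
  have vk': "k' = 0 \<or> (v, k') \<in> E\<^sup>+ \<and> (k, k') \<in> E\<^sup>+" using vk ng by (auto simp: ng_ok_def)
  have le: "lev w \<le> lev k" if "w \<in> between v k'" for w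
    using between_split[OF vk that] inv k ng by (auto simp: pop_inv_def ng_ok_def less_imp_le)
  moreover have "k \<in> between v k'" using vk vk' by (auto simp: between_def)
  moreover have "k' \<noteq> 0 \<longrightarrow> lev k < lev k'" using ng by (auto simp: ng_ok_def)
  ultimately show ?thesis using less vk' unfolding pop_inv_def is_top_def by fastforce
qed

lemma pop_exit:
  assumes inv: "pop_inv v k ch" and k: "k = 0 \<or> \<not> z k < z v"
  shows "ng_ok v k \<and> is_top (between v k) ch"
proof -
  have "lev v < lev k" if "k \<noteq> 0"
    by (rule lev_less')
      (use that inv k bl_mono[of "z v" "z k"] in \<open>auto simp: pop_inv_def lev_def between_def less_imp_le\<close>)
  then show ?thesis using inv by (auto simp: pop_inv_def ng_ok_def)
qed

text \<open>The part of the path before \<open>k\<close> that is dominated by \<open>k\<close>,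
  restricted to the nodes inserted so far. Nodes are inserted by increasing number, so every path
  grows at its upper end. The top of this set is the other child of \<open>k\<close> in the
  Cartesian tree.\<close>

definition above :: "nat \<Rightarrow> nat \<Rightarrow> nat set" where
  "above i k = {u\<in>{1..i}. (u, k) \<in> E\<^sup>+ \<and> (\<forall>w. (u, w) \<in> E\<^sup>* \<and> (w, k) \<in> E\<^sup>+ \<longrightarrow> lev w < lev k)}"

definition sh_inv :: "nat \<Rightarrow> (nat \<Rightarrow> nat) \<Rightarrow> bool" where
  "sh_inv i sh \<longleftrightarrow> (\<forall>k\<in>{1..q}. if k \<le> i then is_top (above i k) (sh k) else sh k = 0)"

text \<open>A new node can become the top of the segment before \<open>k\<close> only if
  \<open>k\<close> is its next greater node, so a single assignment maintains all these
  pointers.\<close>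

lemma sh_step:
  assumes inv: "sh_inv i sh" and v: "Suc i \<in> {1..q}" and ng: "ng_ok (Suc i) k"
  shows "sh_inv (Suc i) (sh(k := Suc i))"
  unfolding sh_inv_def
proof
  let ?v = "Suc i"
  fix x assume x: "x \<in> {1..q}"
  have xv: "x = ?v \<Longrightarrow> x \<noteq> k" using ng E_trancl[of ?v k] x by (auto simp: ng_ok_def)
  have split: "above ?v x = above i x \<union> (if (?v, x) \<in> E\<^sup>+ \<and> (\<forall>w. (?v, w) \<in> E\<^sup>* \<and> (w, x) \<in> E\<^sup>+ \<longrightarrow> lev w < lev x) then {?v} else {})"
    by (auto simp: above_def le_Suc_eq)
  have lower: "(?v, u) \<in> E\<^sup>+" if "u \<in> above i x" "(?v, x) \<in> E\<^sup>+" for u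
  proof -
    have "(?v, u) \<in> E\<^sup>* \<or> (u, ?v) \<in> E\<^sup>*"
      by (rule linear_up[of _ x]) (use that in \<open>auto simp: above_def\<close>)
    moreover have "u \<le> i" using that by (simp add: above_def)
    ultimately show ?thesis using E_trancl[of u ?v] by (auto simp: rtrancl_cases)
  qed
  show "if x \<le> ?v then is_top (above ?v x) ((sh(k := ?v)) x) else (sh(k := ?v)) x = 0"
  proof (cases "x = ?v")
    case True
    have "above ?v x = {}" using E_trancl[of _ x] True by (fastforce simp: above_def)
    then show ?thesis using True xv inv x by (auto simp: is_top_def sh_inv_def split: if_splits)
  next
    case ne: False
    show ?thesis
    proof (cases "x \<le> i")
      case False
      then have "x \<noteq> k" using ne ng E_trancl[of ?v k] using x by (auto simp: ng_ok_def)
      then show ?thesis using False ne inv x by (auto simp: sh_inv_def)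
    next
      case True
      then have top: "is_top (above i x) (sh x)" using inv x by (simp add: sh_inv_def)
      show ?thesis
      proof (cases "x = k")
        case xk: True
        have vk: "(?v, x) \<in> E\<^sup>+" "lev ?v < lev x" "\<And>w. w \<in> between ?v x \<Longrightarrow> lev w < lev ?v"
          using ng xk x by (auto simp: ng_ok_def)
        have "lev w < lev x" if "(?v, w) \<in> E\<^sup>*" "(w, x) \<in> E\<^sup>+" for w
          using that vk(2) vk(3)[of w] by (auto simp: rtrancl_cases between_def)
        then have a: "above ?v x = insert ?v (above i x)" unfolding split using vk(1) by auto
        have "lev u \<le> lev ?v" if "u \<in> above i x" for u
          using lower[OF that vk(1)] that vk(3)[of u] by (auto simp: between_def above_def)
        then have "is_top (above ?v x) ?v" unfolding a is_top_def by auto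
        then show ?thesis using True xk by simp
      next
        case xk: False
        show ?thesis
        proof (cases "?v \<in> above ?v x")
          case False
          then have "above ?v x = above i x" using split by (auto split: if_splits)
          then show ?thesis using top True xk by simp
        next
          case va: True
          then have vx: "(?v, x) \<in> E\<^sup>+" "\<And>w. (?v, w) \<in> E\<^sup>* \<Longrightarrow> (w, x) \<in> E\<^sup>+ \<Longrightarrow> lev w < lev x"
            by (auto simp: above_def)
          \<comment> \<open>Now \<open>k\<close> lies strictly between the new node and
            \<open>x\<close>. It is in the old segment already and higher than the new node, so the
            old top stays.\<close>
          have lx: "lev ?v < lev x" using vx by blast
          have k0: "k \<noteq> 0" using ng vx(1) lx by (auto simp: ng_ok_def between_def dest: order.asym)
          then have k: "(?v, k) \<in> E\<^sup>+" "lev ?v < lev k" "\<And>w. w \<in> between ?v k \<Longrightarrow> lev w < lev ?v"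
            using ng by (auto simp: ng_ok_def)
          have "(k, x) \<in> E\<^sup>* \<or> (x, k) \<in> E\<^sup>*" by (rule linear_down[of ?v]) (use k vx in auto)
          moreover have "(x, k) \<notin> E\<^sup>+" using k(3)[of x] vx(1) lx k0 by (auto simp: between_def)
          ultimately have kx: "(k, x) \<in> E\<^sup>+" using xk by (auto simp: rtrancl_cases)
          have "k \<le> i" using E_trancl[OF k(1)] by simp
          moreover have "k \<in> {1..q}" using E_trancl[OF kx] by simp
          moreover have "lev w < lev x" if "(k, w) \<in> E\<^sup>*" "(w, x) \<in> E\<^sup>+" for w
            by (rule vx(2)) (use k(1) that in auto)
          ultimately have "k \<in> above i x" using kx by (auto simp: above_def)
          then have "sh x \<in> above i x" "\<forall>u\<in>above i x. lev u \<le> lev (sh x)" "lev ?v \<le> lev (sh x)"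
            using top k(2) by (fastforce simp: is_top_def)+
          then show ?thesis using True xk split by (auto simp: is_top_def split: if_splits)
        qed
      qed
    qed
  qed
qed

text \<open>The entry point of a query that reaches a path at \<open>v\<close> from outside. Such a
  query leaves the path at \<open>v\<close> or below, so only that part of the path has to be
  searched.\<close>

definition rt_ok :: "nat \<Rightarrow> nat \<Rightarrow> bool" where
  "rt_ok v r \<longleftrightarrow> (v, r) \<in> E\<^sup>* \<and> (\<forall>w. (v, w) \<in> E\<^sup>* \<longrightarrow> lev w \<le> lev r)"

lemma rt_step:
  assumes ng: "ng_ok v k" and r: "k \<noteq> 0 \<Longrightarrow> rt_ok (nxt v) r"
  shows "rt_ok v (if k = 0 then v else r)"
proof (cases "k = 0")
  case True
  then show ?thesis using ng by (auto simp: rt_ok_def ng_ok_def between_def rtrancl_cases less_imp_le)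
next
  case False
  then have vk: "(v, k) \<in> E\<^sup>+" "lev v < lev k" using ng by (auto simp: ng_ok_def)
  then have v: "v \<in> {1..q}" "nxt v \<noteq> 0" "(nxt v, k) \<in> E\<^sup>*" by (auto simp: trancl_nxt)
  have "(v, nxt v) \<in> E" using v by (simp add: E_iff)
  then have "(v, r) \<in> E\<^sup>+" if "(nxt v, r) \<in> E\<^sup>*" using that by simp
  moreover have "lev v \<le> lev r" using r[OF False] v(3) vk(2) by (auto simp: rt_ok_def intro: order_trans less_imp_le)
  moreover have "(nxt v, w) \<in> E\<^sup>*" if "(v, w) \<in> E\<^sup>+" for w using that by (simp add: trancl_nxt)
  ultimately show ?thesis using r[OF False] False unfolding rt_ok_def by (auto simp: rtrancl_cases[of v])
qed

text \<open>The potential of the amortised analysis: the nodes that a stack-based computation of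
  next greater elements would hold on the stacks of all paths together. A node that \<open>v\<close>
  rejects is covered by \<open>v\<close> from then on, and each insertion exposes at most one new
  node.\<close>

definition exposed :: "nat \<Rightarrow> nat set" where
  "exposed i = {u\<in>{1..i}. \<not> (\<exists>w\<in>{1..i}. (w, u) \<in> E\<^sup>+ \<and> lev u < lev w)}"

definition pops :: "nat \<Rightarrow> nat \<Rightarrow> nat set" where
  "pops v k = {u\<in>exposed (v - 1). k \<noteq> 0 \<and> (k, u) \<in> E\<^sup>* \<and> lev u < lev v}"

lemma finite_exposed: "finite (exposed i)" "finite (pops v k)"
  by (simp_all add: exposed_def pops_def)

lemma pops_step:
  assumes inv: "pop_inv v k ch" and k: "k \<noteq> 0" "z k < z v" and ng: "ng_ok k k'"
  shows "card (pops v k') + 1 \<le> card (pops v k)"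
proof -
  have vk: "(v, k) \<in> E\<^sup>+" using inv k by (auto simp: pop_inv_def)
  have less: "lev k < lev v" using pop_less inv k by blast
  have "\<not> lev k < lev w" if w: "w \<in> {1..v - 1}" "(w, k) \<in> E\<^sup>+" for w
  proof -
    have "(v, w) \<in> E\<^sup>* \<or> (w, v) \<in> E\<^sup>*" by (rule linear_up[of _ k]) (use vk w in auto)
    then have "(v, w) \<in> E\<^sup>+" using w(1) E_trancl[of w v] by (auto simp: rtrancl_cases)
    then have "lev w < lev k" using inv k w(2) by (auto simp: pop_inv_def between_def)
    then show ?thesis by simp
  qed
  then have kin: "k \<in> pops v k" using E_trancl[OF vk] less k by (auto simp: pops_def exposed_def)
  have "pops v k' \<subseteq> pops v k - {k}"
  proof
    fix u assume u: "u \<in> pops v k'"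
    then have "(k, k') \<in> E\<^sup>+" "(k', u) \<in> E\<^sup>*" using ng by (auto simp: pops_def ng_ok_def)
    then have "(k, u) \<in> E\<^sup>+" by simp
    then show "u \<in> pops v k - {k}" using u k E_trancl[of k u] by (auto simp: pops_def)
  qed
  then have "card (pops v k') \<le> card (pops v k - {k})" by (intro card_mono finite_Diff finite_exposed)
  then show ?thesis using card_Suc_Diff1[OF finite_exposed(2) kin] by linarith
qed

lemma exposed_step:
  assumes "Suc i \<in> {1..q}"
  shows "card (exposed (Suc i)) + card (pops (Suc i) (nxt (Suc i))) \<le> card (exposed i) + 1"
proof -
  let ?p = "pops (Suc i) (nxt (Suc i))"
  have sub: "?p \<subseteq> exposed i" by (auto simp: pops_def)
  have "exposed (Suc i) \<subseteq> insert (Suc i) (exposed i - ?p)"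
  proof
    fix u assume u: "u \<in> exposed (Suc i)"
    have "u \<notin> ?p"
    proof
      assume "u \<in> ?p"
      then have "(Suc i, u) \<in> E\<^sup>+" "lev u < lev (Suc i)" using assms by (auto simp: pops_def trancl_nxt)
      then show False using u by (auto simp: exposed_def)
    qed
    then show "u \<in> insert (Suc i) (exposed i - ?p)" using u by (auto simp: exposed_def le_Suc_eq)
  qed
  then have "card (exposed (Suc i)) \<le> card (insert (Suc i) (exposed i - ?p))"
    using finite_exposed by (intro card_mono) auto
  also have "\<dots> \<le> card (exposed i - ?p) + 1" using finite_exposed by (simp add: card_insert_if)
  also have "\<dots> = card (exposed i) - card ?p + 1" using sub finite_exposed by (simp add: card_Diff_subset)
  finally show ?thesis using card_mono[OF finite_exposed(1) sub] by linarith
qed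

end


text \<open>The interface between the tables and the query. \<open>ans i\<close> is the sequence
  that node \<open>i\<close> stands for, \<open>ct\<close> the array of precomputed values, and
  \<open>bs i\<close> the place in it where the own values of \<open>i\<close> start.
  \<open>sh\<close> and \<open>ch\<close> are the two children in the Cartesian tree, and
  \<open>rt\<close> is the entry point.\<close>

locale search_structure = block_grammar +
  fixes sh rt ch ng Ls bs :: "nat \<Rightarrow> nat" and ans :: "nat \<Rightarrow> nat \<Rightarrow> int" and ct :: "nat \<Rightarrow> int"
  assumes q1: "1 \<le> q" and oc_q: "oc q = 1" and oc_bound: "i \<in> {1..q} \<Longrightarrow> oc i \<le> g q"
    and ng: "i \<in> {1..q} \<Longrightarrow> ng_ok i (ng i)" and ch: "i \<in> {1..q} \<Longrightarrow> is_top (between i (ng i)) (ch i)"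
    and rt: "i \<in> {1..q} \<Longrightarrow> rt_ok i (rt i)" and sh: "i \<in> {1..q} \<Longrightarrow> is_top (above q i) (sh i)"
    and Ls: "i \<in> {1..q} \<Longrightarrow> nxt i \<noteq> 0 \<Longrightarrow> Ls i = (if nxt i = L i then 0 else M i) + Ls (nxt i)"
    and ansL: "i \<in> {1..q} \<Longrightarrow> y < g (L i) \<Longrightarrow> ans i y = ans (L i) y"
    and ansR: "i \<in> {1..q} \<Longrightarrow> y < g (R i) \<Longrightarrow> ans i (M i + y) = ans (R i) y"
    and ansB: "i \<in> {1..q} \<Longrightarrow> g (L i) \<le> y \<Longrightarrow> y < M i \<Longrightarrow> ans i y = ct (bs i + (y - g (L i)))"
begin

text \<open>A position of a path is represented by its signed distance from the start of the last node of the path,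
  in which node \<open>u\<close> starts at \<open>- Ls u\<close>.\<close>

definition ins :: "int \<Rightarrow> nat \<Rightarrow> bool" where
  "ins X u \<longleftrightarrow> 0 \<le> X + int (Ls u) \<and> X + int (Ls u) < int (g u)"

definition exits :: "int \<Rightarrow> nat \<Rightarrow> bool" where
  "exits X e \<longleftrightarrow> ins X e \<and> (nxt e \<noteq> 0 \<longrightarrow> \<not> ins X (nxt e))"

text \<open>In terms of the Cartesian tree: \<open>e\<close> lies in the subtree with root
  \<open>t\<close>. Nodes on both sides of \<open>t\<close> have to be allowed.\<close>

definition best :: "nat \<Rightarrow> nat \<Rightarrow> bool" where
  "best t e \<longleftrightarrow> ((t, e) \<in> E\<^sup>* \<or> (e, t) \<in> E\<^sup>*) \<and>
     (\<forall>w. (t, w) \<in> E\<^sup>* \<and> (w, e) \<in> E\<^sup>* \<or> (e, w) \<in> E\<^sup>* \<and> (w, t) \<in> E\<^sup>* \<longrightarrow> lev w \<le> lev t)"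

definition qinv :: "int \<Rightarrow> nat \<Rightarrow> nat \<Rightarrow> nat \<Rightarrow> nat \<Rightarrow> bool" where
  "qinv a t y lv e \<longleftrightarrow> t \<in> {1..q} \<and> e \<in> {1..q} \<and> exits (int y - int lv) e \<and>
     ans e (nat (int y - int lv + int (Ls e))) = a \<and> best t e \<and> 1 \<le> oc e"

text \<open>A step inside a search tree lowers the level of the current node. A change of path never
  raises that level, and it shortens the bit length of \<open>g\<close> or lengthens that of
  \<open>oc\<close>. Hence every step lowers the sum.\<close>

definition qpot :: "nat \<Rightarrow> nat \<Rightarrow> nat" where
  "qpot t e = lev t + bl (g e) + (bl (g q) - bl (oc e))"

section \<open>Steps of a query and the decrease of its potential\<close>

lemma ins_up:
  assumes "(u, k) \<in> E" "ins X k"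
  shows "ins X u \<and> ans u (nat (X + int (Ls u))) = ans k (nat (X + int (Ls k)))"
proof -
  have u: "u \<in> {1..q}" "k = nxt u" "nxt u \<noteq> 0" using assms by (auto simp: E_iff)
  define y where "y = nat (X + int (Ls k))"
  have y: "X + int (Ls k) = int y" "y < g k" using assms(2) by (auto simp: ins_def y_def)
  consider "k = R u" "k \<noteq> L u" | "k = L u" using nxt_child[OF u(1,3)] u(2) by auto
  then show ?thesis
  proof cases
    case 1
    then have "X + int (Ls u) = int (M u + y)" using Ls[OF u(1,3)] u(2) y(1) by simp
    moreover have "M u + y < g u" using gR[OF u(1)] 1 y by simp
    moreover have "ans u (M u + y) = ans k y" using ansR[OF u(1)] 1 y by simp
    ultimately show ?thesis using y by (simp add: ins_def nat_int_add)
  next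
    case 2
    then have "X + int (Ls u) = int y" using Ls[OF u(1,3)] u(2) y(1) by simp
    moreover have "y < g u" using gL_less[OF u(1)] 2 y by simp
    moreover have "ans u y = ans k y" using ansL[OF u(1)] 2 y by simp
    ultimately show ?thesis using y by (simp add: ins_def)
  qed
qed

lemma ins_up_rtrancl: "(u, k) \<in> E\<^sup>* \<Longrightarrow> ins X k \<Longrightarrow> ins X u"
  by (induction rule: converse_rtrancl_induct) (use ins_up in auto)

lemma exit_exists:
  assumes "c \<in> {1..q}" "ins X c"
  shows "\<exists>e. (c, e) \<in> E\<^sup>* \<and> exits X e \<and> ans e (nat (X + int (Ls e))) = ans c (nat (X + int (Ls c)))"
  using assms
proof (induction c rule: less_induct)
  case (less c)
  show ?case
  proof (cases "nxt c \<noteq> 0 \<and> ins X (nxt c)")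
    case True
    then have ed: "(c, nxt c) \<in> E" using less.prems by (simp add: E_iff)
    obtain e where "(nxt c, e) \<in> E\<^sup>*" "exits X e" "ans e (nat (X + int (Ls e))) = ans (nxt c) (nat (X + int (Ls (nxt c))))"
      using less.IH[of "nxt c"] E_edge(1,3)[OF ed] True by auto
    then show ?thesis using ins_up[OF ed] True ed by (auto intro: converse_rtrancl_into_rtrancl)
  next
    case False
    then show ?thesis using less.prems by (auto simp: exits_def)
  qed
qed

text \<open>All nodes of a path have the same bit length of \<open>g\<close>, and this also bounds
  their levels. So entering a path at \<open>c\<close> brings in a level of at most the bit length
  of \<open>g c\<close>.\<close>

lemma q_start:
  assumes "c \<in> {1..q}" "y < g c" "1 \<le> oc c"
  shows "\<exists>e. qinv (ans c y) (rt c) y (Ls c) e \<and> bl (g e) = bl (g c) \<and> bl (oc e) = bl (oc c) \<and> lev (rt c) \<le> bl (g c)"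
proof -
  have "ins (int y - int (Ls c)) c" using assms by (simp add: ins_def)
  then obtain e where e: "(c, e) \<in> E\<^sup>*" "exits (int y - int (Ls c)) e"
    "ans e (nat (int y - int (Ls c) + int (Ls e))) = ans c y"
    using exit_exists[OF assms(1), of "int y - int (Ls c)"] by auto
  have r: "(c, rt c) \<in> E\<^sup>*" "\<And>w. (c, w) \<in> E\<^sup>* \<Longrightarrow> lev w \<le> lev (rt c)" using rt[OF assms(1)] by (auto simp: rt_ok_def)
  note re = E_rtrancl[OF e(1) assms(1)] and rr = E_rtrancl[OF r(1) assms(1)]
  have "lev w \<le> lev (rt c)" if "(rt c, w) \<in> E\<^sup>* \<and> (w, e) \<in> E\<^sup>* \<or> (e, w) \<in> E\<^sup>* \<and> (w, rt c) \<in> E\<^sup>*" for w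
    by (rule r(2)) (use that r(1) e(1) in auto)
  then have "best (rt c) e" using linear_down[OF r(1) e(1)] by (auto simp: best_def)
  moreover have "lev (rt c) \<le> bl (g (rt c))"
    unfolding lev_def z_def using bl_xor_le[of "g (nxt (rt c))" "g (rt c)"] lev_pos[of "rt c"] rr
    by (simp add: xor.commute)
  ultimately show ?thesis using e re rr assms(3) by (auto simp: qinv_def)
qed

text \<open>A node contains the positions of its successors on the path. If \<open>t\<close> does
  not contain the position, then the exit node is strictly before \<open>t\<close>, in the subtree
  with root \<open>sh t\<close>.\<close>

lemma q_out:
  assumes inv: "qinv a t y lv e" and out: "\<not> (lv \<le> y + Ls t \<and> y + Ls t - lv < g t)"
  shows "qinv a (sh t) y lv e \<and> qpot (sh t) e < qpot t e"
proof -
  let ?X = "int y - int lv"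
  have t: "t \<in> {1..q}" "e \<in> {1..q}" "exits ?X e" "best t e" using inv by (auto simp: qinv_def)
  have "\<not> ins ?X t" using out by (auto simp: ins_def)
  then have "(t, e) \<notin> E\<^sup>*" using ins_up_rtrancl t(3) by (auto simp: exits_def)
  then have et: "(e, t) \<in> E\<^sup>+" using t(4) by (auto simp: best_def rtrancl_cases)
  have le: "lev w \<le> lev t" if "(e, w) \<in> E\<^sup>*" "(w, t) \<in> E\<^sup>*" for w using t(4) that by (auto simp: best_def)
  \<comment> \<open>\<open>best\<close> gives the weak inequality only; a tie would produce a larger
    level inside the same segment.\<close>
  have less: "lev w < lev t" if w: "(e, w) \<in> E\<^sup>*" "(w, t) \<in> E\<^sup>+" for w
  proof (rule ccontr)
    assume "\<not> lev w < lev t"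
    then have "lev w = lev t" using le w by (meson le_neq_implies_less trancl_into_rtrancl)
    then obtain x where x: "(w, x) \<in> E\<^sup>+" "(x, t) \<in> E\<^sup>+" "lev w < lev x" using no_tie[OF w(2)] by blast
    have "(e, x) \<in> E\<^sup>*" using w(1) x(1) by (meson rtrancl_trans trancl_into_rtrancl)
    then show False using le[of x] x \<open>lev w = lev t\<close> by (simp add: trancl_into_rtrancl)
  qed
  have above: "w \<in> above q t" if "(e, w) \<in> E\<^sup>*" "(w, t) \<in> E\<^sup>+" for w
    using that less[OF rtrancl_trans[OF that(1)]] E_trancl[OF that(2)] by (auto simp: above_def)
  have "e \<in> above q t" using above et by blast
  then have s: "sh t \<in> above q t" "\<And>u. u \<in> above q t \<Longrightarrow> lev u \<le> lev (sh t)"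
    using sh[OF t(1)] by (auto simp: is_top_def)
  then have st: "(sh t, t) \<in> E\<^sup>+" "\<And>w. (sh t, w) \<in> E\<^sup>* \<Longrightarrow> (w, t) \<in> E\<^sup>+ \<Longrightarrow> lev w < lev t"
    by (auto simp: above_def)
  have lin: "(sh t, e) \<in> E\<^sup>* \<or> (e, sh t) \<in> E\<^sup>*" by (rule linear_up[of _ t]) (use st et in auto)
  have "lev w \<le> lev (sh t)" if "(sh t, w) \<in> E\<^sup>* \<and> (w, e) \<in> E\<^sup>* \<or> (e, w) \<in> E\<^sup>* \<and> (w, sh t) \<in> E\<^sup>*" for w
  proof (rule s(2))
    have wt: "(w, t) \<in> E\<^sup>+" using that et st(1) by auto
    show "w \<in> above q t"
      unfolding above_def using wt that less st(2) E_trancl[OF wt] by (auto intro: rtrancl_trans)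
  qed
  then have "best (sh t) e" using lin by (auto simp: best_def)
  moreover have "sh t \<in> {1..q}" "lev (sh t) < lev t" using E_trancl[OF st(1)] st by auto
  ultimately show ?thesis using inv by (auto simp: qinv_def qpot_def)
qed

lemma in_below:
  assumes inv: "qinv a t y lv e" and i: "lv \<le> y + Ls t" "y + Ls t - lv < g t"
  shows "(t, e) \<in> E\<^sup>*"
proof -
  let ?X = "int y - int lv"
  have t: "t \<in> {1..q}" "e \<in> {1..q}" "exits ?X e" "best t e" using inv by (auto simp: qinv_def)
  have "ins ?X t" using i by (auto simp: ins_def)
  then have "(e, t) \<notin> E\<^sup>+" using t(3) ins_up_rtrancl by (auto simp: trancl_nxt exits_def)
  then show ?thesis using t(4) by (auto simp: best_def rtrancl_cases)
qed

lemma q_child: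
  assumes inv: "qinv a t y lv e" and i: "lv \<le> y + Ls t" "y + Ls t - lv < g t"
    and c: "c = L t \<and> d = 0 \<or> c = R t \<and> d = M t" and y': "y + Ls t - lv = d + y'" "y' < g c"
  shows "\<exists>e'. qinv a (if nxt t = c then ch t else rt c) y' (Ls c) e' \<and>
     qpot (if nxt t = c then ch t else rt c) e' < qpot t e"
proof -
  let ?X = "int y - int lv"
  have t: "t \<in> {1..q}" "e \<in> {1..q}" "exits ?X e" "best t e" "ans e (nat (?X + int (Ls e))) = a" "1 \<le> oc e"
    using inv by (auto simp: qinv_def)
  have te: "(t, e) \<in> E\<^sup>*" by (rule in_below[OF inv i])
  have pos: "?X + int (Ls t) = int (d + y')" using y'(1) i(1) by linarith
  have c0: "c \<noteq> 0" using y'(2) g_0 by (cases "c = 0") auto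
  have lev_e: "lev w \<le> lev t" if "(t, w) \<in> E\<^sup>*" "(w, e) \<in> E\<^sup>*" for w using t(4) that by (auto simp: best_def)
  show ?thesis
  proof (cases "nxt t = c")
    case True
    then have n0: "nxt t \<noteq> 0" using c0 by simp
    have "Ls t = d + Ls c" using Ls[OF t(1) n0] True c nxt_child[OF t(1) n0] by auto
    then have X: "int y' - int (Ls c) = ?X" using pos by simp
    then have "ins ?X (nxt t)" using True y'(2) pos by (simp add: ins_def)
    then have "e \<noteq> t" using t(3) n0 by (auto simp: exits_def)
    then have te': "(t, e) \<in> E\<^sup>+" using te by (auto simp: rtrancl_cases)
    have less: "lev w < lev t" if "(t, w) \<in> E\<^sup>+" "(w, e) \<in> E\<^sup>*" for w
      by (rule lev_less[OF that(1)])
        (use lev_e that in \<open>blast intro: trancl_into_rtrancl rtrancl_trans\<close>)+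
    note ngt = ng[OF t(1)]
    \<comment> \<open>The exit node comes before the next greater node of \<open>t\<close>, because
      otherwise \<open>t\<close> would not be the highest node up to it.\<close>
    have eb: "w \<in> between t (ng t)" if w: "(t, w) \<in> E\<^sup>+" "(w, e) \<in> E\<^sup>*" for w
    proof (cases "ng t = 0")
      case False
      then have k: "(t, ng t) \<in> E\<^sup>+" "lev t < lev (ng t)" using ngt by (auto simp: ng_ok_def)
      have "(w, ng t) \<in> E\<^sup>* \<or> (ng t, w) \<in> E\<^sup>*" by (rule linear_down[of t]) (use k w in auto)
      moreover have "(ng t, w) \<notin> E\<^sup>*"
      proof
        assume "(ng t, w) \<in> E\<^sup>*"
        then have "(ng t, e) \<in> E\<^sup>*" using w by auto
        then show False using lev_e[OF trancl_into_rtrancl[OF k(1)]] k(2) by simp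
      qed
      ultimately show ?thesis using w by (auto simp: between_def rtrancl_cases)
    qed (use w in \<open>auto simp: between_def\<close>)
    then have "e \<in> between t (ng t)" using te' by blast
    then have s: "ch t \<in> between t (ng t)" "\<And>u. u \<in> between t (ng t) \<Longrightarrow> lev u \<le> lev (ch t)"
      using ch[OF t(1)] by (auto simp: is_top_def)
    have tc: "(t, ch t) \<in> E\<^sup>+" "lev (ch t) < lev t" using s(1) ngt by (auto simp: between_def ng_ok_def)
    have lin: "(ch t, e) \<in> E\<^sup>* \<or> (e, ch t) \<in> E\<^sup>*" by (rule linear_down[of t]) (use tc te in auto)
    have "lev w \<le> lev (ch t)" if w: "(ch t, w) \<in> E\<^sup>* \<and> (w, e) \<in> E\<^sup>* \<or> (e, w) \<in> E\<^sup>* \<and> (w, ch t) \<in> E\<^sup>*" for w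
    proof (rule s(2))
      show "w \<in> between t (ng t)"
      proof (cases "(w, e) \<in> E\<^sup>*")
        case True
        have "(t, w) \<in> E\<^sup>+" using w tc(1) te' True
          by (metis rtrancl_trancl_trancl trancl_rtrancl_trancl)
        then show ?thesis using eb True by blast
      next
        case False
        then have "(e, w) \<in> E\<^sup>*" "(w, ch t) \<in> E\<^sup>*" using w by auto
        then show ?thesis using te' s(1) rtrancl_trancl_trancl[of w "ch t" E "ng t"]
          by (auto simp: between_def)
      qed
    qed
    then have "best (ch t) e" using lin by (auto simp: best_def)
    then have "qinv a (ch t) y' (Ls c) e" using inv E_trancl[OF tc(1)] by (auto simp: qinv_def X)
    then show ?thesis using True tc(2) by (auto simp: qpot_def)
  next
    case False
    \<comment> \<open>A later exit node would put the position inside the successor as well, whereas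
      it belongs to the other child. So the path is left exactly at \<open>t\<close>.\<close>
    have "\<not> (t, e) \<in> E\<^sup>+"
    proof
      assume "(t, e) \<in> E\<^sup>+"
      then have n: "nxt t \<noteq> 0" "(nxt t, e) \<in> E\<^sup>*" by (auto simp: trancl_nxt)
      then have i2: "ins ?X (nxt t)" using ins_up_rtrancl t(3) by (auto simp: exits_def)
      show False
      proof (cases "c = L t")
        case True
        then have "nxt t = R t" "nxt t \<noteq> L t" using False nxt_child[OF t(1) n(1)] by auto
        then have "Ls t = M t + Ls (nxt t)" using Ls[OF t(1) n(1)] by simp
        moreover have "d + y' < M t \<or> c = R t" using c True y'(2) gL[OF t(1)] by auto
        ultimately show False using i2 pos True \<open>nxt t = R t\<close> False by (auto simp: ins_def)
      next
        case cR: False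
        then have "d = M t" "c = R t" using c by auto
        then have "nxt t = L t" using False nxt_child[OF t(1) n(1)] by auto
        then have "Ls t = Ls (nxt t)" using Ls[OF t(1) n(1)] by simp
        then show False using i2 pos \<open>d = M t\<close> \<open>nxt t = L t\<close> gL[OF t(1)] by (auto simp: ins_def)
      qed
    qed
    then have et: "e = t" using te by (auto simp: rtrancl_cases)
    have cr: "c \<in> {1..q}" "g c < g t" "oc t \<le> oc c" "c = L t \<or> c = R t"
      using c c0 L_less[OF t(1)] R_less[OF t(1)] gL_less[OF t(1)] gR_less[OF t(1)] oc_child[OF t(1) c0] t(1) by auto
    have ans: "ans c y' = a"
      using t(5) et pos c ansL[OF t(1), of y'] ansR[OF t(1), of y'] y'(2) by (auto simp: nat_int_add)
    obtain e' where e': "qinv (ans c y') (rt c) y' (Ls c) e'" "bl (g e') = bl (g c)" "bl (oc e') = bl (oc c)"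
       "lev (rt c) \<le> bl (g c)"
      using q_start[OF cr(1) y'(2)] cr(3) t(6) et by auto
    \<comment> \<open>The key inequality of the telescoping: the child that leaves the path shares
      the \<open>g t\<close> values with the successor. The bit length of the remaining number is at
      most the level of \<open>t\<close>, which thus pays for the level at the new entry
      point.\<close>
    have "g c \<le> g t - g (nxt t)"
    proof (cases "nxt t = 0")
      case nz: False
      then have "nxt t = L t \<and> c = R t \<or> nxt t = R t \<and> c = L t" using nxt_child[OF t(1) nz] cr(4) False by auto
      then show ?thesis using gL[OF t(1)] gR[OF t(1)] by auto
    qed (use cr(2) g_0 in auto)
    then have "bl (g c) \<le> bl (g t - g (nxt t))" by (rule bl_mono)
    also have "\<dots> \<le> lev t"
      unfolding lev_def z_def using bl_diff_le_xor[of "g (nxt t)" "g t"] lev_pos[OF t(1)] by (simp add: xor.commute)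
    finally have l: "lev (rt c) \<le> lev t" using e'(4) by simp
    \<comment> \<open>The step itself is paid by the bit length that changes on an edge outside the
      paths.\<close>
    have "\<not> on_path t c" by (rule off_path_iff[OF t(1) cr(4) c0 False])
    moreover have "1 \<le> oc t" "1 \<le> g t" "1 \<le> g c" "1 \<le> oc c" using t(6) et g_pos t(1) cr by auto
    ultimately have "bl (g c) \<noteq> bl (g t) \<or> bl (oc c) \<noteq> bl (oc t)" by (auto simp: on_path_def same_iff)
    then have "bl (g c) < bl (g t) \<or> bl (oc t) < bl (oc c)" using bl_mono[of "g c" "g t"] bl_mono[of "oc t" "oc c"] cr by linarith
    moreover have "bl (g c) \<le> bl (g t)" "bl (oc t) \<le> bl (oc c)" "bl (oc c) \<le> bl (g q)"
      using cr oc_bound by (auto intro: bl_mono)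
    ultimately have "qpot (rt c) e' < qpot t e" using l e'(2,3) et by (auto simp: qpot_def)
    then show ?thesis using e'(1) ans False by auto
  qed
qed

lemma q_hit:
  assumes inv: "qinv a t y lv e" and i: "lv \<le> y + Ls t" "y + Ls t - lv < g t"
    and b: "g (L t) \<le> y + Ls t - lv" "y + Ls t - lv < M t"
  shows "a = ct (bs t + (y + Ls t - lv - g (L t)))"
proof -
  let ?X = "int y - int lv"
  have t: "t \<in> {1..q}" "e \<in> {1..q}" "exits ?X e" "ans e (nat (?X + int (Ls e))) = a"
    using inv by (auto simp: qinv_def)
  have te: "(t, e) \<in> E\<^sup>*" by (rule in_below[OF inv i])
  have "\<not> (t, e) \<in> E\<^sup>+"
  proof
    assume "(t, e) \<in> E\<^sup>+"
    then have n: "nxt t \<noteq> 0" "(nxt t, e) \<in> E\<^sup>*" by (auto simp: trancl_nxt)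
    then have "ins ?X (nxt t)" using ins_up_rtrancl t(3) by (auto simp: exits_def)
    then show False using nxt_child[OF t(1) n(1)] Ls[OF t(1) n(1)] b i by (auto simp: ins_def split: if_splits)
  qed
  then have "e = t" using te by (auto simp: rtrancl_cases)
  moreover have "nat (?X + int (Ls t)) = y + Ls t - lv" using i by simp
  ultimately show ?thesis using t(4) ansB[OF t(1) b] by simp
qed

lemma qpot_start:
  assumes "y < g q"
  shows "\<exists>e. qinv (ans q y) (rt q) y (Ls q) e \<and> qpot (rt q) e \<le> 3 * bl (g q)"
  using q_start[of q y] assms q1 oc_q by (fastforce simp: qpot_def)

end

section \<open>A structured language on top of the word RAM\<close>

datatype ex = K nat | V nat | A nat ex | Plus ex ex | Minus ex ex | Times ex ex | Xor ex ex | And ex ex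

fun ev :: "ex \<Rightarrow> state \<Rightarrow> nat" where
  "ev (K k) \<sigma> = k"
| "ev (V r) \<sigma> = reg \<sigma> r"
| "ev (A a e) \<sigma> = wmem \<sigma> a (ev e \<sigma>)"
| "ev (Plus e f) \<sigma> = ev e \<sigma> + ev f \<sigma>"
| "ev (Minus e f) \<sigma> = ev e \<sigma> - ev f \<sigma>"
| "ev (Times e f) \<sigma> = ev e \<sigma> * ev f \<sigma>"
| "ev (Xor e f) \<sigma> = xor (ev e \<sigma>) (ev f \<sigma>)"
| "ev (And e f) \<sigma> = and (ev e \<sigma>) (ev f \<sigma>)"

text \<open>Registers from 50 on are temporaries of the compiled code. The conditions below exclude
  overflow, so that \<^const>\<open>ev\<close> need not mention the bound \<open>B\<close>.\<close>

fun ok :: "nat \<Rightarrow> ex \<Rightarrow> state \<Rightarrow> bool" where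
  "ok B (K k) \<sigma> \<longleftrightarrow> k < B"
| "ok B (V r) \<sigma> \<longleftrightarrow> r < 50 \<and> reg \<sigma> r < B"
| "ok B (A a e) \<sigma> \<longleftrightarrow> ok B e \<sigma>"
| "ok B (Plus e f) \<sigma> \<longleftrightarrow> ok B e \<sigma> \<and> ok B f \<sigma> \<and> ev e \<sigma> + ev f \<sigma> < B"
| "ok B (Minus e f) \<sigma> \<longleftrightarrow> ok B e \<sigma> \<and> ok B f \<sigma> \<and> ev f \<sigma> \<le> ev e \<sigma> \<and> ev e \<sigma> < B"
| "ok B (Times e f) \<sigma> \<longleftrightarrow> ok B e \<sigma> \<and> ok B f \<sigma> \<and> ev e \<sigma> * ev f \<sigma> < B"
| "ok B (Xor e f) \<sigma> \<longleftrightarrow> ok B e \<sigma> \<and> ok B f \<sigma> \<and> xor (ev e \<sigma>) (ev f \<sigma>) < B"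
| "ok B (And e f) \<sigma> \<longleftrightarrow> ok B e \<sigma> \<and> ok B f \<sigma> \<and> and (ev e \<sigma>) (ev f \<sigma>) < B"

fun tm :: "ex \<Rightarrow> nat" where
  "tm (K k) = 1"
| "tm (V r) = 1"
| "tm (A a e) = tm e + 1"
| "tm (Plus e f) = tm e + tm f + 1"
| "tm (Minus e f) = tm e + tm f + 1"
| "tm (Times e f) = tm e + tm f + 1"
| "tm (Xor e f) = tm e + tm f + 1"
| "tm (And e f) = tm e + tm f + 1"

fun ce :: "nat \<Rightarrow> nat \<Rightarrow> ex \<Rightarrow> com" where
  "ce r d (K k) = Const r k"
| "ce r d (V s) = WOp WOr r s s"
| "ce r d (A a e) = Seq (ce d d e) (Load r (a, d))"
| "ce r d (Plus e f) = Seq (Seq (ce d d e) (ce (d+1) (d+1) f)) (WOp WAdd r d (d+1))"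
| "ce r d (Minus e f) = Seq (Seq (ce d d e) (ce (d+1) (d+1) f)) (WOp WSub r d (d+1))"
| "ce r d (Times e f) = Seq (Seq (ce d d e) (ce (d+1) (d+1) f)) (WOp WMul r d (d+1))"
| "ce r d (Xor e f) = Seq (Seq (ce d d e) (ce (d+1) (d+1) f)) (WOp WXor r d (d+1))"
| "ce r d (And e f) = Seq (Seq (ce d d e) (ce (d+1) (d+1) f)) (WOp WAnd r d (d+1))"

lemmas exec_Seq = exec.intros(10)

lemma set_simps [simp]:
  "reg (set_reg r v \<sigma>) = (reg \<sigma>)(r := v)"
  "wmem (set_reg r v \<sigma>) = wmem \<sigma>"
  "nmem (set_reg r v \<sigma>) = nmem \<sigma>"
  by (simp_all add: set_reg_def)

lemma ev_cong:
  assumes "ok B e \<sigma>" "\<And>s. s < 50 \<Longrightarrow> reg \<tau> s = reg \<sigma> s" "wmem \<tau> = wmem \<sigma>"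
  shows "ev e \<tau> = ev e \<sigma>" "ok B e \<tau>"
  using assms by (induction e) auto

definition wset :: "nat \<Rightarrow> nat \<Rightarrow> nat \<Rightarrow> state \<Rightarrow> state" where
  "wset a i v \<sigma> = \<sigma>\<lparr>wmem := (wmem \<sigma>)(a := (wmem \<sigma> a)(i := v))\<rparr>"

definition nset :: "nat \<Rightarrow> (nat \<Rightarrow> int) \<Rightarrow> state \<Rightarrow> state" where
  "nset a f \<sigma> = \<sigma>\<lparr>nmem := (nmem \<sigma>)(a := f)\<rparr>"

lemma wnset_simps [simp]:
  "reg (wset a i v \<sigma>) = reg \<sigma>"
  "wmem (wset a i v \<sigma>) = (wmem \<sigma>)(a := (wmem \<sigma> a)(i := v))"
  "nmem (wset a i v \<sigma>) = nmem \<sigma>"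
  "reg (nset a f \<sigma>) = reg \<sigma>"
  "wmem (nset a f \<sigma>) = wmem \<sigma>"
  "nmem (nset a f \<sigma>) = (nmem \<sigma>)(a := f)"
  by (simp_all add: wset_def nset_def)

lemma exec_ce:
  assumes "ok B e \<sigma>" "50 \<le> d" "r \<le> d"
  shows "\<exists>\<tau>. exec B (ce r d e) \<sigma> (tm e) \<tau> \<and> reg \<tau> r = ev e \<sigma> \<and>
     (\<forall>s. s \<noteq> r \<and> s < d \<longrightarrow> reg \<tau> s = reg \<sigma> s) \<and> wmem \<tau> = wmem \<sigma> \<and> nmem \<tau> = nmem \<sigma>"
proof -
  have bin: "\<exists>\<tau>. exec B (Seq (Seq (ce d d e) (ce (d+1) (d+1) f)) (WOp g r d (d+1))) \<sigma> (tm e + tm f + 1) \<tau> \<and>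
      reg \<tau> r = wop_result g B (ev e \<sigma>) (ev f \<sigma>) \<and>
     (\<forall>s. s \<noteq> r \<and> s < d \<longrightarrow> reg \<tau> s = reg \<sigma> s) \<and> wmem \<tau> = wmem \<sigma> \<and> nmem \<tau> = nmem \<sigma>"
    if e: "\<And>d r \<sigma>. ok B e \<sigma> \<Longrightarrow> 50 \<le> d \<Longrightarrow> r \<le> d \<Longrightarrow> \<exists>\<tau>. exec B (ce r d e) \<sigma> (tm e) \<tau> \<and> reg \<tau> r = ev e \<sigma> \<and>
     (\<forall>s. s \<noteq> r \<and> s < d \<longrightarrow> reg \<tau> s = reg \<sigma> s) \<and> wmem \<tau> = wmem \<sigma> \<and> nmem \<tau> = nmem \<sigma>"
    and f: "\<And>d r \<sigma>. ok B f \<sigma> \<Longrightarrow> 50 \<le> d \<Longrightarrow> r \<le> d \<Longrightarrow> \<exists>\<tau>. exec B (ce r d f) \<sigma> (tm f) \<tau> \<and> reg \<tau> r = ev f \<sigma> \<and>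
     (\<forall>s. s \<noteq> r \<and> s < d \<longrightarrow> reg \<tau> s = reg \<sigma> s) \<and> wmem \<tau> = wmem \<sigma> \<and> nmem \<tau> = nmem \<sigma>"
    and okef: "ok B e \<sigma>" "ok B f \<sigma>" and d: "50 \<le> d" "r \<le> d" for g d e f r \<sigma>
  proof -
    obtain \<tau>1 where 1: "exec B (ce d d e) \<sigma> (tm e) \<tau>1" "reg \<tau>1 d = ev e \<sigma>"
      "\<And>s. s < d \<Longrightarrow> reg \<tau>1 s = reg \<sigma> s" "wmem \<tau>1 = wmem \<sigma>" "nmem \<tau>1 = nmem \<sigma>"
      using e[OF okef(1) d(1) order_refl] by auto
    have ok1: "ok B f \<tau>1" and ev1: "ev f \<tau>1 = ev f \<sigma>"
      using ev_cong[OF okef(2), of \<tau>1] 1 d by auto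
    obtain \<tau>2 where 2: "exec B (ce (d+1) (d+1) f) \<tau>1 (tm f) \<tau>2" "reg \<tau>2 (d+1) = ev f \<sigma>"
      "\<And>s. s < d+1 \<Longrightarrow> reg \<tau>2 s = reg \<tau>1 s" "wmem \<tau>2 = wmem \<tau>1" "nmem \<tau>2 = nmem \<tau>1"
      using f[OF ok1, of "d+1" "d+1"] d ev1 by auto
    have "exec B (Seq (Seq (ce d d e) (ce (d+1) (d+1) f)) (WOp g r d (d+1))) \<sigma> (tm e + tm f + 1)
        (set_reg r (wop_result g B (reg \<tau>2 d) (reg \<tau>2 (d+1))) \<tau>2)"
      by (rule exec_Seq[OF exec_Seq[OF 1(1) 2(1)] exec.intros(2)])
    then show ?thesis using 1 2
      by (intro exI[of _ "set_reg r (wop_result g B (reg \<tau>2 d) (reg \<tau>2 (d+1))) \<tau>2"]) auto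
  qed
  show ?thesis using assms
  proof (induction e arbitrary: d r \<sigma>)
    case (K x)
    have "exec B (Const r x) \<sigma> 1 (set_reg r (x mod B) \<sigma>)" by (rule exec.intros)
    then show ?case using K by (intro exI[of _ "set_reg r (x mod B) \<sigma>"]) auto
  next
    case (V x)
    have "exec B (WOp WOr r x x) \<sigma> 1 (set_reg r (wop_result WOr B (reg \<sigma> x) (reg \<sigma> x)) \<sigma>)"
      by (rule exec.intros)
    then show ?case using V
      by (intro exI[of _ "set_reg r (wop_result WOr B (reg \<sigma> x) (reg \<sigma> x)) \<sigma>"]) auto
  next
    case (A a e)
    obtain \<tau>1 where 1: "exec B (ce d d e) \<sigma> (tm e) \<tau>1" "reg \<tau>1 d = ev e \<sigma>"
      "\<And>s. s < d \<Longrightarrow> reg \<tau>1 s = reg \<sigma> s" "wmem \<tau>1 = wmem \<sigma>" "nmem \<tau>1 = nmem \<sigma>"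
      using A.IH[of \<sigma> d d] A.prems by auto
    have "exec B (ce r d (A a e)) \<sigma> (tm e + 1) (set_reg r (get_word (a, d) \<tau>1) \<tau>1)"
      unfolding ce.simps by (rule exec_Seq[OF 1(1) exec.intros(3)])
    then show ?case using 1 A.prems
      by (intro exI[of _ "set_reg r (get_word (a, d) \<tau>1) \<tau>1"]) (auto simp: get_word_def)
  next
    case (Plus e f) then show ?case using bin[of e f \<sigma> d r WAdd] by simp
  next
    case (Minus e f)
    have "(x + (B - y)) mod B = x - y" if "y \<le> x" "x < B" for x y
    proof -
      have "x + (B - y) = (x - y) + B" using that by simp
      then show ?thesis using that by (metis less_imp_diff_less mod_add_self2 mod_less)
    qed
    then show ?case using Minus bin[of e f \<sigma> d r WSub] by simp
  next
    case (Times e f) then show ?case using bin[of e f \<sigma> d r WMul] by simp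
  next
    case (Xor e f) then show ?case using bin[of e f \<sigma> d r WXor] by simp
  next
    case (And e f) then show ?case using bin[of e f \<sigma> d r WAnd] by simp
  qed
qed

section \<open>Timed weakest preconditions and their soundness\<close>

datatype stm =
    Skp
  | Asg nat ex
  | Sto nat ex ex
  | NCp nat ex nat ex
  | Cpy nat ex nat ex ex
  | Cnv nat ex nat ex ex nat ex ex
  | Sq stm stm
  | IfL ex ex stm stm
  | Whl ex ex stm

text \<open>A block copy is a convolution with the vector \<open>[1]\<close>, which is kept in cell
  0 of number array 3; it takes time equal to its length, as \<open>lg 1 = 1\<close>. Number array 3
  is therefore reserved.\<close>

fun comp :: "stm \<Rightarrow> com" where
  "comp Skp = Skip"
| "comp (Asg r e) = ce r 50 e"
| "comp (Sto a e f) = Seq (Seq (ce 50 50 e) (ce 51 51 f)) (Store (a, 50) 51)"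
| "comp (NCp a e b f) = Seq (Seq (ce 50 50 e) (ce 51 51 f)) (NCopy (a, 50) (b, 51))"
| "comp (Cpy a e b f l) = Seq (Seq (Seq (Seq (Seq (Seq (ce 50 50 e) (ce 51 51 f)) (ce 52 52 l))
     (Const 53 0)) (Const 54 1)) (NConst (3, 53) 1)) (Convolve (a, 50) (b, 51) 52 (3, 53) 54)"
| "comp (Cnv a e b f l c g p) = Seq (Seq (Seq (Seq (Seq (ce 50 50 e) (ce 51 51 f)) (ce 52 52 l))
     (ce 53 53 g)) (ce 54 54 p)) (Convolve (a, 50) (b, 51) 52 (c, 53) 54)"
| "comp (Sq s t) = Seq (comp s) (comp t)"
| "comp (IfL e f s t) = Seq (Seq (ce 50 50 e) (ce 51 51 f)) (If (TLess 50 51) (comp s) (comp t))"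
| "comp (Whl e f s) = Seq (Seq (ce 50 50 e) (ce 51 51 f))
     (While (TLess 50 51) (Seq (comp s) (Seq (ce 50 50 e) (ce 51 51 f))))"

text \<open>Postconditions also speak about the elapsed time. The potential \<Phi> of a loop pays
  for each pass together with the test after it, so invariant, termination and running time come
  from one condition.\<close>

fun wp :: "nat \<Rightarrow> stm \<Rightarrow> (nat \<Rightarrow> state \<Rightarrow> bool) \<Rightarrow> state \<Rightarrow> bool" where
  "wp B Skp Q \<sigma> \<longleftrightarrow> Q 1 \<sigma>"
| "wp B (Asg r e) Q \<sigma> \<longleftrightarrow> r < 50 \<and> ok B e \<sigma> \<and> Q (tm e) (set_reg r (ev e \<sigma>) \<sigma>)"
| "wp B (Sto a e f) Q \<sigma> \<longleftrightarrow> ok B e \<sigma> \<and> ok B f \<sigma> \<and>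
     Q (tm e + tm f + 1) (wset a (ev e \<sigma>) (ev f \<sigma>) \<sigma>)"
| "wp B (NCp a e b f) Q \<sigma> \<longleftrightarrow> a \<noteq> 3 \<and> b \<noteq> 3 \<and> ok B e \<sigma> \<and> ok B f \<sigma> \<and>
     Q (tm e + tm f + 1) (nset a ((nmem \<sigma> a)(ev e \<sigma> := nmem \<sigma> b (ev f \<sigma>))) \<sigma>)"
| "wp B (Cpy a e b f l) Q \<sigma> \<longleftrightarrow> a \<noteq> 3 \<and> b \<noteq> 3 \<and> ok B e \<sigma> \<and> ok B f \<sigma> \<and> ok B l \<sigma> \<and> 1 < B \<and>
     1 \<le> ev l \<sigma> \<and> ev e \<sigma> + ev l \<sigma> \<le> B \<and> ev f \<sigma> + ev l \<sigma> \<le> B \<and>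
     Q (tm e + tm f + tm l + 3 + ev l \<sigma>)
       (nset a (\<lambda>i. if ev e \<sigma> \<le> i \<and> i < ev e \<sigma> + ev l \<sigma> then nmem \<sigma> b (ev f \<sigma> + (i - ev e \<sigma>))
                    else nmem \<sigma> a i) \<sigma>)"
| "wp B (Cnv a e b f l c g p) Q \<sigma> \<longleftrightarrow> a \<noteq> 3 \<and> b \<noteq> 3 \<and> c \<noteq> 3 \<and>
     ok B e \<sigma> \<and> ok B f \<sigma> \<and> ok B l \<sigma> \<and> ok B g \<sigma> \<and> ok B p \<sigma> \<and>
     1 \<le> ev p \<sigma> \<and> ev p \<sigma> \<le> ev l \<sigma> \<and> ev f \<sigma> + ev l \<sigma> \<le> B \<and> ev g \<sigma> + ev p \<sigma> \<le> B \<and>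
     ev e \<sigma> + (ev l \<sigma> - ev p \<sigma> + 1) \<le> B \<and>
     Q (tm e + tm f + tm l + tm g + tm p + nat \<lceil>real (ev l \<sigma>) * lg (ev p \<sigma>)\<rceil>)
       (nset a (\<lambda>i. if ev e \<sigma> \<le> i \<and> i < ev e \<sigma> + (ev l \<sigma> - ev p \<sigma> + 1)
                    then conv (map (\<lambda>i. nmem \<sigma> b (ev f \<sigma> + i)) [0..<ev l \<sigma>])
                              (map (\<lambda>i. nmem \<sigma> c (ev g \<sigma> + i)) [0..<ev p \<sigma>]) (i - ev e \<sigma> + 1)
                    else nmem \<sigma> a i) \<sigma>)"
| "wp B (Sq s u) Q \<sigma> \<longleftrightarrow> wp B s (\<lambda>t \<tau>. wp B u (\<lambda>t'. Q (t + t')) \<tau>) \<sigma>"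
| "wp B (IfL e f s u) Q \<sigma> \<longleftrightarrow> ok B e \<sigma> \<and> ok B f \<sigma> \<and>
     (if ev e \<sigma> < ev f \<sigma> then wp B s (\<lambda>t. Q (tm e + tm f + 1 + t)) \<sigma>
      else wp B u (\<lambda>t. Q (tm e + tm f + 1 + t)) \<sigma>)"
| "wp B (Whl e f s) Q \<sigma> \<longleftrightarrow> (\<exists>I \<Phi>. I \<sigma> \<and> (\<forall>\<tau>. I \<tau> \<longrightarrow> ok B e \<tau> \<and> ok B f \<tau> \<and>
     (if ev e \<tau> < ev f \<tau>
      then wp B s (\<lambda>t \<tau>'. I \<tau>' \<and> t + tm e + tm f + 1 + \<Phi> \<tau>' \<le> \<Phi> \<tau>) \<tau>
      else (\<forall>t. t + \<Phi> \<tau> \<le> \<Phi> \<sigma> + tm e + tm f + 1 \<longrightarrow> Q t \<tau>))))"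

lemma wp_mono:
  assumes "wp B s Q \<sigma>" "\<And>t \<tau>. Q t \<tau> \<Longrightarrow> Q' t \<tau>"
  shows "wp B s Q' \<sigma>"
  using assms
proof (induction s arbitrary: Q Q' \<sigma>)
  case (Sq s1 s2)
  show ?case using Sq.prems unfolding wp.simps
    by (elim Sq.IH(1)) (erule Sq.IH(2))
next
  case (IfL e f s1 s2)
  have "wp B s1 (\<lambda>t. Q' (tm e + tm f + 1 + t)) \<sigma>" if "wp B s1 (\<lambda>t. Q (tm e + tm f + 1 + t)) \<sigma>"
    by (rule IfL.IH(1)[OF that]) (rule IfL.prems(2))
  moreover have "wp B s2 (\<lambda>t. Q' (tm e + tm f + 1 + t)) \<sigma>" if "wp B s2 (\<lambda>t. Q (tm e + tm f + 1 + t)) \<sigma>"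
    by (rule IfL.IH(2)[OF that]) (rule IfL.prems(2))
  ultimately show ?case using IfL.prems(1) unfolding wp.simps by presburger
next
  case (Whl e f s)
  from Whl.prems(1) obtain I \<Phi> where "I \<sigma>" and all: "\<forall>\<tau>. I \<tau> \<longrightarrow> ok B e \<tau> \<and> ok B f \<tau> \<and>
     (if ev e \<tau> < ev f \<tau>
      then wp B s (\<lambda>t \<tau>'. I \<tau>' \<and> t + tm e + tm f + 1 + \<Phi> \<tau>' \<le> \<Phi> \<tau>) \<tau>
      else (\<forall>t. t + \<Phi> \<tau> \<le> \<Phi> \<sigma> + tm e + tm f + 1 \<longrightarrow> Q t \<tau>))"
    unfolding wp.simps by (elim exE conjE) (rule that)
  then show ?case using Whl.prems(2) unfolding wp.simps
    by (intro exI[of _ I] exI[of _ \<Phi>] conjI) presburger+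
qed auto

lemma wp_Whl:
  assumes "I \<sigma>"
    and "\<And>\<tau>. I \<tau> \<Longrightarrow> ok B e \<tau> \<and> ok B f \<tau>"
    and "\<And>\<tau>. I \<tau> \<Longrightarrow> ev e \<tau> < ev f \<tau> \<Longrightarrow> wp B s (\<lambda>t \<tau>'. I \<tau>' \<and> t + tm e + tm f + 1 + \<Phi> \<tau>' \<le> \<Phi> \<tau>) \<tau>"
    and "\<And>\<tau> t. I \<tau> \<Longrightarrow> \<not> ev e \<tau> < ev f \<tau> \<Longrightarrow> t + \<Phi> \<tau> \<le> \<Phi> \<sigma> + tm e + tm f + 1 \<Longrightarrow> Q t \<tau>"
  shows "wp B (Whl e f s) Q \<sigma>"
  unfolding wp.simps using assms by (intro exI[of _ I] exI[of _ \<Phi>] conjI) presburger+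

definition sim :: "state \<Rightarrow> state \<Rightarrow> bool" where
  "sim \<sigma> \<tau> \<longleftrightarrow> (\<forall>r<50. reg \<sigma> r = reg \<tau> r) \<and> wmem \<sigma> = wmem \<tau> \<and> (\<forall>a. a \<noteq> 3 \<longrightarrow> nmem \<sigma> a = nmem \<tau> a)"

lemma sim_ev:
  assumes "ok B e \<sigma>" "sim \<sigma> \<tau>"
  shows "ev e \<tau> = ev e \<sigma>" "ok B e \<tau>"
  using ev_cong[OF assms(1), of \<tau>] assms(2) by (auto simp: sim_def)

lemma exec_ce_temp:
  assumes "ok B e \<sigma>" "sim \<sigma> \<sigma>'" "50 \<le> d"
  shows "\<exists>\<tau>. exec B (ce d d e) \<sigma>' (tm e) \<tau> \<and> reg \<tau> d = ev e \<sigma> \<and> (\<forall>s<d. reg \<tau> s = reg \<sigma>' s) \<and>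
     sim \<sigma> \<tau>"
proof -
  obtain \<tau> where "exec B (ce d d e) \<sigma>' (tm e) \<tau>" "reg \<tau> d = ev e \<sigma>'"
     "\<forall>s. s \<noteq> d \<and> s < d \<longrightarrow> reg \<tau> s = reg \<sigma>' s" "wmem \<tau> = wmem \<sigma>'" "nmem \<tau> = nmem \<sigma>'"
    using exec_ce[OF sim_ev(2)[OF assms(1,2)] assms(3), of d] by blast
  then show ?thesis using assms sim_ev(1)[OF assms(1,2)] by (intro exI[of _ \<tau>]) (auto simp: sim_def)
qed

lemma exec_ce2:
  assumes "ok B e \<sigma>" "ok B f \<sigma>" "sim \<sigma> \<sigma>'"
  shows "\<exists>\<tau>. exec B (Seq (ce 50 50 e) (ce 51 51 f)) \<sigma>' (tm e + tm f) \<tau> \<and>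
     reg \<tau> 50 = ev e \<sigma> \<and> reg \<tau> 51 = ev f \<sigma> \<and> sim \<sigma> \<tau>"
proof -
  obtain \<tau>1 where 1: "exec B (ce 50 50 e) \<sigma>' (tm e) \<tau>1" "reg \<tau>1 50 = ev e \<sigma>" "sim \<sigma> \<tau>1"
    using exec_ce_temp[OF assms(1,3), of 50] by auto
  obtain \<tau>2 where 2: "exec B (ce 51 51 f) \<tau>1 (tm f) \<tau>2" "reg \<tau>2 51 = ev f \<sigma>" "\<forall>s<51. reg \<tau>2 s = reg \<tau>1 s" "sim \<sigma> \<tau>2"
    using exec_ce_temp[OF assms(2) 1(3), of 51] by auto
  show ?thesis using 1 2 exec_Seq[OF 1(1) 2(1)] by (intro exI[of _ \<tau>2]) auto
qed

lemma exec_ce3: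
  assumes "ok B e \<sigma>" "ok B f \<sigma>" "ok B l \<sigma>" "sim \<sigma> \<sigma>'"
  shows "\<exists>\<tau>. exec B (Seq (Seq (ce 50 50 e) (ce 51 51 f)) (ce 52 52 l)) \<sigma>' (tm e + tm f + tm l) \<tau> \<and>
     reg \<tau> 50 = ev e \<sigma> \<and> reg \<tau> 51 = ev f \<sigma> \<and> reg \<tau> 52 = ev l \<sigma> \<and> sim \<sigma> \<tau>"
proof -
  obtain \<tau>1 where 1: "exec B (Seq (ce 50 50 e) (ce 51 51 f)) \<sigma>' (tm e + tm f) \<tau>1"
     "reg \<tau>1 50 = ev e \<sigma>" "reg \<tau>1 51 = ev f \<sigma>" "sim \<sigma> \<tau>1"
    using exec_ce2[OF assms(1,2,4)] by auto
  obtain \<tau>2 where 2: "exec B (ce 52 52 l) \<tau>1 (tm l) \<tau>2" "reg \<tau>2 52 = ev l \<sigma>" "\<forall>s<52. reg \<tau>2 s = reg \<tau>1 s" "sim \<sigma> \<tau>2"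
    using exec_ce_temp[OF assms(3) 1(4), of 52] by auto
  show ?thesis using 1 2 exec_Seq[OF 1(1) 2(1)] by (intro exI[of _ \<tau>2]) auto
qed

lemma conv_single:
  assumes "1 \<le> i" shows "conv xs [1] i = xs ! (i - 1)"
  using assms by (simp add: conv_def)

lemma set_nums_simps [simp]:
  "reg (set_nums x vs \<sigma>) = reg \<sigma>" "wmem (set_nums x vs \<sigma>) = wmem \<sigma>"
  "nmem (set_nums x vs \<sigma>) = (nmem \<sigma>)(fst x := (\<lambda>i. if reg \<sigma> (snd x) \<le> i \<and> i < reg \<sigma> (snd x) + length vs
     then vs ! (i - reg \<sigma> (snd x)) else nmem \<sigma> (fst x) i))"
  by (simp_all add: set_nums_def Let_def)

lemma lg_1 [simp]: "lg 1 = 1" "lg (Suc 0) = 1"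
  by (simp_all add: lg_def)

theorem wp_sound:
  assumes "wp B s Q \<sigma>" "sim \<sigma> \<sigma>'"
  shows "\<exists>t \<tau>' \<tau>. exec B (comp s) \<sigma>' t \<tau>' \<and> sim \<tau> \<tau>' \<and> Q t \<tau>"
  using assms
proof (induction s arbitrary: Q \<sigma> \<sigma>')
  case Skp
  then show ?case using exec.intros(9)[of B \<sigma>'] by auto
next
  case (Asg r e)
  then have r: "r < 50" "ok B e \<sigma>" and Q: "Q (tm e) (set_reg r (ev e \<sigma>) \<sigma>)" by auto
  obtain \<tau> where \<tau>: "exec B (ce r 50 e) \<sigma>' (tm e) \<tau>" "reg \<tau> r = ev e \<sigma>'"
     "\<forall>s. s \<noteq> r \<and> s < 50 \<longrightarrow> reg \<tau> s = reg \<sigma>' s" "wmem \<tau> = wmem \<sigma>'" "nmem \<tau> = nmem \<sigma>'"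
    using exec_ce[OF sim_ev(2)[OF r(2) Asg.prems(2)], of 50 r] r(1) by auto
  show ?case
    by (rule exI[of _ "tm e"], rule exI[of _ \<tau>], rule exI[of _ "set_reg r (ev e \<sigma>) \<sigma>"])
      (use \<tau> Q sim_ev(1)[OF r(2) Asg.prems(2)] Asg.prems(2) in \<open>auto simp: sim_def\<close>)
next
  case (Sto a e f)
  then have ok: "ok B e \<sigma>" "ok B f \<sigma>" by auto
  obtain \<tau>1 where 1: "exec B (Seq (ce 50 50 e) (ce 51 51 f)) \<sigma>' (tm e + tm f) \<tau>1"
     "reg \<tau>1 50 = ev e \<sigma>" "reg \<tau>1 51 = ev f \<sigma>" "sim \<sigma> \<tau>1"
    using exec_ce2[OF ok Sto.prems(2)] by auto
  have "exec B (comp (Sto a e f)) \<sigma>' (tm e + tm f + 1) (set_word (a, 50) (reg \<tau>1 51) \<tau>1)"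
    unfolding comp.simps by (rule exec_Seq[OF 1(1) exec.intros(4)])
  moreover have "sim (wset a (ev e \<sigma>) (ev f \<sigma>) \<sigma>) (set_word (a, 50) (reg \<tau>1 51) \<tau>1)"
    using 1 by (auto simp: sim_def set_word_def)
  ultimately show ?case using Sto.prems by auto
next
  case (NCp a e b f)
  then have ok: "ok B e \<sigma>" "ok B f \<sigma>" by auto
  obtain \<tau>1 where 1: "exec B (Seq (ce 50 50 e) (ce 51 51 f)) \<sigma>' (tm e + tm f) \<tau>1"
     "reg \<tau>1 50 = ev e \<sigma>" "reg \<tau>1 51 = ev f \<sigma>" "sim \<sigma> \<tau>1"
    using exec_ce2[OF ok NCp.prems(2)] by auto
  have "exec B (comp (NCp a e b f)) \<sigma>' (tm e + tm f + 1) (set_num (a, 50) (get_num (b, 51) \<tau>1) \<tau>1)"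
    unfolding comp.simps by (rule exec_Seq[OF 1(1) exec.intros(6)])
  moreover have "sim (nset a ((nmem \<sigma> a)(ev e \<sigma> := nmem \<sigma> b (ev f \<sigma>))) \<sigma>)
      (set_num (a, 50) (get_num (b, 51) \<tau>1) \<tau>1)"
    using 1 NCp.prems(1) by (auto simp: sim_def set_num_def get_num_def)
  ultimately show ?case using NCp.prems(1) unfolding wp.simps by blast
next
  case (Cpy a e b f l)
  then have ok: "ok B e \<sigma>" "ok B f \<sigma>" "ok B l \<sigma>" by auto
  note P = Cpy.prems(1)[unfolded wp.simps]
  obtain \<tau>1 where 1: "exec B (Seq (Seq (ce 50 50 e) (ce 51 51 f)) (ce 52 52 l)) \<sigma>' (tm e + tm f + tm l) \<tau>1"
     "reg \<tau>1 50 = ev e \<sigma>" "reg \<tau>1 51 = ev f \<sigma>" "reg \<tau>1 52 = ev l \<sigma>" "sim \<sigma> \<tau>1"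
    using exec_ce3[OF ok Cpy.prems(2)] by auto
  define \<tau>2 where "\<tau>2 = set_num (3, 53) 1 (set_reg 54 (1 mod B) (set_reg 53 (0 mod B) \<tau>1))"
  have r2: "reg \<tau>2 50 = ev e \<sigma>" "reg \<tau>2 51 = ev f \<sigma>" "reg \<tau>2 52 = ev l \<sigma>" "reg \<tau>2 53 = 0" "reg \<tau>2 54 = 1"
    and n2: "nmem \<tau>2 3 0 = 1" and s2: "sim \<sigma> \<tau>2"
    using 1 P by (auto simp: \<tau>2_def set_num_def sim_def)
  define vs where "vs = map (conv (get_nums (b, 51) (ev l \<sigma>) \<tau>2) (get_nums (3, 53) 1 \<tau>2)) [1..<ev l \<sigma> - 1 + 2]"
  have "exec B (Seq (Seq (Seq (Seq (Seq (ce 50 50 e) (ce 51 51 f)) (ce 52 52 l))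
     (Const 53 0)) (Const 54 1)) (NConst (3, 53) 1)) \<sigma>' (tm e + tm f + tm l + 1 + 1 + 1) \<tau>2"
    unfolding \<tau>2_def
    by (rule exec_Seq[OF exec_Seq[OF exec_Seq[OF 1(1) exec.intros(1)] exec.intros(1)] exec.intros(5)])
  moreover have "exec B (Convolve (a, 50) (b, 51) 52 (3, 53) 54) \<tau>2 (nat \<lceil>real (ev l \<sigma>) * lg 1\<rceil>) (set_nums (a, 50) vs \<tau>2)"
    by (rule exec.intros(8)) (use P r2 in \<open>auto simp: vs_def\<close>)
  ultimately have ex: "exec B (comp (Cpy a e b f l)) \<sigma>' (tm e + tm f + tm l + 1 + 1 + 1 + nat \<lceil>real (ev l \<sigma>) * lg 1\<rceil>)
      (set_nums (a, 50) vs \<tau>2)"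
    unfolding comp.simps by (rule exec_Seq)
  have len: "length vs = ev l \<sigma>" using P by (simp add: vs_def)
  have one: "get_nums (3, 53) 1 \<tau>2 = [1]" using n2 r2 by (simp add: get_nums_def)
  have nth: "vs ! i = nmem \<sigma> b (ev f \<sigma> + i)" if "i < ev l \<sigma>" for i
  proof -
    have "vs ! i = conv (get_nums (b, 51) (ev l \<sigma>) \<tau>2) [1] (Suc i)"
      unfolding vs_def one using that by (subst nth_map) (auto simp: nth_upt simp del: upt_Suc)
    also have "\<dots> = nmem \<tau>2 b (ev f \<sigma> + i)" using that r2 by (simp add: conv_single get_nums_def)
    finally show ?thesis using s2 P by (simp add: sim_def)
  qed
  have "sim (nset a (\<lambda>i. if ev e \<sigma> \<le> i \<and> i < ev e \<sigma> + ev l \<sigma> then nmem \<sigma> b (ev f \<sigma> + (i - ev e \<sigma>))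
                    else nmem \<sigma> a i) \<sigma>) (set_nums (a, 50) vs \<tau>2)"
    using s2 P r2 by (auto simp: sim_def len nth fun_eq_iff)
  then show ?case using ex P by (auto simp: numeral_3_eq_3)
next
  case (Cnv a e b f l c g p)
  then have ok: "ok B e \<sigma>" "ok B f \<sigma>" "ok B l \<sigma>" "ok B g \<sigma>" "ok B p \<sigma>" by auto
  note P = Cnv.prems(1)[unfolded wp.simps]
  obtain \<tau>1 where 1: "exec B (Seq (Seq (ce 50 50 e) (ce 51 51 f)) (ce 52 52 l)) \<sigma>' (tm e + tm f + tm l) \<tau>1"
     "reg \<tau>1 50 = ev e \<sigma>" "reg \<tau>1 51 = ev f \<sigma>" "reg \<tau>1 52 = ev l \<sigma>" "sim \<sigma> \<tau>1"
    using exec_ce3[OF ok(1-3) Cnv.prems(2)] by auto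
  obtain \<tau>2 where 2: "exec B (ce 53 53 g) \<tau>1 (tm g) \<tau>2" "reg \<tau>2 53 = ev g \<sigma>" "\<forall>s<53. reg \<tau>2 s = reg \<tau>1 s" "sim \<sigma> \<tau>2"
    using exec_ce_temp[OF ok(4) 1(5), of 53] by auto
  obtain \<tau>3 where 3: "exec B (ce 54 54 p) \<tau>2 (tm p) \<tau>3" "reg \<tau>3 54 = ev p \<sigma>" "\<forall>s<54. reg \<tau>3 s = reg \<tau>2 s" "sim \<sigma> \<tau>3"
    using exec_ce_temp[OF ok(5) 2(4), of 54] by auto
  have r3: "reg \<tau>3 50 = ev e \<sigma>" "reg \<tau>3 51 = ev f \<sigma>" "reg \<tau>3 52 = ev l \<sigma>" "reg \<tau>3 53 = ev g \<sigma>" "reg \<tau>3 54 = ev p \<sigma>"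
    using 1 2 3 by auto
  define vs where "vs = map (conv (get_nums (b, 51) (ev l \<sigma>) \<tau>3) (get_nums (c, 53) (ev p \<sigma>) \<tau>3)) [1..<ev l \<sigma> - ev p \<sigma> + 2]"
  have "exec B (Seq (Seq (Seq (Seq (ce 50 50 e) (ce 51 51 f)) (ce 52 52 l))
     (ce 53 53 g)) (ce 54 54 p)) \<sigma>' (tm e + tm f + tm l + tm g + tm p) \<tau>3"
    by (rule exec_Seq[OF exec_Seq[OF 1(1) 2(1)] 3(1)])
  moreover have "exec B (Convolve (a, 50) (b, 51) 52 (c, 53) 54) \<tau>3 (nat \<lceil>real (ev l \<sigma>) * lg (ev p \<sigma>)\<rceil>) (set_nums (a, 50) vs \<tau>3)"
    by (rule exec.intros(8)) (use P r3 in \<open>auto simp: vs_def\<close>)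
  ultimately have ex: "exec B (comp (Cnv a e b f l c g p)) \<sigma>' (tm e + tm f + tm l + tm g + tm p + nat \<lceil>real (ev l \<sigma>) * lg (ev p \<sigma>)\<rceil>)
      (set_nums (a, 50) vs \<tau>3)"
    unfolding comp.simps by (rule exec_Seq)
  have len: "length vs = ev l \<sigma> - ev p \<sigma> + 1" unfolding vs_def length_map length_upt by linarith
  have gn: "get_nums (b, 51) (ev l \<sigma>) \<tau>3 = map (\<lambda>i. nmem \<sigma> b (ev f \<sigma> + i)) [0..<ev l \<sigma>]"
    "get_nums (c, 53) (ev p \<sigma>) \<tau>3 = map (\<lambda>i. nmem \<sigma> c (ev g \<sigma> + i)) [0..<ev p \<sigma>]"
    using 3(4) r3 P by (simp_all add: get_nums_def sim_def)
  have nth: "vs ! i = conv (map (\<lambda>i. nmem \<sigma> b (ev f \<sigma> + i)) [0..<ev l \<sigma>])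
      (map (\<lambda>i. nmem \<sigma> c (ev g \<sigma> + i)) [0..<ev p \<sigma>]) (Suc i)" if "i < ev l \<sigma> - ev p \<sigma> + 1" for i
    unfolding vs_def gn using that by (subst nth_map) (auto simp: nth_upt simp del: upt_Suc)
  have "sim (nset a (\<lambda>i. if ev e \<sigma> \<le> i \<and> i < ev e \<sigma> + (ev l \<sigma> - ev p \<sigma> + 1)
                    then conv (map (\<lambda>i. nmem \<sigma> b (ev f \<sigma> + i)) [0..<ev l \<sigma>])
                              (map (\<lambda>i. nmem \<sigma> c (ev g \<sigma> + i)) [0..<ev p \<sigma>]) (i - ev e \<sigma> + 1)
                    else nmem \<sigma> a i) \<sigma>) (set_nums (a, 50) vs \<tau>3)"
    using 3(4) P r3 len nth by (auto simp: sim_def fun_eq_iff)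
  then show ?case using ex P by blast
next
  case (Sq s u)
  from Sq.IH(1)[OF Sq.prems(1)[unfolded wp.simps] Sq.prems(2)]
  obtain t1 \<tau>1' \<tau>1 where 1: "exec B (comp s) \<sigma>' t1 \<tau>1'" "sim \<tau>1 \<tau>1'" "wp B u (\<lambda>t'. Q (t1 + t')) \<tau>1" by auto
  from Sq.IH(2)[OF 1(3,2)]
  obtain t2 \<tau>2' \<tau>2 where "exec B (comp u) \<tau>1' t2 \<tau>2'" "sim \<tau>2 \<tau>2'" "Q (t1 + t2) \<tau>2" by auto
  then show ?case using exec_Seq[OF 1(1)] unfolding comp.simps by blast
next
  case (IfL e f s u)
  then have ok: "ok B e \<sigma>" "ok B f \<sigma>" by auto
  obtain \<tau>1 where 1: "exec B (Seq (ce 50 50 e) (ce 51 51 f)) \<sigma>' (tm e + tm f) \<tau>1"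
     "reg \<tau>1 50 = ev e \<sigma>" "reg \<tau>1 51 = ev f \<sigma>" "sim \<sigma> \<tau>1"
    using exec_ce2[OF ok IfL.prems(2)] by auto
  show ?case
  proof (cases "ev e \<sigma> < ev f \<sigma>")
    case True
    then obtain t2 \<tau>2' \<tau>2 where 2: "exec B (comp s) \<tau>1 t2 \<tau>2'" "sim \<tau>2 \<tau>2'" "Q (tm e + tm f + 1 + t2) \<tau>2"
      using IfL.IH(1)[OF _ 1(4), of "\<lambda>t. Q (tm e + tm f + 1 + t)"] IfL.prems(1) by auto
    have "exec B (comp (IfL e f s u)) \<sigma>' (tm e + tm f + (1 + t2)) \<tau>2'"
      unfolding comp.simps by (rule exec_Seq[OF 1(1)], rule exec.intros(11)) (use True 1 2 in auto)
    then show ?thesis using 2 by (metis add.assoc)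
  next
    case False
    then obtain t2 \<tau>2' \<tau>2 where 2: "exec B (comp u) \<tau>1 t2 \<tau>2'" "sim \<tau>2 \<tau>2'" "Q (tm e + tm f + 1 + t2) \<tau>2"
      using IfL.IH(2)[OF _ 1(4), of "\<lambda>t. Q (tm e + tm f + 1 + t)"] IfL.prems(1) by auto
    have "exec B (comp (IfL e f s u)) \<sigma>' (tm e + tm f + (1 + t2)) \<tau>2'"
      unfolding comp.simps by (rule exec_Seq[OF 1(1)], rule exec.intros(12)) (use False 1 2 in auto)
    then show ?thesis using 2 by (metis add.assoc)
  qed
next
  case (Whl e f s)
  from Whl.prems(1) obtain I \<Phi> where I: "I \<sigma>" and all: "\<forall>\<tau>. I \<tau> \<longrightarrow> ok B e \<tau> \<and> ok B f \<tau> \<and>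
     (if ev e \<tau> < ev f \<tau>
      then wp B s (\<lambda>t \<tau>'. I \<tau>' \<and> t + tm e + tm f + 1 + \<Phi> \<tau>' \<le> \<Phi> \<tau>) \<tau>
      else (\<forall>t. t + \<Phi> \<tau> \<le> \<Phi> \<sigma> + tm e + tm f + 1 \<longrightarrow> Q t \<tau>))"
    unfolding wp.simps by (elim exE conjE) (rule that)
  have step: "\<And>\<tau>. I \<tau> \<Longrightarrow> ok B e \<tau> \<and> ok B f \<tau>"
    "\<And>\<tau>. I \<tau> \<Longrightarrow> ev e \<tau> < ev f \<tau> \<Longrightarrow> wp B s (\<lambda>t \<tau>'. I \<tau>' \<and> t + tm e + tm f + 1 + \<Phi> \<tau>' \<le> \<Phi> \<tau>) \<tau>"
    "\<And>\<tau> t. I \<tau> \<Longrightarrow> \<not> ev e \<tau> < ev f \<tau> \<Longrightarrow> t + \<Phi> \<tau> \<le> \<Phi> \<sigma> + tm e + tm f + 1 \<Longrightarrow> Q t \<tau>"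
    using all by presburger+
  let ?c = "Seq (ce 50 50 e) (ce 51 51 f)"
  have loop: "\<exists>t \<tau>' \<tau>1. exec B (While (TLess 50 51) (Seq (comp s) ?c)) \<rho> t \<tau>' \<and> sim \<tau>1 \<tau>' \<and> I \<tau>1 \<and>
      \<not> ev e \<tau>1 < ev f \<tau>1 \<and> t + \<Phi> \<tau>1 \<le> \<Phi> \<tau> + 1"
    if "I \<tau>" "sim \<tau> \<rho>" "reg \<rho> 50 = ev e \<tau>" "reg \<rho> 51 = ev f \<tau>" for \<tau> \<rho>
    using that
  \<comment> \<open>Every pass contains a test of positive cost, so the potential strictly
    decreases.\<close>
  proof (induction "\<Phi> \<tau>" arbitrary: \<tau> \<rho> rule: less_induct)
    case less
    show ?case
    proof (cases "ev e \<tau> < ev f \<tau>")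
      case True
      from Whl.IH[OF step(2)[OF less.prems(1) True] less.prems(2)]
      obtain t1 \<tau>1' \<tau>1 where 1: "exec B (comp s) \<rho> t1 \<tau>1'" "sim \<tau>1 \<tau>1'" "I \<tau>1"
        "t1 + tm e + tm f + 1 + \<Phi> \<tau>1 \<le> \<Phi> \<tau>" by auto
      have ok1: "ok B e \<tau>1" "ok B f \<tau>1" using step(1)[OF 1(3)] by auto
      obtain \<tau>2 where 2: "exec B ?c \<tau>1' (tm e + tm f) \<tau>2"
        "reg \<tau>2 50 = ev e \<tau>1" "reg \<tau>2 51 = ev f \<tau>1" "sim \<tau>1 \<tau>2"
        using exec_ce2[OF ok1 1(2)] by auto
      have "\<Phi> \<tau>1 < \<Phi> \<tau>" using 1(4) by simp
      from less.hyps[OF this 1(3) 2(4,2,3)]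
      obtain t3 \<tau>3' \<tau>3 where 3: "exec B (While (TLess 50 51) (Seq (comp s) ?c)) \<tau>2 t3 \<tau>3'" "sim \<tau>3 \<tau>3'" "I \<tau>3"
        "\<not> ev e \<tau>3 < ev f \<tau>3" "t3 + \<Phi> \<tau>3 \<le> \<Phi> \<tau>1 + 1" by auto
      have "exec B (While (TLess 50 51) (Seq (comp s) ?c)) \<rho> (1 + (t1 + (tm e + tm f)) + t3) \<tau>3'"
        by (rule exec.intros(13)[OF _ exec_Seq[OF 1(1) 2(1)] 3(1)]) (use True less.prems in auto)
      then show ?thesis using 3 1(4) by (intro exI[of _ "1 + (t1 + (tm e + tm f)) + t3"] exI conjI) auto
    next
      case False
      have "exec B (While (TLess 50 51) (Seq (comp s) ?c)) \<rho> 1 \<rho>"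
        by (rule exec.intros(14)) (use False less.prems in auto)
      then show ?thesis using False less.prems by (intro exI conjI) auto
    qed
  qed
  have ok0: "ok B e \<sigma>" "ok B f \<sigma>" using step(1)[OF I] by auto
  obtain \<tau>2 where 2: "exec B ?c \<sigma>' (tm e + tm f) \<tau>2"
        "reg \<tau>2 50 = ev e \<sigma>" "reg \<tau>2 51 = ev f \<sigma>" "sim \<sigma> \<tau>2"
    using exec_ce2[OF ok0 Whl.prems(2)] by auto
  from loop[OF I 2(4,2,3)]
  obtain t3 \<tau>3' \<tau>3 where 3: "exec B (While (TLess 50 51) (Seq (comp s) ?c)) \<tau>2 t3 \<tau>3'" "sim \<tau>3 \<tau>3'" "I \<tau>3"
        "\<not> ev e \<tau>3 < ev f \<tau>3" "t3 + \<Phi> \<tau>3 \<le> \<Phi> \<sigma> + 1" by auto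
  have "Q (tm e + tm f + t3) \<tau>3" by (rule step(3)[OF 3(3,4)]) (use 3(5) in simp)
  then show ?case using exec_Seq[OF 2(1) 3(1)] 3(2) unfolding comp.simps by blast
qed

lemma run_wp:
  assumes "wp B s Q (start args D)"
  shows "\<exists>t \<tau>. run B (comp s) args D t (result_of \<tau>) \<and> Q t \<tau>"
proof -
  have "sim \<sigma> \<sigma>" for \<sigma> by (simp add: sim_def)
  from wp_sound[OF assms this] obtain t \<tau>' \<tau> where
    "exec B (comp s) (start args D) t \<tau>'" "sim \<tau> \<tau>'" "Q t \<tau>" by auto
  moreover from this have "result_of \<tau>' = result_of \<tau>" by (simp add: result_of_def sim_def)
  ultimately show ?thesis unfolding run_def by metis
qed

fun wregs :: "stm \<Rightarrow> nat set" where
  "wregs (Asg r e) = {r}"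
| "wregs (Sq s u) = wregs s \<union> wregs u"
| "wregs (IfL e f s u) = wregs s \<union> wregs u"
| "wregs (Whl e f s) = wregs s"
| "wregs _ = {}"

fun warrs :: "stm \<Rightarrow> nat set" where
  "warrs (Sto a e f) = {a}"
| "warrs (Sq s u) = warrs s \<union> warrs u"
| "warrs (IfL e f s u) = warrs s \<union> warrs u"
| "warrs (Whl e f s) = warrs s"
| "warrs _ = {}"

fun narrs :: "stm \<Rightarrow> nat set" where
  "narrs (NCp a e b f) = {a}"
| "narrs (Cpy a e b f l) = {a}"
| "narrs (Cnv a e b f l c g p) = {a}"
| "narrs (Sq s u) = narrs s \<union> narrs u"
| "narrs (IfL e f s u) = narrs s \<union> narrs u"
| "narrs (Whl e f s) = narrs s"
| "narrs _ = {}"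

definition frame :: "stm \<Rightarrow> state \<Rightarrow> state \<Rightarrow> bool" where
  "frame s \<sigma> \<tau> \<longleftrightarrow> (\<forall>r. r \<notin> wregs s \<longrightarrow> reg \<tau> r = reg \<sigma> r) \<and> (\<forall>a. a \<notin> warrs s \<longrightarrow> wmem \<tau> a = wmem \<sigma> a) \<and>
     (\<forall>a. a \<notin> narrs s \<longrightarrow> nmem \<tau> a = nmem \<sigma> a)"

text \<open>What a program cannot change is read off its syntax, so that specifications list only
  what changes.\<close>

lemma wp_frame:
  assumes "wp B s Q \<sigma>"
  shows "wp B s (\<lambda>t \<tau>. Q t \<tau> \<and> frame s \<sigma> \<tau>) \<sigma>"
  using assms
proof (induction s arbitrary: Q \<sigma>)
  case (Sq s u)
  have "wp B u (\<lambda>t' \<rho>. Q (t + t') \<rho> \<and> frame (Sq s u) \<sigma> \<rho>) \<tau>"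
    if "wp B u (\<lambda>t'. Q (t + t')) \<tau> \<and> frame s \<sigma> \<tau>" for t \<tau>
    by (rule wp_mono[OF Sq.IH(2)[of "\<lambda>t'. Q (t + t')" \<tau>]]) (use that in \<open>auto simp: frame_def\<close>)
  then show ?case unfolding wp.simps
    using wp_mono[OF Sq.IH(1)[OF Sq.prems[unfolded wp.simps]]] by simp
next
  case (IfL e f s u)
  have "wp B s (\<lambda>t \<tau>. Q (tm e + tm f + 1 + t) \<tau> \<and> frame (IfL e f s u) \<sigma> \<tau>) \<sigma>"
    if "wp B s (\<lambda>t. Q (tm e + tm f + 1 + t)) \<sigma>"
    by (rule wp_mono[OF IfL.IH(1)[OF that]]) (auto simp: frame_def)
  moreover have "wp B u (\<lambda>t \<tau>. Q (tm e + tm f + 1 + t) \<tau> \<and> frame (IfL e f s u) \<sigma> \<tau>) \<sigma>"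
    if "wp B u (\<lambda>t. Q (tm e + tm f + 1 + t)) \<sigma>"
    by (rule wp_mono[OF IfL.IH(2)[OF that]]) (auto simp: frame_def)
  ultimately show ?case using IfL.prems(1) unfolding wp.simps by presburger
next
  case (Whl e f s)
  from Whl.prems(1) obtain I \<Phi> where I: "I \<sigma>" and all: "\<forall>\<tau>. I \<tau> \<longrightarrow> ok B e \<tau> \<and> ok B f \<tau> \<and>
     (if ev e \<tau> < ev f \<tau>
      then wp B s (\<lambda>t \<tau>'. I \<tau>' \<and> t + tm e + tm f + 1 + \<Phi> \<tau>' \<le> \<Phi> \<tau>) \<tau>
      else (\<forall>t. t + \<Phi> \<tau> \<le> \<Phi> \<sigma> + tm e + tm f + 1 \<longrightarrow> Q t \<tau>))"
    unfolding wp.simps by (elim exE conjE) (rule that)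
  have step: "\<And>\<tau>. I \<tau> \<Longrightarrow> ok B e \<tau> \<and> ok B f \<tau>"
    "\<And>\<tau>. I \<tau> \<Longrightarrow> ev e \<tau> < ev f \<tau> \<Longrightarrow> wp B s (\<lambda>t \<tau>'. I \<tau>' \<and> t + tm e + tm f + 1 + \<Phi> \<tau>' \<le> \<Phi> \<tau>) \<tau>"
    "\<And>\<tau> t. I \<tau> \<Longrightarrow> \<not> ev e \<tau> < ev f \<tau> \<Longrightarrow> t + \<Phi> \<tau> \<le> \<Phi> \<sigma> + tm e + tm f + 1 \<Longrightarrow> Q t \<tau>"
    using all by presburger+
  show ?case
  proof (rule wp_Whl[where I = "\<lambda>\<tau>. I \<tau> \<and> frame (Whl e f s) \<sigma> \<tau>" and \<Phi> = \<Phi>])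
    show "I \<sigma> \<and> frame (Whl e f s) \<sigma> \<sigma>" using I by (simp add: frame_def)
  next
    fix \<tau> assume "I \<tau> \<and> frame (Whl e f s) \<sigma> \<tau>" then show "ok B e \<tau> \<and> ok B f \<tau>" using step(1) by blast
  next
    fix \<tau> assume \<tau>: "I \<tau> \<and> frame (Whl e f s) \<sigma> \<tau>" "ev e \<tau> < ev f \<tau>"
    show "wp B s (\<lambda>t \<tau>'. (I \<tau>' \<and> frame (Whl e f s) \<sigma> \<tau>') \<and> t + tm e + tm f + 1 + \<Phi> \<tau>' \<le> \<Phi> \<tau>) \<tau>"
      by (rule wp_mono[OF Whl.IH[OF step(2)]]) (use \<tau> in \<open>auto simp: frame_def\<close>)
  next
    fix \<tau> t assume "I \<tau> \<and> frame (Whl e f s) \<sigma> \<tau>" "\<not> ev e \<tau> < ev f \<tau>" "t + \<Phi> \<tau> \<le> \<Phi> \<sigma> + tm e + tm f + 1"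
    then show "Q t \<tau> \<and> frame (Whl e f s) \<sigma> \<tau>" using step(3) by blast
  qed
qed (auto simp: frame_def)

lemma wp_Sq:
  assumes "wp B s Q \<sigma>" "\<And>t \<tau>. Q t \<tau> \<Longrightarrow> frame s \<sigma> \<tau> \<Longrightarrow> wp B u (\<lambda>t'. R (t + t')) \<tau>"
  shows "wp B (Sq s u) R \<sigma>"
  unfolding wp.simps by (rule wp_mono[OF wp_frame[OF assms(1)]]) (use assms(2) in blast)

section \<open>The redundancy of a straight-line program\<close>

locale slp_pattern =
  fixes G :: slp and P :: "int list" and n m :: nat
  assumes slp: "is_slp G" and n_def: "n = length G" and m_def: "m = length P" and m1: "1 \<le> m"
begin

lemma n1: "1 \<le> n"
  using slp n_def by (cases G) (auto simp: is_slp_def)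

lemma val_Char: "rhs_of G i = Char a \<Longrightarrow> val G i = [a]"
  by (subst val.simps) simp

lemma Pair_range: "rhs_of G i = Pair l r \<Longrightarrow> i \<in> {1..n} \<Longrightarrow> l \<in> {1..<i} \<and> r \<in> {1..<i}"
  using slp unfolding is_slp_def n_def[symmetric] by blast

lemma val_Pair: "rhs_of G i = Pair l r \<Longrightarrow> i \<in> {1..n} \<Longrightarrow> val G i = val G l @ val G r"
  using Pair_range[of i l r] by (subst val.simps) auto

lemma val_nonempty: "i \<in> {1..n} \<Longrightarrow> val G i \<noteq> []"
proof (induction i rule: less_induct)
  case (less i)
  show ?case
  proof (cases "rhs_of G i")
    case (Pair l r)
    then show ?thesis using Pair_range[OF Pair less.prems] val_Pair[OF Pair less.prems] less.IH[of l] less.prems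
      by simp
  qed (simp add: val_Char)
qed

text \<open>The number of length-\<open>m\<close> windows of \<open>t_string\<close>. No half of
  this string is long enough for a window, so all of them cross the border.\<close>

definition wd :: "nat \<Rightarrow> nat" where
  "wd j = (case rhs_of G j of Char a \<Rightarrow> 0
     | Pair l r \<Rightarrow> if m \<le> length (val G j) then length (t_string G m l r) - (m - 1) else 0)"

lemma length_t_string:
  "length (t_string G m l r) = min (m - 1) (length (val G l)) + min (m - 1) (length (val G r))"
  by (auto simp: t_string_def suffix_upto_def)

lemma wd_Pair:
  assumes "rhs_of G j = Pair l r" "j \<in> {1..n}"
  shows "int (wd j) = (if m \<le> length (val G j)
     then int (min (m - 1) (length (val G l))) + int (min (m - 1) (length (val G r))) - (int m - 1) else 0)"
proof (cases "m \<le> length (val G j)")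
  case True
  let ?a = "min (m - 1) (length (val G l))" and ?b = "min (m - 1) (length (val G r))"
  have "m - 1 \<le> ?a + ?b" using True val_Pair[OF assms] by simp
  then have "int (?a + ?b - (m - 1)) = int ?a + int ?b - (int m - 1)" using m1 by linarith
  then show ?thesis using True assms by (simp only: wd_def length_t_string rhs.case if_True)
next
  case False
  then show ?thesis by (simp only: wd_def assms(1) rhs.case if_False of_nat_0)
qed

text \<open>A window lies in the left half, in the right half, or across the border. Truncated
  subtraction yields 0 for strings that are too short.\<close>

lemma windows_Pair:
  assumes "rhs_of G j = Pair l r" "j \<in> {1..n}"
  shows "length (val G j) + 1 - m = wd j + (length (val G l) + 1 - m) + (length (val G r) + 1 - m)"
proof -
  have num: "a + b + 1 - m = k + (a + 1 - m) + (b + 1 - m)"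
    if "int k = (if m \<le> a + b then int (min (m - 1) a) + int (min (m - 1) b) - (int m - 1) else 0)"
    for a b k :: nat
    using that m1 unfolding min_def by (simp split: if_splits)
  show ?thesis using num[OF wd_Pair[OF assms, unfolded val_Pair[OF assms] length_append]]
    unfolding val_Pair[OF assms] length_append .
qed

lemma derivation_tree_Pair:
  "rhs_of G i = Pair l r \<Longrightarrow> i \<in> {1..n} \<Longrightarrow>
     derivation_tree G i = Node2 i (derivation_tree G l) (derivation_tree G r)"
  using Pair_range[of i l r] by (subst derivation_tree.simps) auto

lemma derivation_tree_Char:
  "rhs_of G i = Char a \<Longrightarrow> derivation_tree G i = Node1 i (Leaf a)"
  by (subst derivation_tree.simps) auto

lemma sum_if_wd: "i \<in> {1..n} \<Longrightarrow> (\<Sum>j=1..n. (if i = j then 1 else 0) * wd j) = wd i"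
proof -
  assume "i \<in> {1..n}"
  then have "wd i = (\<Sum>j=1..n. if i = j then wd j else 0)" by (subst sum.delta') auto
  also have "\<dots> = (\<Sum>j=1..n. (if i = j then 1 else 0) * wd j)" by (intro sum.cong) auto
  finally show ?thesis by simp
qed

text \<open>Each window is counted at the unique node of the derivation tree whose border it
  crosses. A single character has no border, which is why \<open>m = 1\<close> is excluded.\<close>

lemma windows_count:
  assumes "2 \<le> m" "i \<in> {1..n}"
  shows "(\<Sum>j=1..n. count_label j (derivation_tree G i) * wd j) = length (val G i) + 1 - m"
  using assms(2)
proof (induction i rule: less_induct)
  case (less i)
  show ?case
  proof (cases "rhs_of G i")
    case (Char a)
    then show ?thesis using assms(1) sum_if_wd[OF less.prems]
      by (simp add: derivation_tree_Char val_Char wd_def)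
  next
    case (Pair l r)
    note lr = Pair_range[OF Pair less.prems]
    have "(\<Sum>j=1..n. count_label j (derivation_tree G i) * wd j) =
       (\<Sum>j=1..n. (if i = j then 1 else 0) * wd j) + (\<Sum>j=1..n. count_label j (derivation_tree G l) * wd j)
       + (\<Sum>j=1..n. count_label j (derivation_tree G r) * wd j)"
      by (simp only: derivation_tree_Pair[OF Pair less.prems] count_label.simps distrib_right sum.distrib)
    also have "\<dots> = wd i + (length (val G l) + 1 - m) + (length (val G r) + 1 - m)"
      using less.IH[of l] less.IH[of r] lr less.prems sum_if_wd[OF less.prems] by simp
    finally show ?thesis using windows_Pair[OF Pair less.prems] by simp
  qed
qed

lemma alpha_eq: "alpha G m = (\<Sum>j=1..n. (int (vOcc G j) - 1) * int (wd j))"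
proof -
  have "(\<Sum>j=1..n. (int (vOcc G j) - 1) * int (wd j)) =
    (\<Sum>j\<in>{j\<in>{1..n}. m \<le> length (val G j)}. (int (vOcc G j) - 1) * int (wd j))"
    by (rule sum.mono_neutral_right) (auto simp: wd_def split: rhs.split)
  also have "\<dots> = alpha G m"
    unfolding alpha_def n_def[symmetric]
  proof (rule sum.cong[OF refl])
    fix j assume j: "j \<in> {j\<in>{1..n}. m \<le> length (val G j)}"
    show "(int (vOcc G j) - 1) * int (wd j) = (case rhs_of G j of
        Char a \<Rightarrow> 0
      | Pair l r \<Rightarrow> (int (vOcc G j) - 1) * (int (length (t_string G m l r)) - (int m - 1)))"
    proof (cases "rhs_of G j")
      case (Pair l r)
      then show ?thesis using j wd_Pair[OF Pair] by (simp add: length_t_string)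
    qed (simp add: wd_def)
  qed
  finally show ?thesis by simp
qed

text \<open>A variable outside the derivation tree enters \<alpha> with the factor -1; the condition
  rules this out.\<close>

lemma alpha_nonneg:
  assumes "\<forall>j\<in>{1..n}. 1 \<le> vOcc G j" shows "0 \<le> alpha G m"
  unfolding alpha_eq
proof (intro sum_nonneg mult_nonneg_nonneg)
  fix j assume "j \<in> {1..n}"
  then have "1 \<le> vOcc G j" using assms by blast
  then show "0 \<le> int (vOcc G j) - 1" by simp
qed simp

lemma wd_1: "m = 1 \<Longrightarrow> wd j = 0"
proof -
  assume "m = 1"
  then have "min (m - 1) a + min (m - 1) b - (m - 1) = 0" for a b by simp
  then show ?thesis unfolding wd_def length_t_string by (cases "rhs_of G j") (simp_all only: rhs.case if_cancel)
qed

lemma N_minus_alpha: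
  assumes "m \<le> length (val G n)"
  shows "int (length (val G n)) - alpha G m =
    (if m = 1 then int (length (val G n)) else int m - 1 + int (\<Sum>j=1..n. wd j))"
proof (cases "m = 1")
  case True
  have "alpha G m = 0" unfolding alpha_eq wd_1[OF True] by simp
  then show ?thesis using True by simp
next
  case False
  then have m2: "2 \<le> m" using m1 by simp
  have "alpha G m = int (\<Sum>j=1..n. vOcc G j * wd j) - int (\<Sum>j=1..n. wd j)"
    unfolding alpha_eq left_diff_distrib sum_subtractf by simp
  also have "(\<Sum>j=1..n. vOcc G j * wd j) = length (val G n) + 1 - m"
    using windows_count[OF m2, of n] n1 unfolding vOcc_def n_def[symmetric] by simp
  finally have "alpha G m = int (length (val G n) + 1 - m) - int (\<Sum>j=1..n. wd j)" .
  moreover have "int (length (val G n) + 1 - m) = int (length (val G n)) + 1 - int m" using assms by linarith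
  ultimately show ?thesis using False by simp
qed

end

section \<open>A depth-first traversal that expands every variable once\<close>

text \<open>The components indexed by a variable are its length (0 if it has not been completed yet), the
  bounds of its first occurrence in the text, the position in the text where its right
  child starts, and its new number (0 if it is shorter than the pattern). The new numbers
  \<open>1, \<dots>, nid\<close> index the tables of left and right children, window counts, the first window of the right
  child, and the position in the text of the first window that belongs to neither child.
  The last three components serve the verification only: \<open>tV\<close> inverts the
  numbering, \<open>clk\<close> counts steps, and \<open>good\<close> records that no subtraction was truncated and no
  access was out of bounds.\<close>

record dstate =
  tx :: "int list"
  vlen :: "nat \<Rightarrow> nat"
  vst :: "nat \<Rightarrow> nat"
  ven :: "nat \<Rightarrow> nat"
  vmid :: "nat \<Rightarrow> nat"
  vid :: "nat \<Rightarrow> nat"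
  nid :: nat
  tL :: "nat \<Rightarrow> nat"
  tR :: "nat \<Rightarrow> nat"
  tG :: "nat \<Rightarrow> nat"
  tM :: "nat \<Rightarrow> nat"
  tB :: "nat \<Rightarrow> nat"
  tV :: "nat \<Rightarrow> nat"
  clk :: nat
  good :: bool

text \<open>The first window that belongs to neither child starts \<open>min (m - 1)\<close> of the
  left length before the border \<open>vmid\<close>, which explains \<open>tB\<close>. Short
  variables get no number, so in the tables they appear as the empty child 0.\<close>

definition regi :: "nat \<Rightarrow> nat \<Rightarrow> nat \<Rightarrow> nat \<Rightarrow> dstate \<Rightarrow> dstate" where
  "regi m v l r s = (if vlen s v < m then s else
     s\<lparr>nid := nid s + 1, vid := (vid s)(v := nid s + 1),
       tL := (tL s)(nid s + 1 := vid s l), tR := (tR s)(nid s + 1 := vid s r),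
       tM := (tM s)(nid s + 1 := vlen s v + 1 - m - tG s (vid s r)),
       tG := (tG s)(nid s + 1 := vlen s v + 1 - m),
       tB := (tB s)(nid s + 1 := vmid s v - (if vlen s l < m then vlen s l else m - 1)),
       tV := (tV s)(nid s + 1 := v),
       good := (good s \<and> tG s (vid s r) \<le> vlen s v + 1 - m \<and> vmid s v \<le> length (tx s) \<and>
         (if vlen s l < m then vlen s l else m - 1) \<le> vmid s v)\<rparr>)"

text \<open>A character rule has no children, hence the zeros. It receives a number only for
  \<open>m = 1\<close>, and then the new character is its only own window.\<close>

definition chr :: "nat \<Rightarrow> nat \<Rightarrow> int \<Rightarrow> dstate \<Rightarrow> dstate" where
  "chr m v a s = regi m v 0 0
     (s\<lparr>tx := tx s @ [a], vlen := (vlen s)(v := 1), vst := (vst s)(v := length (tx s)),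
        vmid := (vmid s)(v := length (tx s)), ven := (ven s)(v := length (tx s) + 1), clk := clk s + 1\<rparr>)"

definition opn :: "nat \<Rightarrow> dstate \<Rightarrow> dstate" where
  "opn v s = s\<lparr>vst := (vst s)(v := length (tx s)), vmid := (vmid s)(v := length (tx s)), clk := clk s + 1\<rparr>"

definition mdl :: "nat \<Rightarrow> dstate \<Rightarrow> dstate" where
  "mdl v s = s\<lparr>vmid := (vmid s)(v := length (tx s)), clk := clk s + 1\<rparr>"

definition fin :: "slp \<Rightarrow> nat \<Rightarrow> nat \<Rightarrow> nat \<Rightarrow> nat \<Rightarrow> dstate \<Rightarrow> dstate" where
  "fin G m v l r s = regi m v l r
     (s\<lparr>vlen := (vlen s)(v := vlen s l + vlen s r), ven := (ven s)(v := length (tx s)), clk := clk s + 1,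
        good := (good s \<and> vlen s l + vlen s r \<le> length (val G (length G)))\<rparr>)"

text \<open>The text of the first occurrence may itself have been assembled from shortened copies.
  Of a long variable, only its first and last \<open>m\<close> characters are known to agree with
  the value, and exactly these are copied.\<close>

definition rpt :: "nat \<Rightarrow> nat \<Rightarrow> dstate \<Rightarrow> dstate" where
  "rpt m v s = s\<lparr>tx := tx s @
       (if vlen s v < m then take (vlen s v) (drop (vst s v) (tx s))
        else take m (drop (vst s v) (tx s)) @ take m (drop (ven s v - m) (tx s))),
     clk := clk s + 1,
     good := (good s \<and> vst s v + (if vlen s v < m then vlen s v else m) \<le> length (tx s) \<and>
       ven s v \<le> length (tx s) \<and> (m \<le> vlen s v \<longrightarrow> m \<le> ven s v))\<rparr>"

text \<open>The state is threaded through both recursive calls, so whatever was completed inside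
  \<open>l\<close>, possibly \<open>r\<close> itself, is only copied inside
  \<open>r\<close>.\<close>

function vis :: "slp \<Rightarrow> nat \<Rightarrow> nat \<Rightarrow> dstate \<Rightarrow> dstate" where
  "vis G m v s = (if vlen s v \<noteq> 0 then rpt m v s
     else case rhs_of G v of
       Char a \<Rightarrow> chr m v a s
     | Pair l r \<Rightarrow> if l < v \<and> r < v
         then fin G m v l r (vis G m r (mdl v (vis G m l (opn v s)))) else s)"
  by pat_completeness auto
termination by (relation "measure (\<lambda>(G, m, v, s). v)") auto

declare vis.simps [simp del]

lemma conv_window:
  assumes "\<And>k. k < length P \<Longrightarrow> S ! (i + k) = S' ! (j + k)"
  shows "conv S P (Suc i) = conv S' P (Suc j)"
  unfolding conv_def
proof (intro sum.cong refl)
  fix x assume "x \<in> {1..length P}"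
  then show "P ! (x - 1) * S ! (Suc i + x - 1 - 1) = P ! (x - 1) * S' ! (Suc j + x - 1 - 1)"
    using assms[of "x - 1"] by (cases x) auto
qed

section \<open>Fragments and the invariant of the traversal\<close>

context slp_pattern
begin

text \<open>The text produced for a variable determines the windows across its borders.\<close>

definition frag :: "int list \<Rightarrow> int list \<Rightarrow> bool" where
  "frag u x \<longleftrightarrow> (length x < m \<longrightarrow> u = x) \<and>
     (m \<le> length x \<longrightarrow> m \<le> length u \<and> (\<forall>j<m. u ! j = x ! j) \<and>
        (\<forall>d\<in>{1..m}. u ! (length u - d) = x ! (length x - d)))"

lemma frag_prefix: "frag u x \<Longrightarrow> j < length x \<Longrightarrow> j < m \<Longrightarrow> j < length u \<and> u ! j = x ! j"
  unfolding frag_def by (cases "length x < m") auto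

lemma frag_suffix:
  "frag u x \<Longrightarrow> 1 \<le> d \<Longrightarrow> d \<le> length x \<Longrightarrow> d \<le> m \<Longrightarrow> d \<le> length u \<and> u ! (length u - d) = x ! (length x - d)"
  unfolding frag_def by (cases "length x < m") auto

text \<open>The reason why shortened copies may be used again as building blocks: an end of the
  concatenation reaches beyond one part only if that part is short, and short parts are kept in
  full.\<close>

lemma frag_append:
  assumes "frag u x" "frag v y" shows "frag (u @ v) (x @ y)"
proof -
  have xs: "length x < m \<Longrightarrow> u = x" "m \<le> length x \<Longrightarrow> m \<le> length u"
    and ys: "length y < m \<Longrightarrow> v = y" "m \<le> length y \<Longrightarrow> m \<le> length v"
    using assms by (auto simp: frag_def)
  have "m \<le> length (u @ v)" if "m \<le> length (x @ y)" using xs ys that by (cases "m \<le> length x"; cases "m \<le> length y") auto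
  moreover have "(u @ v) ! j = (x @ y) ! j" if "m \<le> length (x @ y)" "j < m" for j
  proof (cases "length x < m")
    case True
    then show ?thesis using xs that frag_prefix[OF assms(2), of "j - length x"] by (auto simp: nth_append)
  next
    case False
    then show ?thesis using xs that frag_prefix[OF assms(1), of j] by (auto simp: nth_append)
  qed
  moreover have "(u @ v) ! (length (u @ v) - d) = (x @ y) ! (length (x @ y) - d)"
    if "m \<le> length (x @ y)" "d \<in> {1..m}" for d
  proof (cases "d \<le> length y")
    case True
    then have "d \<le> length v" "v ! (length v - d) = y ! (length y - d)"
      using frag_suffix[OF assms(2), of d] that by auto
    then show ?thesis using True that by (auto simp: nth_append)
  next
    case False
    then have vy: "v = y" using that ys by auto
    then have "d - length y \<le> length u" "u ! (length u - (d - length y)) = x ! (length x - (d - length y))"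
      using frag_suffix[OF assms(1), of "d - length y"] that False by auto
    then show ?thesis using False that vy by (auto simp: nth_append)
  qed
  ultimately show ?thesis using xs ys by (auto simp: frag_def)
qed

text \<open>These are the facts about one node that \<open>search_structure\<close> demands, with
  the convolution of its value as the sequence; own windows are located in the text.\<close>

definition tab_inv :: "dstate \<Rightarrow> nat \<Rightarrow> bool" where
  "tab_inv s i \<longleftrightarrow> tV s i \<in> {1..n} \<and> 1 \<le> tG s i \<and> tG s i = length (val G (tV s i)) + 1 - m \<and>
     length (val G (tV s i)) \<le> length (val G n) \<and> tL s i < i \<and> tR s i < i \<and> tM s i + tG s (tR s i) = tG s i \<and> tG s (tL s i) \<le> tM s i \<and>
     tG s (tL s i) < tG s i \<and> tG s (tR s i) < tG s i \<and>
     (\<forall>y<tG s (tL s i). conv (val G (tV s i)) P (Suc y) = conv (val G (tV s (tL s i))) P (Suc y)) \<and>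
     (\<forall>y<tG s (tR s i). conv (val G (tV s i)) P (Suc (tM s i + y)) = conv (val G (tV s (tR s i))) P (Suc y)) \<and>
     (\<forall>y<tM s i. tG s (tL s i) \<le> y \<longrightarrow> tB s i + (y - tG s (tL s i)) + m \<le> length (tx s) \<and>
        conv (val G (tV s i)) P (Suc y) = conv (tx s) P (Suc (tB s i + (y - tG s (tL s i)))))"

definition var_inv :: "dstate \<Rightarrow> nat \<Rightarrow> bool" where
  "var_inv s v \<longleftrightarrow> vlen s v = length (val G v) \<and> vst s v \<le> ven s v \<and> ven s v \<le> length (tx s) \<and>
     frag (take (ven s v - vst s v) (drop (vst s v) (tx s))) (val G v) \<and>
     (length (val G v) < m \<longrightarrow> vid s v = 0) \<and>
     (m \<le> length (val G v) \<longrightarrow> vid s v \<in> {1..nid s} \<and> tV s (vid s v) = v)"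

definition dinv :: "dstate \<Rightarrow> bool" where
  "dinv s \<longleftrightarrow> (\<forall>v. vlen s v = 0 \<longrightarrow> vid s v = 0) \<and> tG s 0 = 0 \<and> vlen s 0 = 0 \<and>
     (\<forall>v\<in>{1..n}. vlen s v \<noteq> 0 \<longrightarrow> var_inv s v) \<and> (\<forall>i\<in>{1..nid s}. tab_inv s i)"

lemma tab_inv_append:
  assumes "tab_inv s i" "tx s' = tx s @ u" "tL s' i = tL s i" "tR s' i = tR s i"
    "tB s' i = tB s i" "tM s' i = tM s i" "\<And>j. j \<le> i \<Longrightarrow> tG s' j = tG s j" "\<And>j. j \<le> i \<Longrightarrow> tV s' j = tV s j"
  shows "tab_inv s' i"
proof -
  have c: "conv (tx s @ u) P (Suc k) = conv (tx s) P (Suc k)" if "k + m \<le> length (tx s)" for k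
    using that m_def by (intro conv_window) (auto simp: nth_append)
  have le: "tL s i \<le> i" "tR s i \<le> i" using assms(1) by (auto simp: tab_inv_def)
  have g: "tG s' i = tG s i" "tG s' (tL s i) = tG s (tL s i)" "tG s' (tR s i) = tG s (tR s i)"
    "tV s' i = tV s i" "tV s' (tL s i) = tV s (tL s i)" "tV s' (tR s i) = tV s (tR s i)"
    using assms(7,8) le by auto
  show ?thesis using assms(1) unfolding tab_inv_def assms(2-6) g using c by auto
qed

lemma var_inv_append:
  assumes "var_inv s v" "tx s' = tx s @ u" "vlen s' v = vlen s v" "vst s' v = vst s v" "ven s' v = ven s v"
    "vid s' v = vid s v" "nid s \<le> nid s'" "\<And>j. j \<le> nid s \<Longrightarrow> tV s' j = tV s j"
  shows "var_inv s' v"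
proof -
  have "take (ven s v - vst s v) (drop (vst s v) (tx s @ u)) = take (ven s v - vst s v) (drop (vst s v) (tx s))"
    using assms(1) by (auto simp: var_inv_def)
  then show ?thesis using assms(1,7,8) unfolding var_inv_def assms(2-6) by auto
qed

lemma dinv_append:
  assumes "dinv s" "tx s' = tx s @ u" "vlen s' = vlen s" "vid s' = vid s" "nid s' = nid s"
    "tL s' = tL s" "tR s' = tR s" "tG s' = tG s" "tM s' = tM s" "tB s' = tB s" "tV s' = tV s"
    "\<And>v. vlen s v \<noteq> 0 \<Longrightarrow> vst s' v = vst s v" "\<And>v. vlen s v \<noteq> 0 \<Longrightarrow> ven s' v = ven s v"
  shows "dinv s'"
  unfolding dinv_def
proof (intro conjI ballI impI)
  fix v assume "v \<in> {1..n}" "vlen s' v \<noteq> 0"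
  then show "var_inv s' v" using assms by (intro var_inv_append[of s v s' u]) (auto simp: dinv_def)
next
  fix i assume "i \<in> {1..nid s'}"
  then show "tab_inv s' i" using assms by (intro tab_inv_append[of s i s' u]) (auto simp: dinv_def)
qed (use assms in \<open>auto simp: dinv_def\<close>)

lemma dinv_opn: "dinv s \<Longrightarrow> vlen s v = 0 \<Longrightarrow> dinv (opn v s)"
  by (rule dinv_append[of s _ "[]"]) (auto simp: opn_def)

lemma dinv_mdl: "dinv s \<Longrightarrow> dinv (mdl v s)"
  by (rule dinv_append[of s _ "[]"]) (auto simp: mdl_def)

text \<open>A short variable is represented by node 0, whose count 0 agrees with the truncated
  subtraction. Thus short and long children need no separate treatment.\<close>

lemma vid_window_count:
  assumes "dinv s" "v \<in> {1..n}" "vlen s v \<noteq> 0"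
  shows "vlen s v = length (val G v)" "tG s (vid s v) = length (val G v) + 1 - m" "vid s v \<le> nid s"
    "0 < tG s (vid s v) \<Longrightarrow> tV s (vid s v) = v"
proof -
  have v: "var_inv s v" using assms by (auto simp: dinv_def)
  show "vlen s v = length (val G v)" using v by (simp add: var_inv_def)
  show "tG s (vid s v) = length (val G v) + 1 - m"
  proof (cases "m \<le> length (val G v)")
    case True
    then have i: "vid s v \<in> {1..nid s}" "tV s (vid s v) = v" using v by (auto simp: var_inv_def)
    then have "tab_inv s (vid s v)" using assms(1) by (auto simp: dinv_def)
    then show ?thesis using i by (auto simp: tab_inv_def)
  qed (use v assms(1) in \<open>auto simp: var_inv_def dinv_def\<close>)
  show "vid s v \<le> nid s" "0 < tG s (vid s v) \<Longrightarrow> tV s (vid s v) = v"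
    using v assms(1) by (cases "m \<le> length (val G v)"; auto simp: var_inv_def dinv_def)+
qed

text \<open>\<open>s\<close> is the state just before the number of \<open>v\<close> is registered.\<close>

lemma dinv_regi:
  assumes inv: "\<forall>x. vlen s x = 0 \<longrightarrow> vid s x = 0" "tG s 0 = 0" "vlen s 0 = 0"
      "\<forall>x\<in>{1..n}. vlen s x \<noteq> 0 \<and> x \<noteq> v \<longrightarrow> var_inv s x" "\<forall>i\<in>{1..nid s}. tab_inv s i"
    and N: "length (val G v) \<le> length (val G n)"
    and v: "v \<in> {1..n}" "vlen s v = length (val G v)" "vst s v \<le> ven s v" "ven s v = length (tx s)"
      "frag (drop (vst s v) (tx s)) (val G v)" "length (val G v) < m \<Longrightarrow> vid s v = 0"
    and tab: "vid s l \<le> nid s" "vid s r \<le> nid s" "l \<noteq> v" "r \<noteq> v"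
      "tG s (vid s l) + tG s (vid s r) \<le> length (val G v) + 1 - m"
      "m \<le> length (val G v) \<Longrightarrow> tG s (vid s l) < length (val G v) + 1 - m"
      "m \<le> length (val G v) \<Longrightarrow> tG s (vid s r) < length (val G v) + 1 - m"
      "\<And>y. y < tG s (vid s l) \<Longrightarrow> conv (val G v) P (Suc y) = conv (val G (tV s (vid s l))) P (Suc y)"
      "\<And>y. y < tG s (vid s r) \<Longrightarrow> conv (val G v) P (Suc (length (val G v) + 1 - m - tG s (vid s r) + y)) =
          conv (val G (tV s (vid s r))) P (Suc y)"
      "(if vlen s l < m then vlen s l else m - 1) \<le> vmid s v"
      "vmid s v \<le> length (tx s)"
      "\<And>y. tG s (vid s l) \<le> y \<Longrightarrow> y < length (val G v) + 1 - m - tG s (vid s r) \<Longrightarrow>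
          vmid s v - (if vlen s l < m then vlen s l else m - 1) + (y - tG s (vid s l)) + m \<le> length (tx s) \<and>
          conv (val G v) P (Suc y) = conv (tx s) P (Suc (vmid s v -
            (if vlen s l < m then vlen s l else m - 1) + (y - tG s (vid s l))))"
    and good: "good s"
  shows "dinv (regi m v l r s) \<and> good (regi m v l r s)"
proof (cases "vlen s v < m")
  case True
  have "var_inv s v" using v True by (auto simp: var_inv_def)
  then have "dinv s" using inv by (auto simp: dinv_def)
  then show ?thesis using True good by (simp add: regi_def)
next
  case False
  let ?s = "regi m v l r s"
  have s: "tx ?s = tx s" "vlen ?s = vlen s" "vst ?s = vst s" "ven ?s = ven s" "vid ?s = (vid s)(v := nid s + 1)"
    "nid ?s = nid s + 1" "tL ?s = (tL s)(nid s + 1 := vid s l)" "tR ?s = (tR s)(nid s + 1 := vid s r)"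
    "tM ?s = (tM s)(nid s + 1 := vlen s v + 1 - m - tG s (vid s r))"
    "tG ?s = (tG s)(nid s + 1 := vlen s v + 1 - m)"
    "tB ?s = (tB s)(nid s + 1 := vmid s v - (if vlen s l < m then vlen s l else m - 1))"
    "tV ?s = (tV s)(nid s + 1 := v)"
    using False by (simp_all add: regi_def)
  have "var_inv ?s x" if "x \<in> {1..n}" "vlen ?s x \<noteq> 0" for x
  proof (cases "x = v")
    case True
    then show ?thesis using v False by (simp add: var_inv_def s)
  next
    case x: False
    then have "var_inv s x" using that inv s by simp
    then show ?thesis by (rule var_inv_append[where u = "[]"]) (use x in \<open>simp_all add: s\<close>)
  qed
  moreover have "tab_inv ?s i" if "i \<in> {1..nid ?s}" for i
  proof (cases "i = nid s + 1")
    case True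
    have ne: "vid s l \<noteq> nid s + 1" "vid s r \<noteq> nid s + 1" using tab by auto
    have l: "vlen s v = length (val G v)" by (rule v)
    show ?thesis
      unfolding True tab_inv_def s l fun_upd_same fun_upd_other[OF ne(1)] fun_upd_other[OF ne(2)]
    proof (intro conjI allI impI)
      show "length (val G v) + 1 - m - tG s (vid s r) + tG s (vid s r) = length (val G v) + 1 - m"
        "tG s (vid s l) \<le> length (val G v) + 1 - m - tG s (vid s r)"
        using tab(5) by linarith+
      show "1 \<le> length (val G v) + 1 - m" using False l by linarith
      show "tG s (vid s l) < length (val G v) + 1 - m" "tG s (vid s r) < length (val G v) + 1 - m"
        using tab(6,7) False l by auto
      show "vid s l < nid s + 1" "vid s r < nid s + 1" using tab(1,2) by linarith+
      show "v \<in> {1..n}" by (rule v)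
      show "length (val G v) \<le> length (val G n)" by (rule N)
    qed (rule refl tab(8) tab(9) tab(12)[THEN conjunct1] tab(12)[THEN conjunct2]; assumption)+
  next
    case i: False
    then have "i \<le> nid s" "tab_inv s i" using that inv(5) unfolding s by auto
    then show ?thesis by (intro tab_inv_append[of s i ?s "[]"]) (simp_all add: s)
  qed
  moreover have "good ?s" using False good tab v by (simp add: regi_def)
  moreover have "vid ?s x = 0" if "vlen ?s x = 0" for x
    using that inv(1) False m1 by (cases "x = v") (simp_all add: s)
  ultimately show ?thesis using inv(2,3) v False unfolding dinv_def by (simp add: s)
qed

end

context slp_pattern
begin

lemma dinv_chr:
  assumes inv: "dinv s" "good s" and v: "v \<in> {1..n}" "vlen s v = 0" and a: "rhs_of G v = Char a"
  shows "dinv (chr m v a s) \<and> good (chr m v a s)"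
proof -
  let ?s = "s\<lparr>tx := tx s @ [a], vlen := (vlen s)(v := 1), vst := (vst s)(v := length (tx s)),
        vmid := (vmid s)(v := length (tx s)), ven := (ven s)(v := length (tx s) + 1), clk := clk s + 1\<rparr>"
  have val: "val G v = [a]" by (rule val_Char[OF a])
  have N: "length (val G v) \<le> length (val G n)" using val_nonempty[of n] n1 by (simp add: val Suc_le_eq)
  have s0: "vlen s 0 = 0" "tG s 0 = 0" "vid s 0 = 0" "vid s v = 0" and v0: "v \<noteq> 0"
    using inv v by (auto simp: dinv_def)
  show ?thesis unfolding chr_def
  proof (rule dinv_regi)
    show "\<forall>x\<in>{1..n}. vlen ?s x \<noteq> 0 \<and> x \<noteq> v \<longrightarrow> var_inv ?s x"
    proof (intro ballI impI)
      fix x assume x: "x \<in> {1..n}" "vlen ?s x \<noteq> 0 \<and> x \<noteq> v"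
      then have "var_inv s x" using inv by (auto simp: dinv_def)
      then show "var_inv ?s x" by (rule var_inv_append[where u = "[a]"]) (use x in simp_all)
    qed
    show "\<forall>i\<in>{1..nid ?s}. tab_inv ?s i"
    proof
      fix i assume "i \<in> {1..nid ?s}"
      then have "tab_inv s i" using inv by (auto simp: dinv_def)
      then show "tab_inv ?s i" by (rule tab_inv_append[where u = "[a]"]) simp_all
    qed
    fix y assume y: "y < length (val G v) + 1 - m - tG ?s (vid ?s 0)"
    then have "m = 1" "y = 0" using val s0 v0 m1 by auto
    then show "vmid ?s v - (if vlen ?s 0 < m then vlen ?s 0 else m - 1) + (y - tG ?s (vid ?s 0)) + m \<le> length (tx ?s) \<and>
          conv (val G v) P (Suc y) = conv (tx ?s) P (Suc (vmid ?s v -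
            (if vlen ?s 0 < m then vlen ?s 0 else m - 1) + (y - tG ?s (vid ?s 0))))"
      using s0 v0 val m_def by (auto intro!: conv_window)
  qed (use inv v s0 v0 val m1 N in \<open>auto simp: dinv_def frag_def\<close>)
qed

text \<open>A window across the border sees at most \<open>m - 1\<close> characters on either side,
  and there the fragments of the two children agree with their values.\<close>

lemma dinv_fin:
  assumes inv: "dinv s" "good s" and v: "v \<in> {1..n}" "vlen s v = 0" and lr: "rhs_of G v = Pair l r"
    and seen: "vlen s l \<noteq> 0" "vlen s r \<noteq> 0"
    and t: "tx s = T @ u1 @ u2" "frag u1 (val G l)" "frag u2 (val G r)"
      "vst s v = length T" "vmid s v = length T + length u1"
    and N: "length (val G v) \<le> length (val G n)"
  shows "dinv (fin G m v l r s) \<and> good (fin G m v l r s)"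
proof -
  let ?s = "s\<lparr>vlen := (vlen s)(v := vlen s l + vlen s r), ven := (ven s)(v := length (tx s)), clk := clk s + 1,
        good := (good s \<and> vlen s l + vlen s r \<le> length (val G (length G)))\<rparr>"
  note rng = Pair_range[OF lr v(1)]
  have lrn: "l \<in> {1..n}" "r \<in> {1..n}" "l \<noteq> v" "r \<noteq> v" using rng v by auto
  define a b where "a = length (val G l)" and "b = length (val G r)"
  note wl = vid_window_count[OF inv(1) lrn(1) seen(1), folded a_def]
  note wr = vid_window_count[OF inv(1) lrn(2) seen(2), folded b_def]
  have val: "val G v = val G l @ val G r" by (rule val_Pair[OF lr v(1)])
  have len: "length (val G v) = a + b" by (simp add: val a_def b_def)
  have s: "tx ?s = tx s" "vlen ?s l = a" "vlen ?s r = b" "vlen ?s v = a + b" "vst ?s = vst s" "vmid ?s = vmid s"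
     "ven ?s v = length (tx s)" "vid ?s = vid s" "tG ?s = tG s" "tV ?s = tV s" "nid ?s = nid s"
    using wl(1) wr(1) lrn by simp_all
  \<comment> \<open>How far the first window of neither child reaches to the left of the
    border.\<close>
  define c where "c = (if a < m then a else m - 1)"
  have "0 < a" "0 < b" using val_nonempty[OF lrn(1)] val_nonempty[OF lrn(2)] by (simp_all add: a_def b_def)
  then have c0: "1 \<le> c \<or> m = 1 \<and> c = 0" "c \<le> a" "c \<le> m" using m1 unfolding c_def by (auto split: if_splits)
  then have "c \<le> length u1" using frag_suffix[OF t(2), of c] unfolding a_def by auto
  note c = c0 this
  show ?thesis unfolding fin_def
  proof (rule dinv_regi)
    show "\<forall>x\<in>{1..n}. vlen ?s x \<noteq> 0 \<and> x \<noteq> v \<longrightarrow> var_inv ?s x"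
    proof (intro ballI impI)
      fix x assume x: "x \<in> {1..n}" "vlen ?s x \<noteq> 0 \<and> x \<noteq> v"
      then have "var_inv s x" using inv by (auto simp: dinv_def)
      then show "var_inv ?s x" by (rule var_inv_append[where u = "[]"]) (use x in simp_all)
    qed
    show "\<forall>i\<in>{1..nid ?s}. tab_inv ?s i"
    proof
      fix i assume "i \<in> {1..nid ?s}"
      then have "tab_inv s i" using inv by (auto simp: dinv_def)
      then show "tab_inv ?s i" by (rule tab_inv_append[where u = "[]"]) simp_all
    qed
    show "\<forall>x. vlen ?s x = 0 \<longrightarrow> vid ?s x = 0" "tG ?s 0 = 0" "vlen ?s 0 = 0"
      using inv(1) v by (auto simp: dinv_def)
    show "v \<in> {1..n}" by (rule v)
    show "length (val G v) \<le> length (val G n)" by (rule N)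
    show "vlen ?s v = length (val G v)" unfolding s len ..
    show "vst ?s v \<le> ven ?s v" "ven ?s v = length (tx ?s)" using t(1,4) by simp_all
    show "frag (drop (vst ?s v) (tx ?s)) (val G v)" unfolding val using frag_append[OF t(2,3)] t(1,4) by simp
    show "vid ?s v = 0" unfolding s using inv(1) v(2) by (simp add: dinv_def)
    show "vid ?s l \<le> nid ?s" "vid ?s r \<le> nid ?s" unfolding s using wl wr by auto
    show "l \<noteq> v" "r \<noteq> v" by (rule lrn)+
    show "tG ?s (vid ?s l) + tG ?s (vid ?s r) \<le> length (val G v) + 1 - m"
      unfolding s len wl(2) wr(2) using m1 by linarith
    show "tG ?s (vid ?s l) < length (val G v) + 1 - m" "tG ?s (vid ?s r) < length (val G v) + 1 - m"
      if "m \<le> length (val G v)"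
      using that \<open>0 < a\<close> \<open>0 < b\<close> unfolding s len wl(2) wr(2) by auto
    show "conv (val G v) P (Suc y) = conv (val G (tV ?s (vid ?s l))) P (Suc y)" if "y < tG ?s (vid ?s l)" for y
    proof -
      have y: "y < a + 1 - m" using that unfolding s wl(2) .
      then have "tV s (vid s l) = l" using wl(4) wl(2) by simp
      then show ?thesis unfolding s val using y m_def
        by (auto intro!: conv_window simp: nth_append a_def)
    qed
    show "conv (val G v) P (Suc (length (val G v) + 1 - m - tG ?s (vid ?s r) + y)) =
        conv (val G (tV ?s (vid ?s r))) P (Suc y)" if "y < tG ?s (vid ?s r)" for y
    proof -
      have y: "y < b + 1 - m" using that unfolding s wr(2) .
      then have v: "tV s (vid s r) = r" using wr(4) wr(2) by simp
      have "length (val G v) + 1 - m - tG ?s (vid ?s r) = a"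
        unfolding s len wr(2) using y m1 by linarith
      then show ?thesis unfolding s val v by (auto intro!: conv_window simp: nth_append a_def)
    qed
    show "(if vlen ?s l < m then vlen ?s l else m - 1) \<le> vmid ?s v"
      unfolding s c_def[symmetric] t(5) using c by simp
    show "vmid ?s v \<le> length (tx ?s)" using t(1,5) by simp
    fix y assume y: "tG ?s (vid ?s l) \<le> y" "y < length (val G v) + 1 - m - tG ?s (vid ?s r)"
    then have y': "a + 1 - m \<le> y" "y < a + b + 1 - m - (b + 1 - m)" unfolding s len wl(2) wr(2) by auto
    \<comment> \<open>Either \<open>a < m\<close>, and both differences with \<open>a\<close>
      vanish, or \<open>a - c\<close> equals \<open>a + 1 - m\<close>, which is at most
      \<open>y\<close>.\<close>
    have e: "y - (a + 1 - m) + (a - c) = y" unfolding c_def using y' m1 by auto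
    then have pos: "vmid s v - c + (y - (a + 1 - m)) + a = vmid s v + y" unfolding t(5) using c by linarith
    have "y + m \<le> a + length u2"
    proof (cases "b < m")
      case True
      then show ?thesis using t(3) y' m1 by (auto simp: frag_def b_def)
    next
      case False
      then have "m \<le> length u2" using t(3) by (auto simp: frag_def b_def)
      then show ?thesis using y' False by linarith
    qed
    then have fits: "vmid s v - c + (y - (a + 1 - m)) + m \<le> length (tx s)"
      using pos t(1,5) by simp
    moreover have "conv (val G v) P (Suc y) = conv (tx s) P (Suc (vmid s v - c + (y - (a + 1 - m))))"
    proof (rule conv_window)
      fix k assume k: "k < length P"
      let ?p = "vmid s v - c + (y - (a + 1 - m)) + k"
      have p: "?p + a = length T + length u1 + y + k" using pos t(5) by simp
      show "val G v ! (y + k) = tx s ! ?p"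
      proof (cases "y + k < a")
        case True
        \<comment> \<open>Left of the border, positions are counted from the end of the fragment;
          the distance is at most \<open>m\<close> because the window reaches the border. Right of
          it they are counted from the start of the other fragment.\<close>
        define d where "d = a - (y + k)"
        have d: "1 \<le> d" "d \<le> a" "d \<le> m" using True y' unfolding d_def by auto
        have "u1 ! (length u1 - d) = val G l ! (a - d)" "d \<le> length u1"
          using frag_suffix[OF t(2) d(1), folded a_def, OF d(2,3)] by auto
        moreover have idx: "?p = length T + (length u1 - d)" using p True \<open>d \<le> length u1\<close> unfolding d_def by linarith
        moreover have "a - d = y + k" using True unfolding d_def by simp
        moreover have "length u1 - d < length u1" using d(1) \<open>d \<le> length u1\<close> by linarith
        ultimately show ?thesis using True unfolding idx t(1) val nth_append_length_plus
          by (simp add: nth_append a_def)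
      next
        case False
        define j where "j = y + k - a"
        have j: "j < b" "j < m" using False y' k m_def unfolding j_def by (cases "b < m"; auto)+
        have "j < length u2" "u2 ! j = val G r ! j" using frag_prefix[OF t(3), of j] j b_def by auto
        moreover have idx: "?p = length T + (length u1 + j)" using p False unfolding j_def by linarith
        ultimately show ?thesis using False unfolding idx t(1) val nth_append_length_plus
          by (simp add: nth_append a_def j_def)
      qed
    qed
    ultimately show "vmid ?s v - (if vlen ?s l < m then vlen ?s l else m - 1) + (y - tG ?s (vid ?s l)) + m \<le> length (tx ?s) \<and>
          conv (val G v) P (Suc y) = conv (tx ?s) P (Suc (vmid ?s v -
            (if vlen ?s l < m then vlen ?s l else m - 1) + (y - tG ?s (vid ?s l))))"
      unfolding s wl(2) c_def[symmetric] by blast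
  next
    show "good ?s" using inv(2) N wl(1) wr(1) unfolding n_def by (simp add: len[unfolded n_def])
  qed
qed

lemma dinv_rpt:
  assumes inv: "dinv s" "good s" and v: "v \<in> {1..n}" "vlen s v \<noteq> 0"
  shows "dinv (rpt m v s) \<and> good (rpt m v s) \<and>
    (\<exists>u. tx (rpt m v s) = tx s @ u \<and> frag u (val G v) \<and>
       length u = (if length (val G v) < m then length (val G v) else 2 * m))"
proof -
  define b e where "b = vst s v" and "e = ven s v"
  define reg where "reg = take (e - b) (drop b (tx s))"
  have vi: "vlen s v = length (val G v)" "b \<le> e" "e \<le> length (tx s)" "frag reg (val G v)"
    using inv v unfolding b_def e_def reg_def by (auto simp: dinv_def var_inv_def)
  have lreg: "length reg = e - b" using vi by (simp add: reg_def)
  have nreg: "reg ! j = tx s ! (b + j)" if "j < e - b" for j using that vi by (simp add: reg_def)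
  define u where "u = (if vlen s v < m then take (vlen s v) (drop b (tx s))
        else take m (drop b (tx s)) @ take m (drop (e - m) (tx s)))"
  have tx: "tx (rpt m v s) = tx s @ u" by (simp add: rpt_def u_def b_def e_def)
  have "dinv (rpt m v s)" by (rule dinv_append[OF inv(1) tx]) (simp_all add: rpt_def)
  moreover have "good (rpt m v s) \<and> frag u (val G v) \<and>
     length u = (if length (val G v) < m then length (val G v) else 2 * m)"
  proof (cases "vlen s v < m")
    case True
    then have "reg = val G v" using vi by (simp add: frag_def)
    moreover have "e - b = vlen s v" using lreg vi calculation by simp
    ultimately have "u = val G v" "b + vlen s v \<le> length (tx s)" using True vi by (auto simp: u_def reg_def)
    then show ?thesis using True vi inv(2) by (auto simp: rpt_def frag_def b_def e_def)
  next
    case False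
    then have big: "m \<le> length (val G v)" and f: "m \<le> e - b" "\<And>j. j < m \<Longrightarrow> reg ! j = val G v ! j"
      "\<And>d. d \<in> {1..m} \<Longrightarrow> reg ! (length reg - d) = val G v ! (length (val G v) - d)"
      using vi lreg by (auto simp: frag_def)
    have ue: "u = take m (drop b (tx s)) @ take m (drop (e - m) (tx s))" using False by (simp add: u_def)
    have lu: "length u = 2 * m" using f vi by (simp add: ue)
    have "u ! j = val G v ! j" if "j < m" for j
      using that f vi nreg[of j] by (simp add: ue nth_append)
    moreover have "u ! (length u - d) = val G v ! (length (val G v) - d)" if d: "d \<in> {1..m}" for d
    proof -
      have i: "2 * m - d = length (take m (drop b (tx s))) + (m - d)" using f vi d by simp
      have "u ! (length u - d) = u ! (length (take m (drop b (tx s))) + (m - d))" by (simp only: lu i)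
      also have "\<dots> = take m (drop (e - m) (tx s)) ! (m - d)" by (simp only: ue nth_append_length_plus)
      also have "\<dots> = tx s ! (e - m + (m - d))" using d vi f(1) by (simp add: nth_drop)
      also have "e - m + (m - d) = b + (length reg - d)" using f d vi lreg by auto
      also have "tx s ! \<dots> = reg ! (length reg - d)" using nreg[of "length reg - d"] lreg f d by auto
      finally show ?thesis using f(3)[OF d] by simp
    qed
    ultimately have "frag u (val G v)" using big lu by (auto simp: frag_def)
    then show ?thesis using False big lu vi inv(2) f by (auto simp: rpt_def b_def e_def)
  qed
  ultimately show ?thesis using tx by blast
qed

section \<open>Length of the text and number of steps\<close>

definition seen :: "dstate \<Rightarrow> nat set" where
  "seen s = {j\<in>{1..n}. vlen s j \<noteq> 0}"

definition ws :: "dstate \<Rightarrow> nat" where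
  "ws s = (\<Sum>j\<in>seen s. wd j)"

text \<open>Each variable with two long children contributes \<open>m - 1\<close> windows of its own, which pays for
  the border of at most \<open>2 * m\<close> characters emitted for one of them.\<close>

definition vis_bounds :: "nat \<Rightarrow> dstate \<Rightarrow> dstate \<Rightarrow> bool" where
  "vis_bounds v s s' \<longleftrightarrow>
     (2 \<le> m \<longrightarrow> length (tx s') + 4 * ws s \<le> length (tx s) + 4 * ws s' +
        (if length (val G v) < m then length (val G v) else 2 * m)) \<and>
     length (tx s') \<le> length (tx s) + 2 * m * length (val G v) \<and>
     clk s' + 3 + 4 * length (tx s) \<le> clk s + 4 * length (tx s') \<and>
     clk s' + 4 * card (seen s) \<le> clk s + 4 * card (seen s') + 1 \<and>
     length (tx s') + 2 * m * clk s \<le> length (tx s) + 2 * m * clk s' \<and>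
     nid s' + clk s \<le> nid s + clk s'"

definition vis_post :: "nat \<Rightarrow> dstate \<Rightarrow> dstate \<Rightarrow> bool" where
  "vis_post v s s' \<longleftrightarrow> dinv s' \<and> good s' \<and> vlen s' v = length (val G v) \<and>
     (\<exists>u. tx s' = tx s @ u \<and> frag u (val G v)) \<and>
     (\<forall>x. v < x \<longrightarrow> vlen s' x = vlen s x \<and> vst s' x = vst s x \<and> vmid s' x = vmid s x) \<and>
     (\<forall>x. vlen s x \<noteq> 0 \<longrightarrow> vlen s' x = vlen s x) \<and> vis_bounds v s s'"

lemma regi_simps [simp]:
  "tx (regi m v l r s) = tx s" "vlen (regi m v l r s) = vlen s" "vst (regi m v l r s) = vst s"
  "vmid (regi m v l r s) = vmid s" "clk (regi m v l r s) = clk s"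
  by (simp_all add: regi_def)

lemma nid_regi: "nid (regi m v l r s) \<le> nid s + 1"
  by (simp add: regi_def)

lemma seen_insert: "v \<in> {1..n} \<Longrightarrow> vlen s v = 0 \<Longrightarrow> vlen s' = (vlen s)(v := k) \<Longrightarrow> k \<noteq> 0 \<Longrightarrow>
    seen s' = insert v (seen s) \<and> v \<notin> seen s \<and> finite (seen s)"
  by (auto simp: seen_def)

lemma vis_rpt:
  assumes inv: "dinv s" "good s" and v: "v \<in> {1..n}" "vlen s v \<noteq> 0"
  shows "vis_post v s (rpt m v s)"
proof -
  obtain u where u: "tx (rpt m v s) = tx s @ u" "frag u (val G v)"
      "length u = (if length (val G v) < m then length (val G v) else 2 * m)"
    and d: "dinv (rpt m v s)" "good (rpt m v s)"
    using dinv_rpt[OF assms] by blast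
  have r: "vlen (rpt m v s) = vlen s" "vst (rpt m v s) = vst s" "vmid (rpt m v s) = vmid s"
     "clk (rpt m v s) = clk s + 1" "nid (rpt m v s) = nid s"
    by (simp_all add: rpt_def)
  have se: "seen (rpt m v s) = seen s" "ws (rpt m v s) = ws s" by (simp_all add: seen_def ws_def r)
  have l: "1 \<le> length (val G v)" using val_nonempty[OF v(1)] by (cases "val G v") auto
  have "vlen s v = length (val G v)" by (rule vid_window_count(1)[OF inv(1) v])
  moreover have "length u \<le> 2 * m * length (val G v)" "1 \<le> length u" "length u \<le> 2 * m"
    using l m1 u(3) by (auto intro: order_trans[of _ "2 * m * 1"] order_trans[of _ "2 * 1 * length (val G v)"])
  ultimately show ?thesis using d u(1,2)
    unfolding vis_post_def vis_bounds_def se r u(1) length_append using u(3) by (auto simp: algebra_simps)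
qed

lemma vis_chr:
  assumes inv: "dinv s" "good s" and v: "v \<in> {1..n}" "vlen s v = 0" and a: "rhs_of G v = Char a"
  shows "vis_post v s (chr m v a s)"
proof -
  let ?s = "chr m v a s"
  have d: "dinv ?s \<and> good ?s" by (rule dinv_chr[OF assms])
  have val: "val G v = [a]" by (rule val_Char[OF a])
  have r: "vlen ?s = (vlen s)(v := 1)" "tx ?s = tx s @ [a]" "clk ?s = clk s + 1"
    "\<And>x. x \<noteq> v \<Longrightarrow> vst ?s x = vst s x" "\<And>x. x \<noteq> v \<Longrightarrow> vmid ?s x = vmid s x"
    by (simp_all add: chr_def)
  have q: "nid ?s \<le> nid s + 1" unfolding chr_def by (rule order_trans[OF nid_regi]) simp
  have se: "seen ?s = insert v (seen s)" "v \<notin> seen s" "finite (seen s)"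
    using seen_insert[OF v r(1)] by simp_all
  have w: "ws s \<le> ws ?s" unfolding ws_def se(1) using se(2,3) by simp
  have "tx ?s = tx s @ [a] \<and> frag [a] (val G v)" using r(2) val m1 by (auto simp: frag_def)
  then show ?thesis using d w q v(2) r m1 se(2,3)
    unfolding vis_post_def vis_bounds_def se(1) by (auto simp: val algebra_simps)
qed

lemma opn_simps [simp]:
  "tx (opn v s) = tx s" "vlen (opn v s) = vlen s" "vst (opn v s) = (vst s)(v := length (tx s))"
  "vmid (opn v s) = (vmid s)(v := length (tx s))" "clk (opn v s) = clk s + 1" "nid (opn v s) = nid s"
  "good (opn v s) = good s"
  by (simp_all add: opn_def)

lemma mdl_simps [simp]:
  "tx (mdl v s) = tx s" "vlen (mdl v s) = vlen s" "vst (mdl v s) = vst s"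
  "vmid (mdl v s) = (vmid s)(v := length (tx s))" "clk (mdl v s) = clk s + 1" "nid (mdl v s) = nid s"
  "good (mdl v s) = good s"
  by (simp_all add: mdl_def)

text \<open>The origin of the factor 4. Two long children may emit \<open>4 * m\<close> characters
  while the parent is allowed \<open>2 * m\<close>; the \<open>m - 1\<close> windows across the
  border contribute \<open>4 * (m - 1)\<close>, which is at least \<open>2 * m\<close> for
  \<open>m\<close> at least 2.\<close>

lemma border_cost:
  assumes lr: "rhs_of G v = Pair l r" "v \<in> {1..n}" and m2: "2 \<le> m"
  shows "(if length (val G l) < m then length (val G l) else 2 * m) +
     (if length (val G r) < m then length (val G r) else 2 * m) \<le>
     4 * wd v + (if length (val G v) < m then length (val G v) else 2 * m)"
proof -
  have "1 \<le> length (val G l)" "1 \<le> length (val G r)"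
    using Pair_range[OF lr] lr(2) val_nonempty[of l] val_nonempty[of r] by (auto simp: Suc_le_eq)
  then show ?thesis
    using windows_Pair[OF lr] m2 val_Pair[OF lr] by (auto split: if_splits)
qed

lemma vis_fin:
  assumes v: "v \<in> {1..n}" "vlen s v = 0" and lr: "rhs_of G v = Pair l r"
    and N: "length (val G v) \<le> length (val G n)"
    and 1: "vis_post l (opn v s) s2" and 2: "vis_post r (mdl v s2) s4"
  shows "vis_post v s (fin G m v l r s4)"
proof -
  let ?s = "fin G m v l r s4"
  note rng = Pair_range[OF lr v(1)]
  have lrn: "l \<in> {1..n}" "r \<in> {1..n}" "l < v" "r < v" using rng v by auto
  have nonz: "length (val G l) \<noteq> 0" "length (val G r) \<noteq> 0" using val_nonempty lrn by auto
  have val: "val G v = val G l @ val G r" by (rule val_Pair[OF lr v(1)])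
  obtain u1 where u1: "tx s2 = tx s @ u1" "frag u1 (val G l)" using 1 by (auto simp: vis_post_def)
  obtain u2 where u2: "tx s4 = tx s2 @ u2" "frag u2 (val G r)" using 2 by (auto simp: vis_post_def)
  have p2: "vlen s2 l = length (val G l)" "\<And>x. l < x \<Longrightarrow> vlen s2 x = vlen s x"
     "vst s2 v = length (tx s)" "\<And>x. v < x \<Longrightarrow> vst s2 x = vst s x \<and> vmid s2 x = vmid s x"
     "\<And>x. vlen s x \<noteq> 0 \<Longrightarrow> vlen s2 x = vlen s x"
    using 1 lrn by (auto simp: vis_post_def)
  have p4: "vlen s4 r = length (val G r)" "\<And>x. r < x \<Longrightarrow> vlen s4 x = vlen s2 x"
     "vst s4 v = vst s2 v" "vmid s4 v = length (tx s2)" "\<And>x. v < x \<Longrightarrow> vst s4 x = vst s2 x \<and> vmid s4 x = vmid s2 x"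
     "\<And>x. vlen s2 x \<noteq> 0 \<Longrightarrow> vlen s4 x = vlen s2 x" "dinv s4" "good s4"
    using 2 lrn by (auto simp: vis_post_def)
  have v4: "vlen s4 v = 0" using p2(2) p4(2) lrn v by simp
  have l4: "vlen s4 l = length (val G l)" using p4(6)[of l] p2(1) nonz by simp
  have d: "dinv ?s \<and> good ?s"
    by (rule dinv_fin[where ?u1.0 = u1 and ?u2.0 = u2 and T = "tx s"])
      (use p4 v v4 lr l4 nonz u1 u2 p2 N in auto)
  have f: "vlen ?s = (vlen s4)(v := length (val G v))" "tx ?s = tx s4" "clk ?s = clk s4 + 1"
     "vst ?s = vst s4" "vmid ?s = vmid s4"
    by (simp_all add: fin_def l4 p4(1) val)
  have q: "nid ?s \<le> nid s4 + 1" unfolding fin_def by (rule order_trans[OF nid_regi]) simp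
  have "length (val G v) \<noteq> 0" using val nonz by simp
  then have se: "seen ?s = insert v (seen s4)" "v \<notin> seen s4" "finite (seen s4)"
    using seen_insert[OF v(1) v4 f(1)] by simp_all
  have w: "ws ?s = ws s4 + wd v" unfolding ws_def se(1) using se(2,3) by simp
  have c: "card (seen ?s) = card (seen s4) + 1" unfolding se(1) using se(2,3) by simp
  have s13: "seen (opn v s) = seen s" "ws (opn v s) = ws s" "seen (mdl v s2) = seen s2" "ws (mdl v s2) = ws s2"
    by (simp_all add: seen_def ws_def)
  have b1: "vis_bounds l (opn v s) s2" and b2: "vis_bounds r (mdl v s2) s4"
    using 1 2 by (auto simp: vis_post_def)
  have "vis_bounds v s ?s"
    unfolding vis_bounds_def f(2)
  proof (intro conjI impI)
    assume m2: "2 \<le> m"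
    show "length (tx s4) + 4 * ws s \<le> length (tx s) + 4 * ws ?s + (if length (val G v) < m then length (val G v) else 2 * m)"
      using b1 b2 m2 border_cost[OF lr v(1) m2] unfolding vis_bounds_def s13 w by simp
  next
    show "length (tx s4) \<le> length (tx s) + 2 * m * length (val G v)"
      using b1 b2 unfolding vis_bounds_def s13 val by (simp add: algebra_simps)
  next
    \<comment> \<open>A recursion tree with \<open>k\<close> leaves takes
      \<open>k + 3 * (k - 1)\<close> steps, and each leaf emits at least one character.\<close>
    show "clk ?s + 3 + 4 * length (tx s) \<le> clk s + 4 * length (tx s4)"
      using b1 b2 unfolding vis_bounds_def s13 f(3) by simp
  next
    \<comment> \<open>Three steps of its own and the slack 1 of each child, less the slack 1 of the
      result, make four steps per newly completed variable.\<close>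
    show "clk ?s + 4 * card (seen s) \<le> clk s + 4 * card (seen ?s) + 1"
      using b1 b2 unfolding vis_bounds_def s13 f(3) c by simp
  next
    have "length (tx s2) + 2 * m * clk s \<le> length (tx s) + 2 * m * clk s2"
      using b1 unfolding vis_bounds_def by (simp add: algebra_simps)
    moreover have "length (tx s4) + 2 * m * clk s2 \<le> length (tx s2) + 2 * m * clk s4"
      using b2 unfolding vis_bounds_def by (simp add: algebra_simps)
    ultimately show "length (tx s4) + 2 * m * clk s \<le> length (tx s) + 2 * m * clk ?s"
      unfolding f(3) by (simp add: algebra_simps)
  next
    show "nid ?s + clk s \<le> nid s + clk ?s"
      using b1 b2 q unfolding vis_bounds_def f(3) by simp
  qed
  moreover have "\<exists>u. tx ?s = tx s @ u \<and> frag u (val G v)"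
    using u1 u2 frag_append[OF u1(2) u2(2)] unfolding f(2) val by auto
  moreover have "vlen ?s x = vlen s x \<and> vst ?s x = vst s x \<and> vmid ?s x = vmid s x" if "v < x" for x
    using p2(2,4) p4(2,5) lrn that unfolding f by auto
  moreover have "vlen ?s x = vlen s x" if "vlen s x \<noteq> 0" for x
    using p2(5)[OF that] p4(6)[of x] that v(2) unfolding f by auto
  ultimately show ?thesis using d f(1) unfolding vis_post_def by auto
qed

theorem vis_correct:
  assumes "dinv s" "good s" "v \<in> {1..n}" "length (val G v) \<le> length (val G n)"
  shows "vis_post v s (vis G m v s)"
  using assms
proof (induction v arbitrary: s rule: less_induct)
  case (less v)
  show ?case
  proof (cases "vlen s v = 0")
    case False
    then show ?thesis using vis_rpt[OF less.prems(1-3)] by (subst vis.simps) simp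
  next
    case z: True
    show ?thesis
    proof (cases "rhs_of G v")
      case (Char a)
      then show ?thesis using vis_chr[OF less.prems(1-3) z] z by (subst vis.simps) simp
    next
      case (Pair l r)
      note rng = Pair_range[OF Pair less.prems(3)]
      have lrn: "l < v" "r < v" "l \<in> {1..n}" "r \<in> {1..n}" using rng less.prems(3) by auto
      have N: "length (val G l) \<le> length (val G n)" "length (val G r) \<le> length (val G n)"
        using less.prems(4) val_Pair[OF Pair less.prems(3)] by auto
      have 1: "vis_post l (opn v s) (vis G m l (opn v s))"
        by (rule less.IH) (use lrn N less.prems dinv_opn z in auto)
      then have "dinv (vis G m l (opn v s))" "good (vis G m l (opn v s))" by (auto simp: vis_post_def)
      then have 2: "vis_post r (mdl v (vis G m l (opn v s))) (vis G m r (mdl v (vis G m l (opn v s))))"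
        by (intro less.IH) (use lrn N dinv_mdl in auto)
      have "vis G m v s = fin G m v l r (vis G m r (mdl v (vis G m l (opn v s))))"
        using z Pair lrn by (subst vis.simps) simp
      then show ?thesis using vis_fin[OF less.prems(3) z Pair less.prems(4) 1 2] by simp
    qed
  qed
qed

end

abbreviation Sq_syntax :: "stm \<Rightarrow> stm \<Rightarrow> stm" (infixr ";;" 60) where
  "s ;; u \<equiv> Sq s u"

text \<open>For loops whose potential depends on data \<open>g\<close> that the state does not
  determine. \<open>wp\<close> requires a function of the state, so the least potential over all
  fitting \<open>g\<close> is taken.\<close>

lemma wp_Whl_ghost:
  fixes \<Phi> :: "'g \<Rightarrow> nat"
  assumes init: "I g0 \<sigma>"
    and ok: "\<And>g \<tau>. I g \<tau> \<Longrightarrow> ok B e \<tau> \<and> ok B f \<tau>"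
    and step: "\<And>g \<tau>. I g \<tau> \<Longrightarrow> ev e \<tau> < ev f \<tau> \<Longrightarrow>
      wp B s (\<lambda>t \<tau>'. \<exists>g'. I g' \<tau>' \<and> t + tm e + tm f + 1 + \<Phi> g' \<le> \<Phi> g) \<tau>"
    and exit: "\<And>g \<tau> t. I g \<tau> \<Longrightarrow> \<not> ev e \<tau> < ev f \<tau> \<Longrightarrow> t + \<Phi> g \<le> \<Phi> g0 + tm e + tm f + 1 \<Longrightarrow> Q t \<tau>"
  shows "wp B (Whl e f s) Q \<sigma>"
proof -
  define \<Psi> where "\<Psi> \<tau> = (LEAST k. \<exists>g. I g \<tau> \<and> k = \<Phi> g)" for \<tau>
  have ex: "\<exists>g. I g \<tau> \<and> \<Psi> \<tau> = \<Phi> g" if "I g' \<tau>" for g' \<tau>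
    unfolding \<Psi>_def by (rule LeastI_ex) (use that in blast)
  have le: "\<Psi> \<tau> \<le> \<Phi> g" if "I g \<tau>" for g \<tau>
    unfolding \<Psi>_def by (rule Least_le) (use that in blast)
  show ?thesis
  proof (rule wp_Whl[where I = "\<lambda>\<tau>. \<exists>g. I g \<tau>" and \<Phi> = \<Psi>])
    show "\<exists>g. I g \<sigma>" using init by blast
    show "ok B e \<tau> \<and> ok B f \<tau>" if "\<exists>g. I g \<tau>" for \<tau> using ok that by blast
    show "wp B s (\<lambda>t \<tau>'. (\<exists>g. I g \<tau>') \<and> t + tm e + tm f + 1 + \<Psi> \<tau>' \<le> \<Psi> \<tau>) \<tau>"
      if I: "\<exists>g. I g \<tau>" and c: "ev e \<tau> < ev f \<tau>" for \<tau>
    proof -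
      obtain g where g: "I g \<tau>" "\<Psi> \<tau> = \<Phi> g" using ex I by blast
      show ?thesis unfolding g(2)
      proof (rule wp_mono[OF step[OF g(1) c]])
        fix t \<tau>' assume "\<exists>g'. I g' \<tau>' \<and> t + tm e + tm f + 1 + \<Phi> g' \<le> \<Phi> g"
        then obtain g' where g': "I g' \<tau>'" "t + tm e + tm f + 1 + \<Phi> g' \<le> \<Phi> g" by blast
        then show "(\<exists>g. I g \<tau>') \<and> t + tm e + tm f + 1 + \<Psi> \<tau>' \<le> \<Phi> g" using le[OF g'(1)] by auto
      qed
    qed
    show "Q t \<tau>" if I: "\<exists>g. I g \<tau>" and c: "\<not> ev e \<tau> < ev f \<tau>" "t + \<Psi> \<tau> \<le> \<Psi> \<sigma> + tm e + tm f + 1" for \<tau> t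
    proof -
      obtain g where g: "I g \<tau>" "\<Psi> \<tau> = \<Phi> g" using ex I by blast
      show ?thesis by (rule exit[OF g(1) c(1)]) (use c(2) g(2) le[OF init] in linarith)
    qed
  qed
qed

section \<open>The traversal with an explicit stack\<close>

definition dstate0 :: dstate where
  "dstate0 = \<lparr>tx = [], vlen = (\<lambda>_. 0), vst = (\<lambda>_. 0), ven = (\<lambda>_. 0), vmid = (\<lambda>_. 0), vid = (\<lambda>_. 0),
     nid = 0, tL = (\<lambda>_. 0), tR = (\<lambda>_. 0), tG = (\<lambda>_. 0), tM = (\<lambda>_. 0), tB = (\<lambda>_. 0), tV = (\<lambda>_. 0),
     clk = 0, good = True\<rparr>"

text \<open>The stack contains variables to be visited, variables whose right child remains to be visited, and
  variables that remain to be completed.\<close>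

datatype item = Vi nat | Mi nat | Fi nat

fun act :: "slp \<Rightarrow> nat \<Rightarrow> item \<Rightarrow> dstate \<Rightarrow> dstate" where
  "act G m (Vi v) s = vis G m v s"
| "act G m (Mi v) s = (case rhs_of G v of Char a \<Rightarrow> s
     | Pair l r \<Rightarrow> fin G m v l r (vis G m r (mdl v s)))"
| "act G m (Fi v) s = (case rhs_of G v of Char a \<Rightarrow> s | Pair l r \<Rightarrow> fin G m v l r s)"

fun run_stack :: "slp \<Rightarrow> nat \<Rightarrow> item list \<Rightarrow> dstate \<Rightarrow> dstate" where
  "run_stack G m [] s = s"
| "run_stack G m (x # xs) s = run_stack G m xs (act G m x s)"

text \<open>All counters only grow, and \<open>good\<close> is never restored once lost. So bounds
  and \<open>good\<close> of the final state carry over to all earlier states.\<close>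

definition dle :: "dstate \<Rightarrow> dstate \<Rightarrow> bool" where
  "dle s s' \<longleftrightarrow> clk s \<le> clk s' \<and> length (tx s) \<le> length (tx s') \<and> nid s \<le> nid s' \<and> (good s' \<longrightarrow> good s)"

lemma dle_trans: "dle s s' \<Longrightarrow> dle s' s'' \<Longrightarrow> dle s s''"
  by (auto simp: dle_def)

lemma dle_refl [simp]: "dle s s"
  by (simp add: dle_def)

lemma dle_regi: "dle s (regi m v l r s)"
  by (auto simp: dle_def regi_def)

lemma dle_steps: "dle s (rpt m v s)" "dle s (chr m v a s)" "dle s (opn v s)" "dle s (mdl v s)"
    "dle s (fin G m v l r s)"
  by (auto simp: rpt_def opn_def mdl_def chr_def fin_def regi_def dle_def split: if_splits)

lemma dle_vis: "dle s (vis G m v s)"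
proof (induction v arbitrary: s rule: less_induct)
  case (less v)
  have "dle s (fin G m v l r (vis G m r (mdl v (vis G m l (opn v s)))))" if "l < v" "r < v" for l r
    by (rule dle_trans[OF dle_trans[OF dle_trans[OF dle_trans[OF dle_steps(3) less[OF that(1)]]
      dle_steps(4)] less[OF that(2)]] dle_steps(5)])
  then show ?case
    by (subst vis.simps) (auto intro: dle_steps split: rhs.split)
qed

lemma dle_act: "dle s (act G m x s)"
  by (cases x) (auto intro: dle_vis dle_steps dle_trans[OF dle_trans[OF dle_steps(4) dle_vis] dle_steps(5)]
    split: rhs.split)

lemma dle_run_stack: "dle s (run_stack G m xs s)"
  by (induction xs arbitrary: s) (auto intro: dle_trans[OF dle_act])

text \<open>Registers: 0 \<open>n\<close>, 1 \<open>m\<close>, 2 stack height, 3 length of the text, 4 number of registered variables,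
  5--7 the current variable and its children. Word arrays: 2 the stack, 3--7 the components of
  \<^typ>\<open>dstate\<close> indexed by variables, 8--12 the tables. Number array 2 is the text.\<close>

definition regi_prog :: stm where
  "regi_prog = IfL (A 3 (V 5)) (V 1) Skp (
     Asg 4 (Plus (V 4) (K 1)) ;;
     Sto 9 (V 4) (A 7 (V 6)) ;;
     Sto 10 (V 4) (A 7 (V 7)) ;;
     Sto 11 (V 4) (Minus (Minus (Plus (A 3 (V 5)) (K 1)) (V 1)) (A 8 (A 7 (V 7)))) ;;
     Sto 8 (V 4) (Minus (Plus (A 3 (V 5)) (K 1)) (V 1)) ;;
     IfL (A 3 (V 6)) (V 1) (Sto 12 (V 4) (Minus (A 6 (V 5)) (A 3 (V 6))))
       (Sto 12 (V 4) (Minus (A 6 (V 5)) (Minus (V 1) (K 1)))) ;;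
     Sto 7 (V 5) (V 4))"

definition push :: "ex \<Rightarrow> stm" where
  "push e = Sto 2 (V 2) e ;; Asg 2 (Plus (V 2) (K 1))"

definition push2 :: "ex \<Rightarrow> ex \<Rightarrow> stm" where
  "push2 e f = push e ;; push f"

definition children_prog :: stm where
  "children_prog = Asg 6 (A 0 (Times (K 2) (Minus (V 5) (K 1)))) ;;
     Asg 7 (A 0 (Plus (Times (K 2) (Minus (V 5) (K 1))) (K 1)))"

definition fin_prog :: stm where
  "fin_prog = Asg 5 (Minus (V 5) (Plus (V 0) (V 0))) ;; children_prog ;;
     Sto 3 (V 5) (Plus (A 3 (V 6)) (A 3 (V 7))) ;; Sto 5 (V 5) (V 3) ;; regi_prog"

definition mdl_prog :: stm where
  "mdl_prog = Asg 5 (Minus (V 5) (V 0)) ;; children_prog ;; Sto 6 (V 5) (V 3) ;;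
     push2 (Plus (Plus (V 5) (V 0)) (V 0)) (V 7)"

definition rpt_prog :: stm where
  "rpt_prog = IfL (A 3 (V 5)) (V 1)
     (Cpy 2 (V 3) 2 (A 4 (V 5)) (A 3 (V 5)) ;; Asg 3 (Plus (V 3) (A 3 (V 5))))
     (Cpy 2 (V 3) 2 (A 4 (V 5)) (V 1) ;; Asg 3 (Plus (V 3) (V 1)) ;;
      Cpy 2 (V 3) 2 (Minus (A 5 (V 5)) (V 1)) (V 1) ;; Asg 3 (Plus (V 3) (V 1)))"

definition opn_prog :: stm where
  "opn_prog = push2 (Plus (V 5) (V 0)) (V 6)"

definition chr_prog :: stm where
  "chr_prog = NCp 2 (V 3) 0 (Minus (V 5) (K 1)) ;; Asg 3 (Plus (V 3) (K 1)) ;;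
     Sto 3 (V 5) (K 1) ;; Sto 5 (V 5) (V 3) ;; regi_prog"

text \<open>The input encodes a character rule by two zeros, so a positive left child identifies a
  pair.\<close>

definition new_prog :: stm where
  "new_prog = Sto 4 (V 5) (V 3) ;; Sto 6 (V 5) (V 3) ;; children_prog ;;
     IfL (K 0) (V 6) opn_prog chr_prog"

definition dfs_body :: stm where
  "dfs_body = Asg 2 (Minus (V 2) (K 1)) ;; Asg 5 (A 2 (V 2)) ;;
     IfL (V 0) (V 5) (IfL (Plus (V 0) (V 0)) (V 5) fin_prog mdl_prog)
       (IfL (K 0) (A 3 (V 5)) rpt_prog new_prog)"

definition dfs_prog :: stm where
  "dfs_prog = Sto 2 (K 0) (V 0) ;; Asg 2 (K 1) ;; Whl (K 0) (V 2) dfs_body"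

text \<open>The final state is fixed in advance, and \<open>Mx\<close> bounds its counters. The
  factor 100 leaves room for every sum and address that the programs form.\<close>

locale bounded_machine = slp_pattern +
  fixes B Mx :: nat and F :: dstate
  assumes F: "F = vis G m n dstate0"
    and big: "length (tx F) \<le> Mx" "clk F \<le> Mx" "nid F \<le> Mx" "n \<le> Mx" "m \<le> Mx"
      "length (val G n) \<le> Mx" "100 * Mx + 100 \<le> B" and good_F: "good F"
begin

section \<open>Correctness of the machine program for the traversal\<close>

definition input :: "(nat \<Rightarrow> nat) \<Rightarrow> (nat \<Rightarrow> int) \<Rightarrow> bool" where
  "input W Z \<longleftrightarrow> (\<forall>v\<in>{1..n}. case rhs_of G v of
     Char a \<Rightarrow> W (2 * (v - 1)) = 0 \<and> W (2 * (v - 1) + 1) = 0 \<and> Z (v - 1) = a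
   | Pair l r \<Rightarrow> W (2 * (v - 1)) = l \<and> W (2 * (v - 1) + 1) = r)"

definition drepr :: "state \<Rightarrow> dstate \<Rightarrow> bool" where
  "drepr \<sigma> s \<longleftrightarrow> reg \<sigma> 0 = n \<and> reg \<sigma> (Suc 0) = m \<and> reg \<sigma> 3 = length (tx s) \<and> reg \<sigma> 4 = nid s \<and>
     wmem \<sigma> 3 = vlen s \<and> wmem \<sigma> 4 = vst s \<and> wmem \<sigma> 5 = ven s \<and> wmem \<sigma> 6 = vmid s \<and> wmem \<sigma> 7 = vid s \<and>
     wmem \<sigma> 8 = tG s \<and> wmem \<sigma> 9 = tL s \<and> wmem \<sigma> 10 = tR s \<and> wmem \<sigma> 11 = tM s \<and> wmem \<sigma> 12 = tB s \<and>
     (\<forall>i<length (tx s). nmem \<sigma> 2 i = tx s ! i) \<and> input (wmem \<sigma> 0) (nmem \<sigma> 0)"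

text \<open>One word per item; the program recognises the kind by comparison with \<open>n\<close>
  and \<open>n + n\<close>.\<close>

fun code :: "item \<Rightarrow> nat" where
  "code (Vi v) = v" | "code (Mi v) = v + n" | "code (Fi v) = v + n + n"

fun wf_item :: "item \<Rightarrow> bool" where
  "wf_item (Vi v) \<longleftrightarrow> v \<in> {1..n}"
| "wf_item (Mi v) \<longleftrightarrow> v \<in> {1..n} \<and> (\<exists>l r. rhs_of G v = Pair l r)"
| "wf_item (Fi v) \<longleftrightarrow> v \<in> {1..n} \<and> (\<exists>l r. rhs_of G v = Pair l r)"

definition srepr :: "state \<Rightarrow> item list \<Rightarrow> bool" where
  "srepr \<sigma> xs \<longleftrightarrow> reg \<sigma> 2 = length xs \<and> map (wmem \<sigma> 2) [0..<length xs] = map code (rev xs)"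

lemma drepr_set_reg [simp]:
  "drepr (set_reg 2 x \<sigma>) s = drepr \<sigma> s" "drepr (set_reg 5 x \<sigma>) s = drepr \<sigma> s"
  "drepr (set_reg 6 x \<sigma>) s = drepr \<sigma> s" "drepr (set_reg 7 x \<sigma>) s = drepr \<sigma> s"
  "drepr (wset 2 i x \<sigma>) s = drepr \<sigma> s"
  by (simp_all add: drepr_def)

lemma drepr_simps:
  assumes "drepr \<sigma> s"
  shows "reg \<sigma> 0 = n" "reg \<sigma> (Suc 0) = m" "reg \<sigma> 3 = length (tx s)" "reg \<sigma> 4 = nid s"
    "wmem \<sigma> 3 = vlen s" "wmem \<sigma> 4 = vst s" "wmem \<sigma> 5 = ven s" "wmem \<sigma> 6 = vmid s" "wmem \<sigma> 7 = vid s"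
    "input (wmem \<sigma> 0) (nmem \<sigma> 0)"
  using assms by (simp_all add: drepr_def)

lemma srepr_simps [simp]:
  "r \<noteq> 2 \<Longrightarrow> srepr (set_reg r x \<sigma>) xs = srepr \<sigma> xs" "a \<noteq> 2 \<Longrightarrow> srepr (wset a i x \<sigma>) xs = srepr \<sigma> xs"
  "srepr (nset a f \<sigma>) xs = srepr \<sigma> xs"
  by (simp_all add: srepr_def)

lemma B1: "1 < B" using big m1 by linarith

lemma regi_prog_correct:
  assumes d: "drepr \<sigma> s" and r: "reg \<sigma> 5 = v" "reg \<sigma> 6 = l" "reg \<sigma> 7 = r"
    and le: "v \<le> Mx" "l \<le> Mx" "r \<le> Mx" "vlen s v \<le> Mx" "dle (regi m v l r s) F"
  shows "wp B regi_prog (\<lambda>t \<tau>. t \<le> 100 \<and> drepr \<tau> (regi m v l r s)) \<sigma>"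
proof (cases "vlen s v < m")
  case True
  then show ?thesis using assms big B1 by (simp add: regi_prog_def drepr_def regi_def)
next
  case False
  have "good (regi m v l r s)" using le(5) good_F by (simp add: dle_def)
  then have g: "tG s (vid s r) \<le> Suc (vlen s v) - m" "vmid s v \<le> length (tx s)"
     "vlen s l < m \<Longrightarrow> vlen s l \<le> vmid s v" "\<not> vlen s l < m \<Longrightarrow> m - Suc 0 \<le> vmid s v"
    using False by (simp_all add: regi_def split: if_splits)
  have bd: "length (tx s) \<le> Mx" "nid s + 1 \<le> Mx"
    using le(5) big False by (simp_all add: dle_def regi_def)
  have B: "n < B" "m < B" "Suc (nid s) < B" "nid s < B" "v < B" "l < B" "r < B" "Suc (vlen s v) < B" "Suc 0 < B"
    "vmid s v < B" "Suc (vlen s v) - m < B" "m - Suc 0 < B"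
    using bd big le g by linarith+
  show ?thesis using False g B r d m1
    by (simp add: regi_prog_def drepr_def regi_def)
qed

lemma push_correct:
  assumes "srepr \<sigma> xs" "ok B e \<sigma>" "ev e \<sigma> = code x" "length xs + 1 < B"
    and "\<And>\<tau> t. t \<le> tm e + 10 \<Longrightarrow> srepr \<tau> (x # xs) \<Longrightarrow> \<tau> = set_reg 2 (length xs + 1) (wset 2 (length xs) (code x) \<sigma>) \<Longrightarrow> Q t \<tau>"
  shows "wp B (push e) Q \<sigma>"
proof -
  have "srepr (set_reg 2 (length xs + 1) (wset 2 (length xs) (code x) \<sigma>)) (x # xs)"
    using assms(1) by (simp add: srepr_def)
  from assms(5)[OF _ this refl] show ?thesis using assms(1-4) B1 by (simp add: push_def srepr_def)
qed

lemma children_Pair: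
  assumes "input (wmem \<sigma> 0) (nmem \<sigma> 0)" "reg \<sigma> 5 = v" "v \<in> {1..n}" "rhs_of G v = Pair l r"
    "\<And>t. t \<le> 20 \<Longrightarrow> Q t (set_reg 7 r (set_reg 6 l \<sigma>))"
  shows "wp B children_prog Q \<sigma>"
proof -
  have "wmem \<sigma> 0 (2 * (v - 1)) = l" "wmem \<sigma> 0 (2 * (v - 1) + 1) = r"
    using assms(1)[unfolded input_def, THEN bspec, OF assms(3)] assms(4) by simp_all
  moreover have "2 * (v - 1) + 1 < B" "v < B" "2 < B" using assms(3) big m1 by auto
  ultimately show ?thesis using assms(2,3,5) by (simp add: children_prog_def)
qed

lemma children_Char:
  assumes "input (wmem \<sigma> 0) (nmem \<sigma> 0)" "reg \<sigma> 5 = v" "v \<in> {1..n}" "rhs_of G v = Char a"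
    "\<And>t. t \<le> 20 \<Longrightarrow> nmem \<sigma> 0 (v - 1) = a \<Longrightarrow> Q t (set_reg 7 0 (set_reg 6 0 \<sigma>))"
  shows "wp B children_prog Q \<sigma>"
proof -
  have "wmem \<sigma> 0 (2 * (v - 1)) = 0" "wmem \<sigma> 0 (2 * (v - 1) + 1) = 0" "nmem \<sigma> 0 (v - 1) = a"
    using assms(1)[unfolded input_def, THEN bspec, OF assms(3)] assms(4) by simp_all
  moreover have "2 * (v - 1) + 1 < B" "v < B" "2 < B" using assms(3) big m1 by auto
  ultimately show ?thesis using assms(2,3,5) by (simp add: children_prog_def)
qed

lemma fin_prog_correct:
  assumes d: "drepr \<sigma> s" and r: "reg \<sigma> 5 = v + n + n" "v \<in> {1..n}" "rhs_of G v = Pair l r"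
    and le: "dle (fin G m v l r s) F"
  shows "wp B fin_prog (\<lambda>t \<tau>. t \<le> 200 \<and> drepr \<tau> (fin G m v l r s)) \<sigma>"
proof -
  let ?s = "s\<lparr>vlen := (vlen s)(v := vlen s l + vlen s r), ven := (ven s)(v := length (tx s)), clk := clk s + 1,
        good := (good s \<and> vlen s l + vlen s r \<le> length (val G (length G)))\<rparr>"
  let ?\<tau> = "wset 5 v (length (tx s)) (wset 3 v (vlen s l + vlen s r) (set_reg 7 r (set_reg 6 l (set_reg 5 v \<sigma>))))"
  have g: "good (fin G m v l r s)" using le good_F by (simp add: dle_def)
  have "good ?s" using g dle_regi[of ?s m v l r] unfolding fin_def dle_def by blast
  then have N: "vlen s l + vlen s r \<le> Mx" using big(6) n_def by simp
  have lr: "l \<le> Mx" "r \<le> Mx" using Pair_range[OF r(3,2)] r(2) big by auto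
  have v: "v \<le> Mx" using r big by auto
  have "wp B regi_prog (\<lambda>t \<tau>. t \<le> 100 \<and> drepr \<tau> (fin G m v l r s)) ?\<tau>"
    unfolding fin_def
    by (rule regi_prog_correct) (use d r N lr v le in \<open>auto simp: drepr_def fin_def\<close>)
  note reg = this
  have B: "v + n + n < B" "n < B" "n + n < B" "l < B" "r < B" "v < B" "length (tx s) < B"
    "vlen s l + vlen s r < B"
    using r(2) big lr v N le by (auto simp: dle_def fin_def)
  show ?thesis unfolding fin_prog_def
    by (simp add: r(1) drepr_simps[OF d] B, rule children_Pair[OF _ _ r(2,3)])
      (simp_all add: d drepr_simps[OF d] B wp_mono[OF reg])
qed

lemma mdl_prog_correct:
  assumes d: "drepr \<sigma> s" and st: "srepr \<sigma> xs" "length xs + 2 < B"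
    and r: "reg \<sigma> 5 = v + n" "v \<in> {1..n}" "rhs_of G v = Pair l r"
    and le: "dle (mdl v s) F"
  shows "wp B mdl_prog (\<lambda>t \<tau>. t \<le> 200 \<and> drepr \<tau> (mdl v s) \<and> srepr \<tau> (Vi r # Fi v # xs)) \<sigma>"
proof -
  let ?\<tau> = "wset 6 v (length (tx s)) (set_reg 7 r (set_reg 6 l (set_reg 5 v \<sigma>)))"
  have lr: "l \<le> Mx" "r \<le> Mx" using Pair_range[OF r(3,2)] r(2) big by auto
  have v: "v \<le> Mx" using r big by auto
  have B: "v + n + n < B" "v + n < B" "n < B" "n + n < B" "l < B" "r < B" "v < B" "length (tx s) < B"
    using r(2) big lr v le by (auto simp: dle_def)
  have dr: "drepr ?\<tau> (mdl v s)" using d by (simp add: drepr_def mdl_def)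
  have sr: "srepr ?\<tau> xs" using st by simp
  have "wp B (push2 (Plus (Plus (V 5) (V 0)) (V 0)) (V 7))
      (\<lambda>t \<tau>. t \<le> 100 \<and> drepr \<tau> (mdl v s) \<and> srepr \<tau> (Vi r # Fi v # xs)) ?\<tau>"
    unfolding push2_def wp.simps(7)
    by (rule push_correct[OF sr, where x = "Fi v"], (use st B drepr_simps[OF d] in simp_all)[3],
        rule push_correct[where x = "Vi r"], assumption, insert st(2) B drepr_simps[OF d] dr, simp_all)
  note rest = this
  show ?thesis unfolding mdl_prog_def
    by (simp add: r(1) drepr_simps[OF d] B, rule children_Pair[OF _ _ r(2,3)])
      (simp_all add: drepr_simps[OF d] B wp_mono[OF rest])
qed

lemma opn_prog_correct:
  assumes d: "drepr \<sigma> s" and st: "srepr \<sigma> xs" "length xs + 2 < B"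
    and r: "reg \<sigma> 5 = v" "reg \<sigma> 6 = l" and le: "v + n < B" "l < B"
  shows "wp B opn_prog (\<lambda>t \<tau>. t \<le> 100 \<and> drepr \<tau> s \<and> srepr \<tau> (Vi l # Mi v # xs)) \<sigma>"
  unfolding opn_prog_def push2_def wp.simps(7)
  by (rule push_correct[OF st(1), where x = "Mi v"], (use st le drepr_simps[OF d] r in simp_all)[3],
      rule push_correct[where x = "Vi l"], assumption, insert st(2) le drepr_simps[OF d] d r, simp_all)

lemma chr_prog_correct:
  assumes d: "drepr \<sigma> s" and r: "reg \<sigma> 5 = v" "reg \<sigma> 6 = 0" "reg \<sigma> 7 = 0" "v \<in> {1..n}"
    "nmem \<sigma> 0 (v - 1) = a" and v: "vst s v = length (tx s)" "vmid s v = length (tx s)"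
    and le: "dle (chr m v a (s\<lparr>clk := c\<rparr>)) F"
  shows "wp B chr_prog (\<lambda>t \<tau>. t \<le> 200 \<and> drepr \<tau> (chr m v a (s\<lparr>clk := c\<rparr>))) \<sigma>"
proof -
  let ?s = "s\<lparr>tx := tx s @ [a], vlen := (vlen s)(v := 1), vst := (vst s)(v := length (tx s)),
        vmid := (vmid s)(v := length (tx s)), ven := (ven s)(v := length (tx s) + 1), clk := c + 1\<rparr>"
  have ch: "chr m v a (s\<lparr>clk := c\<rparr>) = regi m v 0 0 ?s" by (simp add: chr_def)
  let ?\<tau> = "wset 5 v (length (tx s) + 1) (wset 3 v 1 (set_reg 3 (length (tx s) + 1)
     (nset 2 ((nmem \<sigma> 2)(length (tx s) := a)) \<sigma>)))"
  have upd: "(vst s)(v := length (tx s)) = vst s" "(vmid s)(v := length (tx s)) = vmid s" using v by auto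
  have dr: "drepr ?\<tau> ?s" using d unfolding drepr_def by (simp add: upd nth_append less_Suc_eq)
  have "wp B regi_prog (\<lambda>t \<tau>. t \<le> 100 \<and> drepr \<tau> (chr m v a (s\<lparr>clk := c\<rparr>))) ?\<tau>"
    unfolding ch by (rule regi_prog_correct[OF dr]) (use r big le m1 in \<open>auto simp: ch\<close>)
  note reg = this
  have B: "v < B" "length (tx s) + 1 < B" "1 < B" using r(4) big le B1 by (auto simp: dle_def ch)
  show ?thesis unfolding chr_prog_def
    using B r by (simp add: drepr_simps[OF d] wp_mono[OF reg[simplified]])
qed

lemma rpt_prog_correct:
  assumes d: "drepr \<sigma> s" and r: "reg \<sigma> 5 = v" "v \<in> {1..n}" "vlen s v \<noteq> 0"
    and le: "dle (rpt m v s) F"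
  shows "wp B rpt_prog (\<lambda>t \<tau>. t \<le> 200 + length (tx (rpt m v s)) - length (tx s) \<and> drepr \<tau> (rpt m v s)) \<sigma>"
proof -
  let ?s = "rpt m v s"
  have g: "good ?s" using le good_F by (simp add: dle_def)
  have len: "length (tx ?s) \<le> Mx" using le big by (simp add: dle_def)
  have vB: "v < B" "m < B" using r(2) big by auto
  show ?thesis
  proof (cases "vlen s v < m")
    case True
    have b: "vst s v + vlen s v \<le> length (tx s)" using g True by (simp add: rpt_def)
    then have l: "length (tx ?s) = length (tx s) + vlen s v" using True by (simp add: rpt_def)
    have t: "tx ?s ! i = tx s ! (vst s v + (i - length (tx s)))" if "length (tx s) \<le> i" "i < length (tx s) + vlen s v" for i
      using that True b by (simp add: rpt_def nth_append)
    have t': "tx ?s ! i = tx s ! i" if "i < length (tx s)" for i using that by (simp add: rpt_def nth_append)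
    have B: "length (tx s) + vlen s v < B" "vst s v + vlen s v < B" "length (tx s) < B" using b l len big by auto
    have other: "vlen ?s = vlen s" "vst ?s = vst s" "ven ?s = ven s" "vmid ?s = vmid s" "vid ?s = vid s"
      "nid ?s = nid s" "tL ?s = tL s" "tR ?s = tR s" "tG ?s = tG s" "tM ?s = tM s" "tB ?s = tB s"
      by (simp_all add: rpt_def)
    show ?thesis using d r True B vB B1 m1 unfolding rpt_prog_def drepr_def other
      by (simp add: l t t') (use b t t' in auto)
  next
    case False
    have b: "vst s v + m \<le> length (tx s)" "ven s v \<le> length (tx s)" "m \<le> ven s v"
      using g False by (simp_all add: rpt_def)
    then have l: "length (tx ?s) = length (tx s) + m + m" using False by (simp add: rpt_def)
    have t: "tx ?s ! i = (if i < length (tx s) then tx s ! i else if i < length (tx s) + m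
        then tx s ! (vst s v + (i - length (tx s))) else tx s ! (ven s v - m + (i - (length (tx s) + m))))"
      if "i < length (tx s) + m + m" for i
      using that False b by (cases "i < length (tx s) + m") (auto simp: rpt_def nth_append)
    have B: "length (tx s) + m + m < B" "length (tx s) + m < B" "vst s v + m < B" "length (tx s) < B" "ven s v < B"
      "ven s v - m + m < B"
      using b l len big by auto
    have other: "vlen ?s = vlen s" "vst ?s = vst s" "ven ?s = ven s" "vmid ?s = vmid s" "vid ?s = vid s"
      "nid ?s = nid s" "tL ?s = tL s" "tR ?s = tR s" "tG ?s = tG s" "tM ?s = tM s" "tB ?s = tB s"
      by (simp_all add: rpt_def)
    show ?thesis using d r False B vB B1 m1 b unfolding rpt_prog_def drepr_def other
      by (simp add: l t) (use b in auto)
  qed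
qed

lemma frame_srepr: "frame s \<sigma> \<tau> \<Longrightarrow> srepr \<sigma> xs \<Longrightarrow> 2 \<notin> wregs s \<Longrightarrow> 2 \<notin> warrs s \<Longrightarrow> srepr \<tau> xs"
  by (simp add: frame_def srepr_def)

lemma run_stack_dle: "run_stack G m xs s = F \<Longrightarrow> dle s F"
  using dle_run_stack by blast

text \<open>That the remaining stack still leads to \<open>F\<close> replaces any description of how
  far the recursion has come. The stack grows by at most one item per step, which bounds its height
  for the overflow conditions.\<close>

definition dfs_inv :: "dstate \<Rightarrow> item list \<Rightarrow> state \<Rightarrow> bool" where
  "dfs_inv s xs \<sigma> \<longleftrightarrow> drepr \<sigma> s \<and> srepr \<sigma> xs \<and> (\<forall>x\<in>set xs. wf_item x) \<and> run_stack G m xs s = F \<and>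
     length xs \<le> clk s + 1"

text \<open>Copying takes time linear in the emitted characters, so a step is granted a constant
  plus the growth of the text.\<close>

definition dfs_step :: "dstate \<Rightarrow> nat \<Rightarrow> state \<Rightarrow> bool" where
  "dfs_step s t \<tau> \<longleftrightarrow> (\<exists>s' xs'. dfs_inv s' xs' \<tau> \<and> clk s' = clk s + 1 \<and> length (tx s) \<le> length (tx s') \<and>
     t + length (tx s) \<le> 300 + length (tx s'))"

lemma dfs_stepI:
  assumes "drepr \<tau> s'" "srepr \<tau> xs'" "\<forall>x\<in>set xs'. wf_item x" "run_stack G m xs' s' = F"
    "length xs' \<le> clk s' + 1" "clk s' = clk s + 1" "length (tx s) \<le> length (tx s')"
    "t + length (tx s) \<le> 300 + length (tx s')"
  shows "dfs_step s t \<tau>"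
  using assms unfolding dfs_step_def dfs_inv_def by blast

text \<open>The slack \<open>k\<close> absorbs the time of the instructions that the loop body
  executes before this program.\<close>

lemma new_prog_correct:
  assumes d: "drepr \<sigma> s" and st: "srepr \<sigma> xs" and wf: "\<forall>x\<in>set xs. wf_item x"
    and r: "reg \<sigma> 5 = v" "v \<in> {1..n}" "vlen s v = 0"
    and run: "run_stack G m (Vi v # xs) s = F" and len: "length xs \<le> clk s"
  shows "wp B new_prog (\<lambda>t \<tau>. \<forall>k\<le>20. dfs_step s (k + t) \<tau>) \<sigma>"
proof -
  let ?\<tau> = "wset 6 v (length (tx s)) (wset 4 v (length (tx s)) \<sigma>)"
  have dle: "dle s F" using run_stack_dle[OF run] .
  have B: "v < B" "length (tx s) < B" "v + n < B" "length xs + 2 < B" "n < B" "0 < B"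
    using r(2) big dle len by (auto simp: dle_def)
  have dr: "drepr ?\<tau> (opn v s)" using d by (simp add: drepr_def opn_def)
  have sr: "srepr ?\<tau> xs" using st by simp
  show ?thesis
  proof (cases "rhs_of G v")
    case (Pair l r)
    note rng = Pair_range[OF Pair r(2)]
    have l: "0 < l" "l < v" "r < v" "l < B" "r < B" "l \<in> {1..n}" using rng r(2) B by auto
    have "vis G m v s = fin G m v l r (vis G m r (mdl v (vis G m l (opn v s))))"
      using r(3) Pair l by (subst vis.simps) simp
    then have run': "run_stack G m (Vi l # Mi v # xs) (opn v s) = F" using run Pair by simp
    have "wp B opn_prog (\<lambda>t \<tau>. t \<le> 100 \<and> drepr \<tau> (opn v s) \<and> srepr \<tau> (Vi l # Mi v # xs)) (set_reg 7 r (set_reg 6 l ?\<tau>))"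
      by (rule opn_prog_correct[where s = "opn v s" and v = v and l = l]) (use dr sr B r l in simp_all)
    note opn = this
    have step: "dfs_step s k \<tau>" if "k \<le> 300" "drepr \<tau> (opn v s)" "srepr \<tau> (Vi l # Mi v # xs)" for k \<tau>
      by (rule dfs_stepI[OF that(2,3) _ run']) (use wf len that(1) l(6) r(2) Pair in simp_all)
    show ?thesis unfolding new_prog_def
      by (simp add: r(1) drepr_simps[OF d] B, rule children_Pair[OF _ _ r(2) Pair])
        (simp_all add: drepr_simps[OF d] r B B1[THEN less_imp_le] l wp_mono[OF opn] step)
  next
    case (Char a)
    have vis: "vis G m v s = chr m v a s" using r(3) Char by (subst vis.simps) simp
    have ch: "chr m v a ((opn v s)\<lparr>clk := clk s\<rparr>) = chr m v a s" by (simp add: chr_def opn_def)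
    have run': "run_stack G m xs (chr m v a s) = F" using run vis by simp
    have "wp B chr_prog (\<lambda>t \<tau>. t \<le> 200 \<and> drepr \<tau> (chr m v a s)) (set_reg 7 0 (set_reg 6 0 ?\<tau>))"
      if "nmem \<sigma> 0 (v - 1) = a"
      unfolding ch[symmetric]
      by (rule chr_prog_correct[where s = "opn v s" and v = v and a = a])
        (use dr r that run_stack_dle[OF run'] in \<open>simp_all add: ch\<close>)
    note chr = this
    have step: "dfs_step s k \<tau>" if "k \<le> 300" "drepr \<tau> (chr m v a s)" "srepr \<tau> xs" for k \<tau>
      by (rule dfs_stepI[OF that(2,3) wf run']) (use len that(1) in \<open>simp_all add: chr_def\<close>)
    have rest: "wp B chr_prog (\<lambda>t \<tau>. t \<le> 200 \<and> drepr \<tau> (chr m v a s) \<and> srepr \<tau> xs) (set_reg 7 0 (set_reg 6 0 ?\<tau>))"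
      if "nmem \<sigma> 0 (v - 1) = a"
    proof (rule wp_mono[OF wp_frame[OF chr[OF that]]], goal_cases)
      case (1 t \<tau>)
      have "srepr \<tau> xs"
        by (rule frame_srepr[OF conjunct2[OF 1]]) (use sr in \<open>simp_all add: chr_prog_def regi_prog_def\<close>)
      then show ?case using 1 by simp
    qed
    show ?thesis unfolding new_prog_def
      by (simp add: r(1) drepr_simps[OF d] B, rule children_Char[OF _ _ r(2) Char])
        (simp_all add: drepr_simps[OF d] r B wp_mono[OF rest] step)
  qed
qed

lemma dfs_body_correct:
  assumes "dfs_inv s (x # xs) \<sigma>"
  shows "wp B dfs_body (dfs_step s) \<sigma>"
proof -
  have d: "drepr \<sigma> s" and st: "srepr \<sigma> (x # xs)" and wf: "wf_item x" "\<forall>x\<in>set xs. wf_item x"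
    and run: "run_stack G m (x # xs) s = F" and len: "length xs \<le> clk s"
    using assms by (auto simp: dfs_inv_def)
  let ?\<tau> = "set_reg 5 (code x) (set_reg 2 (length xs) \<sigma>)"
  have top: "reg \<sigma> 2 = length xs + 1" "wmem \<sigma> 2 (length xs) = code x" using st by (simp_all add: srepr_def)
  have d': "drepr ?\<tau> s" using d by simp
  have st': "srepr ?\<tau> xs" using st by (simp add: srepr_def)
  have r5: "reg ?\<tau> 5 = code x" by simp
  have dle: "dle s F" by (rule run_stack_dle[OF run])
  then have B: "length xs + 2 < B" "Suc (length xs) < B" "0 < B" "Suc 0 < B" "n < B" "n + n < B"
    using len big m1 by (auto simp: dle_def)
  have cB: "code x < B" using wf(1) big by (cases x) auto
  show ?thesis
  proof (cases x)
    case (Vi v)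
    have v: "v \<in> {1..n}" using wf Vi by simp
    then have vn: "\<not> n < v" "v < B" using B by auto
    have run': "run_stack G m (Vi v # xs) s = F" using run Vi by simp
    show ?thesis
    proof (cases "vlen s v = 0")
      case True
      have new: "wp B new_prog (\<lambda>t \<tau>. \<forall>k\<le>20. dfs_step s (k + t) \<tau>) ?\<tau>"
        by (rule new_prog_correct[OF d' st' wf(2) _ v True run' len]) (simp add: Vi)
      then show ?thesis unfolding dfs_body_def
        using True B vn v top
        by (simp add: Vi drepr_simps[OF d], intro wp_mono[OF new[unfolded Vi code.simps]], drule_tac x = 12 in spec, simp add: numeral_eq_Suc)
    next
      case False
      have "vis G m v s = rpt m v s" using False by (subst vis.simps) simp
      then have run'': "run_stack G m xs (rpt m v s) = F" using run' by simp
      have le: "length (tx s) \<le> length (tx (rpt m v s))" by (simp add: rpt_def)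
      have "wp B rpt_prog (\<lambda>t \<tau>. t \<le> 200 + length (tx (rpt m v s)) - length (tx s) \<and> drepr \<tau> (rpt m v s)) ?\<tau>"
        by (rule rpt_prog_correct[OF d' _ v False run_stack_dle[OF run'']]) (simp add: Vi)
      note rpt = this
      have rep: "wp B rpt_prog (\<lambda>t \<tau>. t \<le> 200 + length (tx (rpt m v s)) - length (tx s) \<and> drepr \<tau> (rpt m v s) \<and> srepr \<tau> xs) ?\<tau>"
      proof (rule wp_mono[OF wp_frame[OF rpt]], goal_cases)
        case (1 t \<tau>)
        have "srepr \<tau> xs"
          by (rule frame_srepr[OF conjunct2[OF 1]]) (use st' in \<open>simp_all add: rpt_prog_def\<close>)
        then show ?case using 1 by simp
      qed
      have step: "dfs_step s k \<tau>" if "k + length (tx s) \<le> 300 + length (tx (rpt m v s))" "drepr \<tau> (rpt m v s)" "srepr \<tau> xs" for k \<tau>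
        by (rule dfs_stepI[OF that(2,3) wf(2) run'']) (use len that(1) in \<open>simp_all add: rpt_def\<close>)
      show ?thesis unfolding dfs_body_def
        using False B vn v top le
        by (simp add: Vi drepr_simps[OF d], intro wp_mono[OF rep[unfolded Vi code.simps]], elim conjE)
          (rule step, simp_all)
    qed
  next
    case (Mi v)
    obtain l r where v: "v \<in> {1..n}" and lr: "rhs_of G v = Pair l r" using wf Mi by auto
    have r: "reg ?\<tau> 5 = v + n" by (simp add: Mi)
    have vB: "\<not> n + n < v + n" "n < v + n" "v + n < B" using v cB Mi by auto
    have rn: "r \<in> {1..n}" using Pair_range[OF lr v] v by auto
    have run': "run_stack G m (Vi r # Fi v # xs) (mdl v s) = F" using run lr by (simp add: Mi)
    have mdl: "wp B mdl_prog (\<lambda>t \<tau>. t \<le> 200 \<and> drepr \<tau> (mdl v s) \<and> srepr \<tau> (Vi r # Fi v # xs)) ?\<tau>"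
      by (rule mdl_prog_correct[OF d' st' B(1) r v lr run_stack_dle[OF run']])
    have step: "dfs_step s k \<tau>" if "k \<le> 300" "drepr \<tau> (mdl v s)" "srepr \<tau> (Vi r # Fi v # xs)" for k \<tau>
      by (rule dfs_stepI[OF that(2,3) _ run']) (use wf len that(1) rn v lr in simp_all)
    show ?thesis unfolding dfs_body_def
      using B vB v top by (simp add: Mi drepr_simps[OF d] wp_mono[OF mdl[unfolded Mi code.simps]] step)
  next
    case (Fi v)
    obtain l r where v: "v \<in> {1..n}" and lr: "rhs_of G v = Pair l r" using wf Fi by auto
    have r: "reg ?\<tau> 5 = v + n + n" by (simp add: Fi)
    have vB: "n + n < v + n + n" "n < v + n + n" "v + n + n < B" using v cB Fi by auto
    have run': "run_stack G m xs (fin G m v l r s) = F" using run lr by (simp add: Fi)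
    have "wp B fin_prog (\<lambda>t \<tau>. t \<le> 200 \<and> drepr \<tau> (fin G m v l r s)) ?\<tau>"
      by (rule fin_prog_correct[OF d' r v lr run_stack_dle[OF run']])
    note fin = this
    have fin': "wp B fin_prog (\<lambda>t \<tau>. t \<le> 200 \<and> drepr \<tau> (fin G m v l r s) \<and> srepr \<tau> xs) ?\<tau>"
    proof (rule wp_mono[OF wp_frame[OF fin]], goal_cases)
      case (1 t \<tau>)
      have "srepr \<tau> xs"
        by (rule frame_srepr[OF conjunct2[OF 1]])
          (use st' in \<open>simp_all add: fin_prog_def children_prog_def regi_prog_def\<close>)
      then show ?case using 1 by simp
    qed
    have step: "dfs_step s k \<tau>" if "k \<le> 300" "drepr \<tau> (fin G m v l r s)" "srepr \<tau> xs" for k \<tau>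
      by (rule dfs_stepI[OF that(2,3) wf(2) run']) (use len that(1) in \<open>simp_all add: fin_def\<close>)
    show ?thesis unfolding dfs_body_def
      using B vB v top by (simp add: Fi drepr_simps[OF d] wp_mono[OF fin'[unfolded Fi code.simps]] step)
  qed
qed

lemma dfs_prog_correct:
  assumes d: "drepr \<sigma> dstate0"
  shows "wp B dfs_prog (\<lambda>t \<tau>. t \<le> 310 * clk F + length (tx F) + 20 \<and> drepr \<tau> F) \<sigma>"
proof -
  let ?\<tau> = "set_reg 2 1 (wset 2 0 n \<sigma>)"
  have B: "n < B" "0 < B" "Suc 0 < B" using big m1 by auto
  have i0: "dfs_inv dstate0 [Vi n] ?\<tau>"
    unfolding dfs_inv_def using d n1 F[symmetric] by (simp add: srepr_def)
  have "wp B (Whl (K 0) (V 2) dfs_body) (\<lambda>t \<tau>. t \<le> 310 * clk F + length (tx F) + 10 \<and> drepr \<tau> F) ?\<tau>"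
  proof (rule wp_Whl_ghost[where I = "\<lambda>(s, xs) \<tau>. dfs_inv s xs \<tau>" and ?g0.0 = "(dstate0, [Vi n])"
      and \<Phi> = "\<lambda>(s, xs). 310 * (clk F - clk s) + (length (tx F) - length (tx s))"], goal_cases)
    case 1 then show ?case using i0 by simp
  next
    case (2 g \<tau>)
    obtain s xs where g: "g = (s, xs)" by fastforce
    then have inv: "dfs_inv s xs \<tau>" using 2 by simp
    then have "dle s F" "length xs \<le> clk s + 1" "reg \<tau> 2 = length xs" using run_stack_dle by (auto simp: dfs_inv_def srepr_def)
    then show ?case using big B by (simp add: dle_def)
  next
    case (3 g \<tau>)
    obtain s xs where g: "g = (s, xs)" by fastforce
    then have inv: "dfs_inv s xs \<tau>" using 3 by simp
    moreover have "xs \<noteq> []" using inv 3 by (auto simp: dfs_inv_def srepr_def)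
    ultimately obtain x ys where xs: "xs = x # ys" and inv': "dfs_inv s (x # ys) \<tau>" by (cases xs) auto
    show ?case
    proof (rule wp_mono[OF dfs_body_correct[OF inv']], goal_cases)
      case (1 t \<tau>')
      then obtain s' xs' where s': "dfs_inv s' xs' \<tau>'" "clk s' = clk s + 1" "length (tx s) \<le> length (tx s')"
        "t + length (tx s) \<le> 300 + length (tx s')" by (auto simp: dfs_step_def)
      have "dle s' F" using s'(1) run_stack_dle by (auto simp: dfs_inv_def)
      then have "clk s' \<le> clk F" "length (tx s') \<le> length (tx F)" by (simp_all add: dle_def)
      then have "310 * (clk F - clk s) = 310 * (clk F - clk s') + 310"
        using s'(2) by (simp add: Suc_diff_Suc)
      then show ?case
        using s' g \<open>length (tx s') \<le> length (tx F)\<close> by (intro exI[of _ "(s', xs')"]) simp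
    qed
  next
    case (4 g \<tau> t)
    obtain s xs where g: "g = (s, xs)" by fastforce
    then have inv: "dfs_inv s xs \<tau>" using 4 by simp
    moreover have "xs = []" using inv 4 by (auto simp: dfs_inv_def srepr_def)
    ultimately have "s = F" "drepr \<tau> s" by (auto simp: dfs_inv_def)
    then show ?case using 4 g by (simp add: dstate0_def)
  qed
  note loop = this
  show ?thesis unfolding dfs_prog_def
    using B by (simp add: drepr_simps[OF d] wp_mono[OF loop[unfolded One_nat_def]] del: wp.simps(9))
qed

end

section \<open>Counting occurrences\<close>

text \<open>The equation for loops quantifies over the invariant, which only rules can supply.\<close>

declare wp.simps(9) [simp del]

context grammar_shape
begin

definition add_at :: "(nat \<Rightarrow> nat) \<Rightarrow> nat \<Rightarrow> nat \<Rightarrow> nat \<Rightarrow> nat" where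
  "add_at oc c k = (if c = 0 then oc else oc(c := oc c + k))"

text \<open>Nodes are processed from \<open>q\<close> downwards and pass their count on to their
  children, so counts above \<open>v\<close> are final. The weighted sum cannot grow, because the
  children of a node together have at most its number of windows. As all weights are positive, it
  bounds each count by \<open>g q\<close>, both against overflow and for the potential of
  queries.\<close>

definition occ_inv :: "nat \<Rightarrow> (nat \<Rightarrow> nat) \<Rightarrow> bool" where
  "occ_inv v oc \<longleftrightarrow> oc 0 = 0 \<and> oc q = 1 \<and> (\<Sum>i=1..v. oc i * g i) \<le> g q \<and>
     (\<forall>c\<in>{1..q}. (\<Sum>i | i \<in> {v<..q} \<and> (L i = c \<or> R i = c). oc i) \<le> oc c) \<and> (\<forall>i\<in>{v<..q}. oc i \<le> g q)"

lemma occ_init: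
  assumes "1 \<le> q" shows "occ_inv q ((\<lambda>_. 0)(q := 1))"
proof -
  have "(\<Sum>i=1..q. ((\<lambda>_. 0)(q := 1)) i * g i) = (\<Sum>i=1..q. if i = q then g i else 0)"
    by (intro sum.cong) auto
  also have "\<dots> = g q" using assms by (subst sum.delta) auto
  finally show ?thesis using assms by (auto simp: occ_inv_def)
qed

lemma occ_le:
  assumes "occ_inv v oc" "i \<in> {1..v}" "v \<le> q" shows "oc i \<le> g q"
proof -
  have "oc i * 1 \<le> oc i * g i" using g_pos[of i] assms by (intro mult_le_mono) auto
  also have "\<dots> \<le> (\<Sum>i=1..v. oc i * g i)" using assms by (intro member_le_sum) auto
  finally show ?thesis using assms(1) by (simp add: occ_inv_def)
qed

lemma sum_add_at:
  assumes "c \<le> k"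
  shows "(\<Sum>i=1..k. add_at oc c x i * g i) = (\<Sum>i=1..k. oc i * g i) + x * g c"
proof (cases "c = 0")
  case False
  then have c: "c \<in> {1..k}" using assms by simp
  have "(\<Sum>i=1..k. add_at oc c x i * g i) = (\<Sum>i=1..k. oc i * g i + (if i = c then x * g i else 0))"
    using False by (intro sum.cong) (auto simp: add_at_def algebra_simps)
  also have "\<dots> = (\<Sum>i=1..k. oc i * g i) + (\<Sum>i=1..k. if i = c then x * g i else 0)" by (simp add: sum.distrib)
  also have "(\<Sum>i=1..k. if i = c then x * g i else 0) = x * g c" using c by (subst sum.delta) auto
  finally show ?thesis .
qed (simp add: add_at_def g_0)

lemma occ_step:
  assumes inv: "occ_inv v oc" and v: "v \<in> {1..q}"
  shows "occ_inv (v - 1) (add_at (add_at oc (L v) (oc v)) (R v) (oc v))"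
proof -
  let ?x = "oc v" and ?o = "add_at (add_at oc (L v) (oc v)) (R v) (oc v)"
  have lr: "L v \<le> v - 1" "R v \<le> v - 1" using L_less[OF v] R_less[OF v] by auto
  have same: "?o i = oc i" if "v \<le> i" for i using that lr v by (auto simp: add_at_def)
  have "(\<Sum>i=1..v-1. ?o i * g i) = (\<Sum>i=1..v-1. oc i * g i) + ?x * g (L v) + ?x * g (R v)"
    by (simp only: sum_add_at[OF lr(1)] sum_add_at[OF lr(2)])
  also have "\<dots> = (\<Sum>i=1..v-1. oc i * g i) + ?x * (g (L v) + g (R v))" by (simp add: algebra_simps)
  also have "\<dots> \<le> (\<Sum>i=1..v-1. oc i * g i) + ?x * g v"
    using gL[OF v] gR[OF v] by (intro add_left_mono mult_left_mono) auto
  also have "\<dots> = (\<Sum>i=1..v. oc i * g i)" using v by (cases v) auto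
  finally have 1: "(\<Sum>i=1..v-1. ?o i * g i) \<le> g q" using inv by (simp add: occ_inv_def)
  have 2: "(\<Sum>i | i \<in> {v - 1<..q} \<and> (L i = c \<or> R i = c). ?o i) \<le> ?o c" if c: "c \<in> {1..q}" for c
  proof -
    let ?S = "{i. i \<in> {v<..q} \<and> (L i = c \<or> R i = c)}"
    have old: "sum oc ?S \<le> oc c" using inv c by (simp add: occ_inv_def)
    have eq: "sum ?o ?S = sum oc ?S" using same by (intro sum.cong) auto
    show ?thesis
    proof (cases "L v = c \<or> R v = c")
      case True
      have set: "{i. i \<in> {v - 1<..q} \<and> (L i = c \<or> R i = c)} = insert v ?S" using v True by auto
      have "sum ?o (insert v ?S) = ?o v + sum ?o ?S" by (rule sum.insert) auto
      also have "\<dots> = ?x + sum oc ?S" unfolding eq using same[of v] by simp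
      finally have "sum ?o (insert v ?S) = ?x + sum oc ?S" .
      moreover have "oc c + ?x \<le> ?o c" using True c by (auto simp: add_at_def)
      ultimately show ?thesis unfolding set using old by simp
    next
      case False
      have "i = v \<or> v < i" if "v - 1 < i" for i using that v by auto
      then have set: "{i. i \<in> {v - 1<..q} \<and> (L i = c \<or> R i = c)} = ?S" using v False by auto
      have "?o c = oc c" using False by (auto simp: add_at_def)
      then show ?thesis unfolding set using old eq by simp
    qed
  qed
  have 3: "?o i \<le> g q" if "i \<in> {v - 1<..q}" for i
  proof (cases "i = v")
    case True
    then show ?thesis using same[of v] occ_le[OF inv, of v] v by simp
  next
    case False
    then have "v < i" "i \<le> q" using that by auto
    then show ?thesis using same[of i] inv by (simp add: occ_inv_def)
  qed
  have "?o 0 = 0" "?o q = 1" using inv same[of q] v by (auto simp: occ_inv_def add_at_def)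
  then show ?thesis using 1 2 3 unfolding occ_inv_def by blast
qed

lemma occ_final:
  assumes inv: "occ_inv 0 oc"
  shows "block_grammar q L R g M oc" "oc q = 1" "\<And>i. i \<in> {1..q} \<Longrightarrow> oc i \<le> g q"
proof -
  have sum: "(\<Sum>i | i \<in> {1..q} \<and> (L i = c \<or> R i = c). oc i) \<le> oc c" if "c \<in> {1..q}" for c
  proof -
    have set: "{i. i \<in> {1..q} \<and> (L i = c \<or> R i = c)} = {i. i \<in> {0<..q} \<and> (L i = c \<or> R i = c)}" by auto
    from inv have "\<forall>c\<in>{1..q}. (\<Sum>i | i \<in> {0<..q} \<and> (L i = c \<or> R i = c). oc i) \<le> oc c"
      unfolding occ_inv_def by (elim conjE)
    then show ?thesis unfolding set using that by (rule bspec)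
  qed
  have fin: "finite {i. i \<in> {1..q} \<and> (L i = c \<or> R i = c)}" for c by simp
  have cq: "c \<in> {1..q}" if "i \<in> {1..q}" "c \<noteq> 0" "L i = c \<or> R i = c" for i c
    using that L_less[of i] R_less[of i] by auto
  show "block_grammar q L R g M oc"
  proof
    fix i c assume i: "i \<in> {1..q}" "c \<noteq> 0" "L i = c \<or> R i = c"
    have "oc i \<le> (\<Sum>i | i \<in> {1..q} \<and> (L i = c \<or> R i = c). oc i)" using i by (intro member_le_sum) auto
    then show "oc i \<le> oc c" using sum[OF cq[OF i]] by simp
  next
    fix i j c assume ij: "i \<in> {1..q}" "j \<in> {1..q}" "i \<noteq> j" "c \<noteq> 0" "L i = c \<or> R i = c" "L j = c \<or> R j = c"
    have "oc i + oc j = sum oc {i, j}" using ij(3) by simp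
    also have "\<dots> \<le> (\<Sum>i | i \<in> {1..q} \<and> (L i = c \<or> R i = c). oc i)" using ij by (intro sum_mono2) auto
    finally show "oc i + oc j \<le> oc c" using sum[OF cq[OF ij(1,4,5)]] by simp
  qed
  show "oc q = 1" "\<And>i. i \<in> {1..q} \<Longrightarrow> oc i \<le> g q" using inv by (auto simp: occ_inv_def)
qed

end

definition occ_body :: stm where
  "occ_body = Asg 6 (A 9 (V 5)) ;; Asg 7 (A 10 (V 5)) ;;
     IfL (K 0) (V 6) (Sto 13 (V 6) (Plus (A 13 (V 6)) (A 13 (V 5)))) Skp ;;
     IfL (K 0) (V 7) (Sto 13 (V 7) (Plus (A 13 (V 7)) (A 13 (V 5)))) Skp ;;
     Asg 5 (Minus (V 5) (K 1))"

definition occ_prog :: stm where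
  "occ_prog = Sto 13 (V 4) (K 1) ;; Asg 5 (V 4) ;; Whl (K 0) (V 5) occ_body"

locale machine_grammar = grammar_shape +
  fixes B Mx :: nat
  assumes B: "100 * Mx + 100 \<le> B" and q_le: "q \<le> Mx" and g_le: "i \<in> {1..q} \<Longrightarrow> g i \<le> Mx" and q1: "1 \<le> q"
begin

definition tables :: "state \<Rightarrow> bool" where
  "tables \<sigma> \<longleftrightarrow> reg \<sigma> 4 = q \<and> wmem \<sigma> 8 = g \<and> wmem \<sigma> 9 = L \<and> wmem \<sigma> 10 = R \<and> wmem \<sigma> 11 = M"

lemma occ_body_correct:
  assumes t: "tables \<sigma>" and r: "reg \<sigma> 5 = v" "v \<in> {1..q}" and inv: "occ_inv v (wmem \<sigma> 13)"
  shows "wp B occ_body (\<lambda>t \<tau>. t \<le> 50 \<and> tables \<tau> \<and> reg \<tau> 5 = v - 1 \<and> occ_inv (v - 1) (wmem \<tau> 13)) \<sigma>"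
proof -
  let ?oc = "wmem \<sigma> 13"
  let ?o = "add_at (add_at ?oc (L v) (?oc v)) (R v) (?oc v)"
  have inv': "occ_inv (v - 1) ?o" by (rule occ_step[OF inv r(2)])
  have lr: "L v < v" "R v < v" using L_less[OF r(2)] R_less[OF r(2)] by auto
  have gq: "g q \<le> Mx" using g_le q1 by simp
  have le: "?o i \<le> Mx" if "i \<in> {1..v - 1}" for i
    by (rule order_trans[OF occ_le[OF inv' that] gq]) (use r in auto)
  have vB: "v < B" "L v < B" "R v < B" "Suc 0 < B" "0 < B" using r(2) lr q_le B by auto
  have 1: "?oc (L v) + ?oc v < B" if "0 < L v"
  proof -
    have "?oc (L v) + ?oc v \<le> ?o (L v)" using that by (simp add: add_at_def)
    also have "\<dots> \<le> Mx" using le[of "L v"] that lr by simp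
    finally show ?thesis using B by linarith
  qed
  have 2: "add_at ?oc (L v) (?oc v) (R v) + ?oc v < B" if "0 < R v"
  proof -
    have "add_at ?oc (L v) (?oc v) (R v) + ?oc v = ?o (R v)" using that by (simp add: add_at_def)
    also have "\<dots> \<le> Mx" using le[of "R v"] that lr by simp
    finally show ?thesis using B by linarith
  qed
  show ?thesis using t r(1) inv' 1 2 vB lr r(2)
    by (cases "L v = 0"; cases "R v = 0"; cases "R v = L v"; simp add: occ_body_def tables_def add_at_def)
qed

lemma occ_prog_correct:
  assumes t: "tables \<sigma>" and z: "wmem \<sigma> 13 = (\<lambda>_. 0)"
  shows "wp B occ_prog (\<lambda>t \<tau>. t \<le> 60 * q + 20 \<and> tables \<tau> \<and> occ_inv 0 (wmem \<tau> 13)) \<sigma>"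
proof -
  have qB: "q < B" "Suc 0 < B" "0 < B" using q_le B by auto
  let ?\<tau> = "set_reg 5 q (wset 13 q 1 \<sigma>)"
  have "wp B (Whl (K 0) (V 5) occ_body) (\<lambda>t \<tau>. t \<le> 60 * q + 10 \<and> tables \<tau> \<and> occ_inv 0 (wmem \<tau> 13)) ?\<tau>"
  proof (rule wp_Whl_ghost[where I = "\<lambda>v \<tau>. tables \<tau> \<and> reg \<tau> 5 = v \<and> v \<le> q \<and> occ_inv v (wmem \<tau> 13)" and ?g0.0 = q
      and \<Phi> = "\<lambda>v. 60 * v"], goal_cases)
    case 1
    then show ?case using t z occ_init[OF q1] by (simp add: tables_def)
  next
    case (2 v \<tau>)
    then show ?case using qB by simp
  next
    case (3 v \<tau>)
    then have v: "tables \<tau>" "reg \<tau> 5 = v" "v \<in> {1..q}" "occ_inv v (wmem \<tau> 13)" by auto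
    show ?case
      by (rule wp_mono[OF occ_body_correct[OF v]], rule exI[of _ "v - 1"]) (use v(3) in auto)
  next
    case (4 v \<tau> t)
    then show ?case by simp
  qed
  note loop = this
  show ?thesis unfolding occ_prog_def
    using qB t by (simp add: tables_def[of \<sigma>] wp_mono[OF loop[unfolded One_nat_def]])
qed

end

section \<open>Building the search trees\<close>

lemma bl_bound: "a div 2 ^ bl x = 0 \<Longrightarrow> a \<le> 2 * x"
proof -
  assume a: "a div 2 ^ bl x = 0"
  then have "bl a \<le> bl x" by (simp add: div_0_iff_bl)
  show "a \<le> 2 * x"
  proof (cases "x = 0")
    case False
    then have "2 ^ (bl x - 1) \<le> x" "1 \<le> bl x" using bl_ge[of x] by linarith+
    moreover have "(2::nat) ^ bl x = 2 ^ (bl x - 1) + 2 ^ (bl x - 1)" using \<open>1 \<le> bl x\<close> by (cases "bl x") simp_all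
    ultimately have "2 ^ bl x \<le> 2 * x" by (metis add_le_mono mult_2)
    moreover have "a < 2 ^ bl x" by (rule iffD1[OF bl_le_iff \<open>bl a \<le> bl x\<close>])
    ultimately show ?thesis by (meson less_imp_le order_trans)
  next
    case True
    then have "bl a = 0" using \<open>bl a \<le> bl x\<close> bl_0_iff[of x] by simp
    then show ?thesis using bl_0_iff[of a] by simp
  qed
qed

text \<open>Bitwise operations do not exceed the larger bit length, hence not twice the common
  bound; this excludes overflow in the tests of paths and levels.\<close>

lemma xor_and_le:
  fixes a b x :: nat
  assumes "a \<le> x" "b \<le> x" shows "xor a b \<le> 2 * x" "and a b \<le> 2 * x"
proof -
  have "a div 2 ^ bl x = 0" "b div 2 ^ bl x = 0" using assms by (simp_all add: div_0_iff_bl bl_mono)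
  then have "xor a b div 2 ^ bl x = 0" "and a b div 2 ^ bl x = 0" by (simp_all add: xor_div and_div)
  then show "xor a b \<le> 2 * x" "and a b \<le> 2 * x" by (simp_all add: bl_bound)
qed

definition path_test :: "nat \<Rightarrow> stm \<Rightarrow> stm \<Rightarrow> stm" where
  "path_test c s u = IfL (Xor (A 13 (V 5)) (A 13 (V c))) (And (A 13 (V 5)) (A 13 (V c)))
     (IfL (Xor (A 8 (V 5)) (A 8 (V c))) (And (A 8 (V 5)) (A 8 (V c))) s u) u"

text \<open>Register 8 receives the successor of the current node on its path, and 9 the value \<open>Ls\<close>.
  Word arrays: 13 \<open>oc\<close>, 15 \<open>z\<close>, 16 the nearest later node of the path with larger \<open>z\<close>, 18 \<open>sh\<close>, 19 \<open>rt\<close>, 20 \<open>Ls\<close>,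
  21--24 the node of the search structure and the value \<open>Ls\<close> with which a query continues in the left or right
  child, 25 the number of windows of the left child.\<close>

definition path_prog :: stm where
  "path_prog = Asg 6 (A 9 (V 5)) ;; Asg 7 (A 10 (V 5)) ;; Asg 8 (K 0) ;; Asg 9 (K 0) ;;
     path_test 6 (Asg 8 (V 6) ;; Asg 9 (A 20 (V 6)))
       (path_test 7 (Asg 8 (V 7) ;; Asg 9 (Plus (A 11 (V 5)) (A 20 (V 7)))) Skp)"

text \<open>Node 0 gets the level of the current node as a sentinel.\<close>

definition pop_prog :: stm where
  "pop_prog = Asg 10 (Xor (A 8 (V 5)) (A 8 (V 8))) ;; Sto 15 (V 5) (V 10) ;; Sto 15 (K 0) (V 10) ;;
     Asg 11 (K 0) ;; Asg 12 (V 8) ;;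
     Whl (A 15 (V 12)) (V 10) (Asg 11 (V 12) ;; Asg 12 (A 16 (V 12)))"

text \<open>If there is no next greater node, the second store goes to cell 0, about which
  \<open>sh_inv\<close> says nothing. The two comparisons of registers 6 and 8 together test for
  inequality.\<close>

definition link_prog :: stm where
  "link_prog = Sto 16 (V 5) (V 12) ;; Sto 18 (V 12) (V 5) ;;
     IfL (K 0) (V 12) (Sto 19 (V 5) (A 19 (V 8))) (Sto 19 (V 5) (V 5)) ;;
     Sto 20 (V 5) (V 9) ;; Sto 25 (V 5) (A 8 (V 6)) ;;
     Sto 22 (V 5) (A 20 (V 6)) ;; Sto 24 (V 5) (A 20 (V 7)) ;;
     Sto 21 (V 5) (A 19 (V 6)) ;; Sto 23 (V 5) (A 19 (V 7)) ;;
     IfL (K 0) (V 8)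
       (IfL (V 6) (V 8) (Sto 23 (V 5) (V 11)) (IfL (V 8) (V 6) (Sto 23 (V 5) (V 11)) (Sto 21 (V 5) (V 11)))) Skp ;;
     Asg 5 (Plus (V 5) (K 1))"

definition tree_body :: stm where
  "tree_body = path_prog ;; pop_prog ;; link_prog"

definition tree_prog :: stm where
  "tree_prog = Asg 5 (K 1) ;; Whl (V 5) (Plus (V 4) (K 1)) tree_body"

locale machine_paths = machine_grammar + block_grammar +
  assumes oc_le: "i \<in> {1..q} \<Longrightarrow> oc i \<le> Mx" and oc_0: "oc 0 = 0"
begin

definition tables2 :: "state \<Rightarrow> bool" where
  "tables2 \<sigma> \<longleftrightarrow> tables \<sigma> \<and> wmem \<sigma> 13 = oc"

definition off :: "(nat \<Rightarrow> nat) \<Rightarrow> nat \<Rightarrow> nat" where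
  "off LS v = (if nxt v = 0 then 0 else (if nxt v = L v then 0 else M v) + LS (nxt v))"

text \<open>\<open>c\<close> stands for the pointers \<open>ch\<close>, for which the machine keeps
  no array. They are written straight into the entry for the side on which the path continues; the
  entry for a side that leaves the path holds the entry point of that child.\<close>

definition node_ok where
  "node_ok Z NG RT LS TL LL TR LR GL c j \<longleftrightarrow> Z j = z j \<and> ng_ok j (NG j) \<and> is_top (between j (NG j)) (c j) \<and>
     rt_ok j (RT j) \<and> LS j = off LS j \<and> LS j < g j \<and> c j < B \<and>
     TL j = (if nxt j \<noteq> 0 \<and> nxt j = L j then c j else RT (L j)) \<and> LL j = LS (L j) \<and>
     TR j = (if nxt j \<noteq> 0 \<and> nxt j = R j then c j else RT (R j)) \<and> LR j = LS (R j) \<and> GL j = g (L j)"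

definition nodes_ok where
  "nodes_ok i Z NG RT LS TL LL TR LR GL c \<longleftrightarrow> (\<forall>j\<in>{1..i}. node_ok Z NG RT LS TL LL TR LR GL c j)"

definition tinv :: "nat \<Rightarrow> (nat \<Rightarrow> nat) \<Rightarrow> state \<Rightarrow> bool" where
  "tinv i c \<sigma> \<longleftrightarrow> tables2 \<sigma> \<and> reg \<sigma> 5 = Suc i \<and> i \<le> q \<and> sh_inv i (wmem \<sigma> 18) \<and>
     nodes_ok i (wmem \<sigma> 15) (wmem \<sigma> 16) (wmem \<sigma> 19) (wmem \<sigma> 20) (wmem \<sigma> 21) (wmem \<sigma> 22)
        (wmem \<sigma> 23) (wmem \<sigma> 24) (wmem \<sigma> 25) c"

lemma nxt_less: "v \<in> {1..q} \<Longrightarrow> nxt v < v"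
  using L_less[of v] R_less[of v] by (auto simp: nxt_def)

lemma val_bounds:
  assumes "i \<le> q" shows "g i \<le> Mx" "oc i \<le> Mx" "i < B"
  using assms g_le[of i] oc_le[of i] g_0 oc_0 q_le B by (cases "i = 0"; auto)+

lemma bit_bounds:
  assumes "i \<le> q" "j \<le> q"
  shows "xor (g i) (g j) < B" "and (g i) (g j) < B" "xor (oc i) (oc j) < B" "and (oc i) (oc j) < B"
  using xor_and_le[OF val_bounds(1)[OF assms(1)] val_bounds(1)[OF assms(2)]]
    xor_and_le[OF val_bounds(2)[OF assms(1)] val_bounds(2)[OF assms(2)]] B by linarith+

lemma path_prog_correct:
  assumes t: "tables2 \<sigma>" and v: "reg \<sigma> 5 = v" "v \<in> {1..q}" and LS: "\<And>j. j \<in> {1..<v} \<Longrightarrow> wmem \<sigma> 20 j < g j"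
  shows "wp B path_prog (\<lambda>t \<tau>. t \<le> 100 \<and> reg \<tau> 6 = L v \<and> reg \<tau> 7 = R v \<and> reg \<tau> 8 = nxt v \<and>
     reg \<tau> 9 = off (wmem \<sigma> 20) v) \<sigma>"
proof -
  have lr: "L v < v" "R v < v" "L v \<le> q" "R v \<le> q" "v \<le> q" using L_less[OF v(2)] R_less[OF v(2)] v(2) by auto
  note b = bit_bounds[OF lr(5,3)] bit_bounds[OF lr(5,4)] val_bounds(3)[OF lr(3)] val_bounds(3)[OF lr(4)] val_bounds(3)[OF lr(5)]
  have B0: "0 < B" using B by linarith
  have mem: "wmem \<sigma> 8 = g" "wmem \<sigma> 9 = L" "wmem \<sigma> 10 = R" "wmem \<sigma> 11 = M" "wmem \<sigma> 13 = oc"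
    using t by (simp_all add: tables2_def tables_def)
  have sums: "M v + wmem \<sigma> 20 (R v) < B" if "on_path v (R v)"
  proof -
    have "R v \<noteq> 0" using that not_on_path_0 by metis
    then have "wmem \<sigma> 20 (R v) < g (R v)" using LS lr by simp
    then have "M v + wmem \<sigma> 20 (R v) < g v" using gR[OF v(2)] by simp
    then show ?thesis using val_bounds(1)[OF lr(5)] B by linarith
  qed
  have nz: "on_path v (L v) \<Longrightarrow> L v \<noteq> 0" "on_path v (R v) \<Longrightarrow> R v \<noteq> 0" using not_on_path_0 by metis+
  show ?thesis
  proof (cases "on_path v (L v)")
    case True
    then have n: "nxt v = L v" by (simp add: nxt_def)
    show ?thesis using True v(1) b B0 nz(1)[OF True]
      by (simp add: path_prog_def path_test_def mem n off_def on_path_def same_def)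
  next
    case Lf: False
    show ?thesis
    proof (cases "on_path v (R v)")
      case True
      then have n: "nxt v = R v" "R v \<noteq> L v" using Lf by (auto simp: nxt_def)
      show ?thesis using Lf[unfolded on_path_def same_def] True[unfolded on_path_def same_def] v(1) b B0 nz(2)[OF True] sums[OF True]
        by (simp add: path_prog_def path_test_def mem n off_def)
    next
      case False
      then have n: "nxt v = 0" using Lf by (simp add: nxt_def)
      show ?thesis using Lf[unfolded on_path_def same_def] False[unfolded on_path_def same_def] v(1) b B0
        by (simp add: path_prog_def path_test_def mem n off_def)
    qed
  qed
qed

lemma pop_prog_correct:
  assumes t: "tables2 \<sigma>" and v: "reg \<sigma> 5 = v" "v \<in> {1..q}" "reg \<sigma> 8 = nxt v"
    and Z: "\<And>j. j \<in> {1..<v} \<Longrightarrow> wmem \<sigma> 15 j = z j" and NG: "\<And>j. j \<in> {1..<v} \<Longrightarrow> ng_ok j (wmem \<sigma> 16 j)"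
  shows "wp B pop_prog (\<lambda>t \<tau>. t \<le> 10 * card (pops v (nxt v)) + 50 \<and> ng_ok v (reg \<tau> 12) \<and>
     is_top (between v (reg \<tau> 12)) (reg \<tau> 11) \<and> wmem \<tau> 15 = (wmem \<sigma> 15)(v := z v, 0 := z v)) \<sigma>"
proof -
  have vq: "v \<le> q" "nxt v \<le> q" "v \<noteq> 0" using v(2) nxt_less[OF v(2)] by auto
  have zB: "z v < B" unfolding z_def by (rule bit_bounds[OF vq(1,2)])
  have B0: "0 < B" "v < B" "nxt v < B" using B val_bounds(3) vq by auto
  let ?Z = "(wmem \<sigma> 15)(v := z v, 0 := z v)"
  let ?\<tau> = "set_reg 12 (nxt v) (set_reg 11 0 (wset 15 0 (z v) (wset 15 v (z v) (set_reg 10 (z v) \<sigma>))))"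
  have "wp B (Whl (A 15 (V 12)) (V 10) (Asg 11 (V 12) ;; Asg 12 (A 16 (V 12))))
     (\<lambda>t \<tau>. t \<le> 10 * card (pops v (nxt v)) + 10 \<and> ng_ok v (reg \<tau> 12) \<and>
     is_top (between v (reg \<tau> 12)) (reg \<tau> 11) \<and> wmem \<tau> 15 = ?Z) ?\<tau>"
  proof (rule wp_Whl[where I = "\<lambda>\<tau>. pop_inv v (reg \<tau> 12) (reg \<tau> 11) \<and> reg \<tau> 10 = z v \<and> wmem \<tau> 15 = ?Z \<and> wmem \<tau> 16 = wmem \<sigma> 16"
      and \<Phi> = "\<lambda>\<tau>. 10 * card (pops v (reg \<tau> 12))"], goal_cases)
    case 1
    then show ?case using pop_init[OF v(2)] by simp
  next
    case (2 \<tau>)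
    then have "reg \<tau> 12 \<le> q" using E_trancl[of v "reg \<tau> 12"] by (auto simp: pop_inv_def)
    then show ?case using 2 zB val_bounds(3) by simp
  next
    case (3 \<tau>)
    define k where "k = reg \<tau> 12"
    have inv: "pop_inv v k (reg \<tau> 11)" using 3 by (simp add: k_def)
    have less: "?Z k < z v" using 3 by (simp add: k_def)
    then have k0: "k \<noteq> 0" "k \<noteq> v" by (auto simp: fun_upd_apply split: if_splits)
    then have kv: "k \<in> {1..<v}" using inv E_trancl[of v k] by (auto simp: pop_inv_def)
    have zk: "z k < z v" using less k0 Z[OF kv] by simp
    note st = pop_step[OF inv k0(1) zk NG[OF kv]] pops_step[OF inv k0(1) zk NG[OF kv]]
    have "k < B" using kv B0 by simp
    then show ?case using 3 st by (simp add: k_def[symmetric])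
  next
    case (4 \<tau> t)
    have inv: "pop_inv v (reg \<tau> 12) (reg \<tau> 11)" using 4 by simp
    have "reg \<tau> 12 = 0 \<or> \<not> z (reg \<tau> 12) < z v"
    proof (cases "reg \<tau> 12 = 0")
      case False
      then have "reg \<tau> 12 \<in> {1..<v}" using inv E_trancl[of v "reg \<tau> 12"] by (auto simp: pop_inv_def)
      then show ?thesis using 4 Z by auto
    qed simp
    then show ?case using pop_exit[OF inv] 4 by simp
  qed
  note loop = this
  have mem: "wmem \<sigma> 8 = g" using t by (simp_all add: tables2_def tables_def)
  show ?thesis unfolding pop_prog_def
    using zB B0 by (simp add: v(1,3) mem z_def[symmetric] wp_mono[OF loop])
qed

lemma frame_tables2: "frame s \<sigma> \<tau> \<Longrightarrow> tables2 \<sigma> \<Longrightarrow> 4 \<notin> wregs s \<Longrightarrow> warrs s \<inter> {8, 9, 10, 11, 13} = {} \<Longrightarrow> tables2 \<tau>"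
  by (auto simp: frame_def tables2_def tables_def)

lemma node_ok_upd:
  assumes "node_ok Z NG RT LS TL LL TR LR GL c j" "j \<in> {1..q}" "j < v"
  shows "node_ok (Z(v := a0, 0 := a0')) (NG(v := a1)) (RT(v := a2)) (LS(v := a3)) (TL(v := a4)) (LL(v := a5))
     (TR(v := a6)) (LR(v := a7)) (GL(v := a8)) (c(v := a9)) j"
proof -
  have "L j \<noteq> v" "R j \<noteq> v" "nxt j \<noteq> v" "j \<noteq> v" "j \<noteq> 0"
    using assms L_less[of j] R_less[of j] nxt_less[of j] by auto
  then show ?thesis using assms(1) by (simp add: node_ok_def off_def)
qed

lemma off_less:
  assumes v: "v \<in> {1..q}" and LS: "\<And>j. j \<in> {1..<v} \<Longrightarrow> LS j < g j"
  shows "off LS v < g v"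
proof (cases "nxt v = 0")
  case True
  then show ?thesis using g_pos[OF v] by (simp add: off_def)
next
  case False
  then have "LS (nxt v) < g (nxt v)" using LS nxt_less[OF v] by simp
  then show ?thesis using nxt_child[OF v False] gL_less[OF v] gR[OF v] by (auto simp: off_def)
qed

lemma link_prog_correct:
  assumes t: "tables2 \<sigma>" and v: "v = Suc i" "v \<in> {1..q}"
    and r: "reg \<sigma> 5 = v" "reg \<sigma> 6 = L v" "reg \<sigma> 7 = R v" "reg \<sigma> 8 = nxt v" "reg \<sigma> 9 = off (wmem \<sigma> 20) v"
    and sh: "sh_inv i (wmem \<sigma> 18)" and Z: "wmem \<sigma> 15 = Z(v := z v, 0 := z v)"
    and n: "\<forall>j\<in>{1..i}. node_ok Z (wmem \<sigma> 16) (wmem \<sigma> 19) (wmem \<sigma> 20) (wmem \<sigma> 21) (wmem \<sigma> 22)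
        (wmem \<sigma> 23) (wmem \<sigma> 24) (wmem \<sigma> 25) c j"
    and k: "ng_ok v (reg \<sigma> 12)" "is_top (between v (reg \<sigma> 12)) (reg \<sigma> 11)"
  shows "wp B link_prog (\<lambda>t \<tau>. t \<le> 100 \<and> tinv v (c(v := reg \<sigma> 11)) \<tau>) \<sigma>"
proof -
  define k ch where "k = reg \<sigma> 12" and "ch = reg \<sigma> 11"
  note kc = k[folded k_def ch_def]
  have ni: "node_ok Z (wmem \<sigma> 16) (wmem \<sigma> 19) (wmem \<sigma> 20) (wmem \<sigma> 21) (wmem \<sigma> 22)
        (wmem \<sigma> 23) (wmem \<sigma> 24) (wmem \<sigma> 25) c j" if "j \<in> {1..<v}" for j
    using n that v(1) by simp
  have nif: "wmem \<sigma> 20 j < g j" "rt_ok j (wmem \<sigma> 19 j)" if "j \<in> {1..<v}" for j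
    using ni[OF that] unfolding node_ok_def by blast+
  have LSl: "off (wmem \<sigma> 20) v < g v" by (rule off_less[OF v(2) nif(1)])
  have lr: "L v < v" "R v < v" "nxt v < v" "v \<le> q" using L_less[OF v(2)] R_less[OF v(2)] nxt_less[OF v(2)] v(2) by auto
  have kq: "k \<le> q" using kc(1) E_trancl[of v k] by (auto simp: ng_ok_def)
  have cq: "ch \<le> q" using kc(2) E_trancl[of v ch] by (auto simp: is_top_def between_def)
  have bnd: "v < B" "L v < B" "R v < B" "nxt v < B" "k < B" "ch < B" "off (wmem \<sigma> 20) v < B" "Suc v < B" "Suc 0 < B" "0 < B"
    using lr kq cq q_le B LSl val_bounds(1)[OF lr(4)] by linarith+
  have mem: "wmem \<sigma> 8 = g" using t by (simp_all add: tables2_def tables_def)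
  define RT where "RT = wmem \<sigma> 19"
  define TL TR where "TL = (if nxt v \<noteq> 0 \<and> nxt v = L v then ch else RT (L v))"
    and "TR = (if nxt v \<noteq> 0 \<and> nxt v = R v then ch else RT (R v))"
  define rv where "rv = (if k = 0 then v else RT (nxt v))"
  have rt: "rt_ok v rv" unfolding rv_def
  proof (rule rt_step[OF kc(1)])
    assume "k \<noteq> 0"
    then have "nxt v \<noteq> 0" using kc(1) by (auto simp: ng_ok_def trancl_nxt)
    then show "rt_ok (nxt v) (RT (nxt v))" using nif(2)[of "nxt v"] lr by (simp add: RT_def)
  qed
  have nv: "node_ok (Z(v := z v, 0 := z v)) ((wmem \<sigma> 16)(v := k)) ((wmem \<sigma> 19)(v := rv))
      ((wmem \<sigma> 20)(v := off (wmem \<sigma> 20) v)) ((wmem \<sigma> 21)(v := TL)) ((wmem \<sigma> 22)(v := wmem \<sigma> 20 (L v)))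
      ((wmem \<sigma> 23)(v := TR)) ((wmem \<sigma> 24)(v := wmem \<sigma> 20 (R v))) ((wmem \<sigma> 25)(v := g (L v))) (c(v := ch)) v"
    using kc rt LSl lr bnd v by (simp add: node_ok_def off_def TL_def TR_def RT_def)
  have nodes: "nodes_ok v (Z(v := z v, 0 := z v)) ((wmem \<sigma> 16)(v := k)) ((wmem \<sigma> 19)(v := rv))
      ((wmem \<sigma> 20)(v := off (wmem \<sigma> 20) v)) ((wmem \<sigma> 21)(v := TL)) ((wmem \<sigma> 22)(v := wmem \<sigma> 20 (L v)))
      ((wmem \<sigma> 23)(v := TR)) ((wmem \<sigma> 24)(v := wmem \<sigma> 20 (R v))) ((wmem \<sigma> 25)(v := g (L v))) (c(v := ch))"
    unfolding nodes_ok_def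
  proof
    fix j assume "j \<in> {1..v}"
    then consider "j = v" | "j \<in> {1..<v}" by fastforce
    then show "node_ok (Z(v := z v, 0 := z v)) ((wmem \<sigma> 16)(v := k)) ((wmem \<sigma> 19)(v := rv))
      ((wmem \<sigma> 20)(v := off (wmem \<sigma> 20) v)) ((wmem \<sigma> 21)(v := TL)) ((wmem \<sigma> 22)(v := wmem \<sigma> 20 (L v)))
      ((wmem \<sigma> 23)(v := TR)) ((wmem \<sigma> 24)(v := wmem \<sigma> 20 (R v))) ((wmem \<sigma> 25)(v := g (L v))) (c(v := ch)) j"
    proof cases
      case 1
      then show ?thesis using nv by simp
    next
      case 2
      then show ?thesis using ni[OF 2] lr by (intro node_ok_upd) auto
    qed
  qed
  have sh': "sh_inv v ((wmem \<sigma> 18)(k := v))" using sh_step[OF sh _ kc(1)[unfolded v(1)]] v by simp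
  have sel: "nxt v \<noteq> 0 \<Longrightarrow> nxt v = L v \<and> R v \<noteq> L v \<or> nxt v = R v \<and> (L v < R v \<or> R v < L v)"
    using nxt_child[OF v(2)] by auto
  let ?P = "\<lambda>\<tau>. reg \<tau> 5 = Suc v \<and> wmem \<tau> 15 = wmem \<sigma> 15 \<and> wmem \<tau> 16 = (wmem \<sigma> 16)(v := k) \<and>
     wmem \<tau> 18 = (wmem \<sigma> 18)(k := v) \<and> wmem \<tau> 19 = (wmem \<sigma> 19)(v := rv) \<and>
     wmem \<tau> 20 = (wmem \<sigma> 20)(v := off (wmem \<sigma> 20) v) \<and> wmem \<tau> 21 = (wmem \<sigma> 21)(v := TL) \<and>
     wmem \<tau> 22 = (wmem \<sigma> 22)(v := wmem \<sigma> 20 (L v)) \<and> wmem \<tau> 23 = (wmem \<sigma> 23)(v := TR) \<and>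
     wmem \<tau> 24 = (wmem \<sigma> 24)(v := wmem \<sigma> 20 (R v)) \<and> wmem \<tau> 25 = (wmem \<sigma> 25)(v := g (L v))"
  have rs: "reg \<sigma> 12 = k" "reg \<sigma> 11 = ch" by (simp_all add: k_def ch_def)
  have ne: "L v \<noteq> v" "R v \<noteq> v" "nxt v \<noteq> v" using lr by simp_all
  have exec: "wp B link_prog (\<lambda>t \<tau>. t \<le> 100 \<and> ?P \<tau>) \<sigma>"
  proof (cases "nxt v = 0")
    case True
    then have "TL = wmem \<sigma> 19 (L v)" "TR = wmem \<sigma> 19 (R v)" by (simp_all add: TL_def TR_def RT_def)
    then show ?thesis using True bnd
      by (cases "k = 0") (simp_all add: link_prog_def r mem rs ne rv_def RT_def)
  next
    case n0: False
    show ?thesis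
    proof (cases "nxt v = L v")
      case True
      then have "TL = ch" "TR = wmem \<sigma> 19 (R v)" "0 < L v" using n0 sel by (auto simp: TL_def TR_def RT_def)
      then show ?thesis using True bnd
        by (cases "k = 0") (simp_all add: link_prog_def r mem rs ne rv_def RT_def)
    next
      case False
      then have "TR = ch" "TL = wmem \<sigma> 19 (L v)" "0 < R v" "nxt v = R v" "L v < R v \<or> R v < L v"
        using n0 sel by (auto simp: TL_def TR_def RT_def)
      then show ?thesis using bnd
        by (cases "k = 0"; cases "L v < R v") (simp_all add: link_prog_def r mem rs ne rv_def RT_def)
    qed
  qed
  show ?thesis
  proof (rule wp_mono[OF wp_frame[OF exec]], goal_cases)
    case (1 t' \<tau>)
    then have P: "?P \<tau>" and f: "frame link_prog \<sigma> \<tau>" and t': "t' \<le> 100" by blast+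
    have w: "wregs link_prog = {5}" "warrs link_prog = {16, 18, 19, 20, 21, 22, 23, 24, 25}"
      by (auto simp: link_prog_def)
    have "tables2 \<tau>" by (rule frame_tables2[OF f t]) (simp_all add: w)
    then show ?case using P nodes sh' lr t' by (simp add: tinv_def Z ch_def k_def)
  qed
qed

lemma tree_body_correct:
  assumes inv: "tinv i c \<sigma>" and i: "i < q"
  shows "wp B tree_body (\<lambda>t \<tau>. t \<le> 10 * card (pops (Suc i) (nxt (Suc i))) + 250 \<and> (\<exists>c'. tinv (Suc i) c' \<tau>)) \<sigma>"
proof -
  let ?v = "Suc i"
  have v: "?v \<in> {1..q}" using i by simp
  have t: "tables2 \<sigma>" and r5: "reg \<sigma> 5 = ?v" and sh: "sh_inv i (wmem \<sigma> 18)"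
    and n: "\<forall>j\<in>{1..i}. node_ok (wmem \<sigma> 15) (wmem \<sigma> 16) (wmem \<sigma> 19) (wmem \<sigma> 20) (wmem \<sigma> 21) (wmem \<sigma> 22)
        (wmem \<sigma> 23) (wmem \<sigma> 24) (wmem \<sigma> 25) c j"
    using inv by (simp_all add: tinv_def nodes_ok_def)
  have nj: "wmem \<sigma> 20 j < g j" "wmem \<sigma> 15 j = z j" "ng_ok j (wmem \<sigma> 16 j)" if "j \<in> {1..<?v}" for j
    using bspec[OF n, of j] that unfolding node_ok_def by auto
  show ?thesis unfolding tree_body_def
  proof (rule wp_Sq[OF path_prog_correct[OF t r5 v nj(1)]], assumption)
    fix t1 :: nat and \<tau>1
    assume 1: "t1 \<le> 100 \<and> reg \<tau>1 6 = L ?v \<and> reg \<tau>1 7 = R ?v \<and> reg \<tau>1 8 = nxt ?v \<and> reg \<tau>1 9 = off (wmem \<sigma> 20) ?v"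
      and f1: "frame path_prog \<sigma> \<tau>1"
    have w: "wregs path_prog = {6, 7, 8, 9}" "warrs path_prog = {}" by (auto simp: path_prog_def path_test_def)
    have m1: "wmem \<tau>1 = wmem \<sigma>" "reg \<tau>1 5 = ?v" and t1: "tables2 \<tau>1"
      using f1 r5 t frame_tables2[OF f1 t] by (auto simp: frame_def w)
    show "wp B (pop_prog ;; link_prog) (\<lambda>t' \<tau>. t1 + t' \<le> 10 * card (pops ?v (nxt ?v)) + 250 \<and> (\<exists>c'. tinv ?v c' \<tau>)) \<tau>1"
    proof (rule wp_Sq[OF pop_prog_correct[OF t1 m1(2) v]])
      show "reg \<tau>1 8 = nxt ?v" using 1 by simp
      show "wmem \<tau>1 15 j = z j" "ng_ok j (wmem \<tau>1 16 j)" if "j \<in> {1..<?v}" for j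
        using nj that unfolding m1 by auto
      fix t2 :: nat and \<tau>2
      assume 2: "t2 \<le> 10 * card (pops ?v (nxt ?v)) + 50 \<and> ng_ok ?v (reg \<tau>2 12) \<and>
         is_top (between ?v (reg \<tau>2 12)) (reg \<tau>2 11) \<and> wmem \<tau>2 15 = (wmem \<tau>1 15)(?v := z ?v, 0 := z ?v)"
        and f2: "frame pop_prog \<tau>1 \<tau>2"
      have w2: "wregs pop_prog = {10, 11, 12}" "warrs pop_prog = {15}" by (auto simp: pop_prog_def)
      have m2: "\<And>a. a \<noteq> 15 \<Longrightarrow> wmem \<tau>2 a = wmem \<sigma> a" "\<And>r. r < 10 \<Longrightarrow> reg \<tau>2 r = reg \<tau>1 r" and t2: "tables2 \<tau>2"
        using f2 m1 frame_tables2[OF f2 t1] by (auto simp: frame_def w2)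
      have link: "wp B link_prog (\<lambda>t \<tau>. t \<le> 100 \<and> tinv ?v (c(?v := reg \<tau>2 11)) \<tau>) \<tau>2"
        by (rule link_prog_correct[OF t2 refl v, where Z = "wmem \<sigma> 15"]) (use 1 2 m1 m2 sh n in simp_all)
      show "wp B link_prog (\<lambda>t' \<tau>. t1 + (t2 + t') \<le> 10 * card (pops ?v (nxt ?v)) + 250 \<and> (\<exists>c'. tinv ?v c' \<tau>)) \<tau>2"
        by (rule wp_mono[OF link]) (use 1 2 in auto)
    qed
  qed
qed

lemma tree_prog_correct:
  assumes t: "tables2 \<sigma>" and z: "wmem \<sigma> 18 = (\<lambda>_. 0)"
  shows "wp B tree_prog (\<lambda>t \<tau>. t \<le> 300 * q + 20 \<and> (\<exists>c. tinv q c \<tau>)) \<sigma>"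
proof -
  have qB: "q + 1 < B" "Suc 0 < B" using q_le B by auto
  let ?\<tau> = "set_reg 5 1 \<sigma>"
  have "sh_inv 0 (\<lambda>_. 0)" by (simp add: sh_inv_def)
  then have i0: "tinv 0 c ?\<tau>" for c using t z by (simp add: tinv_def nodes_ok_def tables2_def tables_def)
  \<comment> \<open>The scans are charged to the exposed nodes that they cover. Each insertion adds
    at most one such node, whose share of 10 is contained in the 280.\<close>
  have "wp B (Whl (V 5) (Plus (V 4) (K 1)) tree_body) (\<lambda>t \<tau>. t \<le> 300 * q + 10 \<and> (\<exists>c. tinv q c \<tau>)) ?\<tau>"
  proof (rule wp_Whl_ghost[where I = "\<lambda>i \<tau>. \<exists>c. tinv i c \<tau>" and ?g0.0 = 0
      and \<Phi> = "\<lambda>i. 280 * (q - i) + 10 * card (exposed i)"], goal_cases)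
    case 1
    then show ?case using i0 by blast
  next
    case (2 i \<tau>)
    then have "reg \<tau> 5 = Suc i" "i \<le> q" "reg \<tau> 4 = q" by (auto simp: tinv_def tables2_def tables_def)
    then show ?case using qB by simp
  next
    case (3 i \<tau>)
    then obtain c where c: "tinv i c \<tau>" by blast
    then have i: "i < q" using 3 by (simp add: tinv_def tables2_def tables_def)
    have "card (exposed (Suc i)) + card (pops (Suc i) (nxt (Suc i))) \<le> card (exposed i) + 1"
      by (rule exposed_step) (use i in simp)
    moreover have "280 * (q - i) = 280 * (q - Suc i) + 280" using i by (simp add: Suc_diff_Suc)
    ultimately show ?case
      by (intro wp_mono[OF tree_body_correct[OF c i]] exI[of _ "Suc i"]) auto
  next
    case (4 i \<tau> t)
    then obtain c where c: "tinv i c \<tau>" by blast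
    then have "i = q" using 4 by (simp add: tinv_def tables2_def tables_def)
    moreover have "exposed 0 = {}" by (simp add: exposed_def)
    ultimately show ?case using 4 by auto
  qed
  note loop = this
  show ?thesis unfolding tree_prog_def
    using qB by (simp add: wp_mono[OF loop[unfolded One_nat_def]])
qed

end

section \<open>The output and the query program\<close>

text \<open>The record of a node: window count, \<open>Ls\<close>, \<open>sh\<close>, count of the
  left child, start of the right child, and place of the own windows. Then come the node where the
  search continues and the matching \<open>Ls\<close>, first for the left and then for the right
  side.\<close>

definition fields :: "nat list" where
  "fields = [8, 20, 18, 25, 11, 12, 21, 22, 23, 24]"

fun pack_fields :: "nat list \<Rightarrow> stm" where
  "pack_fields [] = Skp"
| "pack_fields (a # as) = Sto 1 (V 6) (A a (V 5)) ;; Asg 6 (Plus (V 6) (K 1)) ;; pack_fields as"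

text \<open>The record of node 0 contains the entry point for the root.\<close>

definition pack_prog :: stm where
  "pack_prog = Sto 21 (K 0) (A 19 (V 4)) ;; Sto 22 (K 0) (A 20 (V 4)) ;; Asg 5 (K 0) ;; Asg 6 (K 0) ;;
     Whl (V 5) (Plus (V 4) (K 1)) (pack_fields fields ;; Asg 5 (Plus (V 5) (K 1))) ;;
     Asg 0 (V 6) ;; Asg 1 (Plus (Minus (V 3) (V 1)) (K 1))"

lemma pack_fields_sets: "wregs (pack_fields as) \<subseteq> {6}" "warrs (pack_fields as) \<subseteq> {1}"
  by (induction as) auto

lemma pack_fields_correct:
  assumes "reg \<sigma> 5 = v" "reg \<sigma> 6 = x" "1 \<notin> set as" "v < B" "x + length as < B" "1 < B"
  shows "wp B (pack_fields as) (\<lambda>t \<tau>. t \<le> 8 * length as + 1 \<and> reg \<tau> 6 = x + length as \<and>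
    (\<forall>y<x. wmem \<tau> 1 y = wmem \<sigma> 1 y) \<and> (\<forall>i<length as. wmem \<tau> 1 (x + i) = wmem \<sigma> (as ! i) v)) \<sigma>"
  using assms
proof (induction as arbitrary: \<sigma> x)
  case (Cons a as)
  let ?\<tau> = "set_reg 6 (x + 1) (wset 1 x (wmem \<sigma> a v) \<sigma>)"
  have "wp B (pack_fields as) (\<lambda>t \<tau>. t \<le> 8 * length as + 1 \<and> reg \<tau> 6 = x + 1 + length as \<and>
    (\<forall>y<x + 1. wmem \<tau> 1 y = wmem ?\<tau> 1 y) \<and> (\<forall>i<length as. wmem \<tau> 1 (x + 1 + i) = wmem ?\<tau> (as ! i) v)) ?\<tau>"
    by (rule Cons.IH) (use Cons.prems in auto)
  note IH = this
  have "wp B (pack_fields as) (\<lambda>t \<tau>. 7 + t \<le> 8 * length (a # as) + 1 \<and> reg \<tau> 6 = x + length (a # as) \<and>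
    (\<forall>y<x. wmem \<tau> 1 y = wmem \<sigma> 1 y) \<and> (\<forall>i<length (a # as). wmem \<tau> 1 (x + i) = wmem \<sigma> ((a # as) ! i) v)) ?\<tau>"
  proof (rule wp_mono[OF IH], goal_cases)
    case (1 t \<tau>)
    have "wmem \<tau> 1 (x + i) = wmem \<sigma> ((a # as) ! i) v" if i: "i < length (a # as)" for i
    proof (cases i)
      case 0
      then show ?thesis using 1 by simp
    next
      case (Suc j)
      then have j: "j < length as" using i by simp
      have "as ! j \<noteq> 1" using Cons.prems(3) nth_mem[OF j] by auto
      then show ?thesis using 1 j Suc by simp
    qed
    then show ?case using 1 by simp
  qed
  note step = this
  show ?case
    using Cons.prems by (simp, intro wp_mono[OF step[simplified]]) simp
qed simp

lemma pack_prog_correct: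
  assumes r: "reg \<sigma> 4 = q" "reg \<sigma> 3 = k" "reg \<sigma> 1 = m" "m \<le> k" and B: "10 * q + 100 < B" "k + 1 < B"
  shows "wp B pack_prog (\<lambda>t \<tau>. t \<le> 100 * q + 150 \<and> reg \<tau> 0 = 10 * (q + 1) \<and> reg \<tau> 1 = k - m + 1 \<and>
    nmem \<tau> = nmem \<sigma> \<and> (\<forall>v\<le>q. \<forall>f<10. wmem \<tau> 1 (10 * v + f) =
      ((wmem \<sigma>)(21 := (wmem \<sigma> 21)(0 := wmem \<sigma> 19 q), 22 := (wmem \<sigma> 22)(0 := wmem \<sigma> 20 q))) (fields ! f) v)) \<sigma>"
proof -
  let ?W = "(wmem \<sigma>)(21 := (wmem \<sigma> 21)(0 := wmem \<sigma> 19 q), 22 := (wmem \<sigma> 22)(0 := wmem \<sigma> 20 q))"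
  let ?\<tau> = "set_reg 6 0 (set_reg 5 0 (wset 22 0 (wmem \<sigma> 20 q) (wset 21 0 (wmem \<sigma> 19 q) \<sigma>)))"
  let ?body = "pack_fields fields ;; Asg 5 (Plus (V 5) (K 1))"
  define I where "I v \<tau> \<longleftrightarrow> reg \<tau> 5 = v \<and> v \<le> q + 1 \<and> reg \<tau> 6 = 10 * v \<and> reg \<tau> 4 = q \<and> reg \<tau> 3 = k \<and> reg \<tau> 1 = m \<and>
     nmem \<tau> = nmem \<sigma> \<and> (\<forall>a. a \<noteq> 1 \<longrightarrow> wmem \<tau> a = ?W a) \<and>
     (\<forall>u<v. \<forall>f<10. wmem \<tau> 1 (10 * u + f) = ?W (fields ! f) u)" for v and \<tau> :: state
  have lf: "length fields = 10" "1 \<notin> set fields" by (simp_all add: fields_def)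
  have "wp B (Whl (V 5) (Plus (V 4) (K 1)) ?body) (\<lambda>t \<tau>. t \<le> 100 * (q + 1) + 10 \<and> I (q + 1) \<tau>) ?\<tau>"
  proof (rule wp_Whl_ghost[where I = I and ?g0.0 = 0 and \<Phi> = "\<lambda>v. 100 * (q + 1 - v)"], goal_cases)
    case 1
    then show ?case using r by (simp add: I_def)
  next
    case (2 v \<tau>)
    then show ?case using B by (simp add: I_def)
  next
    case (3 v \<tau>)
    then have inv: "I v \<tau>" and v: "v \<le> q" by (simp_all add: I_def)
    have "wp B (pack_fields fields) (\<lambda>t \<tau>'. t \<le> 8 * length fields + 1 \<and> reg \<tau>' 6 = 10 * v + length fields \<and>
      (\<forall>y<10 * v. wmem \<tau>' 1 y = wmem \<tau> 1 y) \<and> (\<forall>i<length fields. wmem \<tau>' 1 (10 * v + i) = wmem \<tau> (fields ! i) v)) \<tau>"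
      by (rule pack_fields_correct) (use inv v B lf in \<open>simp_all add: I_def\<close>)
    note pf = this
    show ?case
    proof (rule wp_Sq[OF pf], goal_cases)
      case (1 t \<tau>1)
      note w = pack_fields_sets[of fields]
      have narrs: "narrs (pack_fields as) = {}" for as by (induction as) auto
      have f: "\<And>r. r \<noteq> 6 \<Longrightarrow> reg \<tau>1 r = reg \<tau> r" "\<And>a. a \<noteq> 1 \<Longrightarrow> wmem \<tau>1 a = wmem \<tau> a" "nmem \<tau>1 = nmem \<tau>"
        using 1(2) w narrs by (auto simp: frame_def fun_eq_iff)
      have mem: "wmem \<tau>1 1 (10 * u + f) = ?W (fields ! f) u" if "u < v + 1" "f < 10" for u f
      proof (cases "u = v")
        case True
        have "fields ! f \<noteq> 1" using lf nth_mem[of f fields] that(2) by metis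
        then show ?thesis using 1(1) lf True that inv by (simp add: I_def del: fun_upd_apply)
      next
        case False
        then have "10 * u + f < 10 * v" "u < v" using that by auto
        then show ?thesis using 1(1) inv that by (simp add: I_def del: fun_upd_apply)
      qed
      have "I (v + 1) (set_reg 5 (v + 1) \<tau>1)"
        using f mem 1(1) inv v lf by (simp add: I_def del: fun_upd_apply) (simp add: fun_upd_apply)
      moreover have "100 * (q + 1 - v) = 100 * (q + 1 - (v + 1)) + 100" using v by simp
      ultimately show ?case using 1(1) f(1)[of 5] inv v B lf
        by (simp add: I_def[of v]) (intro exI[of _ "Suc v"], simp)
    qed
  next
    case (4 v \<tau> t)
    then have "v = q + 1" by (simp add: I_def)
    then show ?case using 4 by simp
  qed
  note loop = this
  show ?thesis unfolding pack_prog_def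
    using B r(4) by (simp add: r(1-3)[unfolded One_nat_def], intro wp_mono[OF loop[unfolded One_nat_def]])
      (auto simp: I_def)
qed

text \<open>Register 2 holds the position, 3 the current tree node, 4 the reference value
  \<open>Ls\<close>, 5 the address of the record, 6 the position relative to the current node, and 7
  is 0 once the answer has been written.\<close>

definition query_body :: stm where
  "query_body = Asg 5 (Times (K 10) (V 3)) ;; Asg 6 (Plus (V 2) (A 0 (Plus (V 5) (K 1)))) ;;
     IfL (V 6) (V 4) (Asg 3 (A 0 (Plus (V 5) (K 2))))
       (Asg 6 (Minus (V 6) (V 4)) ;;
        IfL (V 6) (A 0 (V 5))
          (IfL (V 6) (A 0 (Plus (V 5) (K 3)))
             (Asg 2 (V 6) ;; Asg 4 (A 0 (Plus (V 5) (K 7))) ;; Asg 3 (A 0 (Plus (V 5) (K 6))))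
             (IfL (V 6) (A 0 (Plus (V 5) (K 4)))
                (NCp 1 (K 0) 0 (Minus (Plus (A 0 (Plus (V 5) (K 5))) (V 6)) (A 0 (Plus (V 5) (K 3)))) ;; Asg 7 (K 0))
                (Asg 2 (Minus (V 6) (A 0 (Plus (V 5) (K 4)))) ;; Asg 4 (A 0 (Plus (V 5) (K 9))) ;;
                 Asg 3 (A 0 (Plus (V 5) (K 8))))))
          (Asg 3 (A 0 (Plus (V 5) (K 2)))))"

definition query_prog :: stm where
  "query_prog = Asg 2 (Minus (V 0) (K 1)) ;; Asg 3 (A 0 (K 6)) ;; Asg 4 (A 0 (K 7)) ;; Asg 7 (K 1) ;;
     Whl (K 0) (V 7) query_body ;; Asg 0 (K 0) ;; Asg 1 (K 1)"

locale query_machine = search_structure +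
  fixes B Mx :: nat and W :: "nat \<Rightarrow> nat"
  assumes B: "100 * Mx + 100 \<le> B" and q_le: "q \<le> Mx" and g_le: "i \<in> {1..q} \<Longrightarrow> g i \<le> Mx"
    and Ls_less: "i \<in> {1..q} \<Longrightarrow> Ls i < g i"
    and bs_le: "i \<in> {1..q} \<Longrightarrow> g (L i) \<le> y \<Longrightarrow> y < M i \<Longrightarrow> bs i + (y - g (L i)) \<le> Mx"
    and W_start: "W 6 = rt q" "W 7 = Ls q"
    and W: "i \<in> {1..q} \<Longrightarrow> W (10 * i) = g i \<and> W (10 * i + 1) = Ls i \<and> W (10 * i + 2) = sh i \<and>
      W (10 * i + 3) = g (L i) \<and> W (10 * i + 4) = M i \<and> W (10 * i + 5) = bs i \<and>
      W (10 * i + 6) = (if nxt i \<noteq> 0 \<and> nxt i = L i then ch i else rt (L i)) \<and> W (10 * i + 7) = Ls (L i) \<and>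
      W (10 * i + 8) = (if nxt i \<noteq> 0 \<and> nxt i = R i then ch i else rt (R i)) \<and> W (10 * i + 9) = Ls (R i)"
begin

text \<open>A state of the search is a current node of the tree, a position in the sequence of a node on the same path, and
  the value \<open>Ls\<close> of that node; the exit node \<open>e\<close> of the position is known to the verification only.\<close>

definition searching :: "int \<Rightarrow> nat \<Rightarrow> nat \<Rightarrow> state \<Rightarrow> bool" where
  "searching a t e \<sigma> \<longleftrightarrow> reg \<sigma> 3 = t \<and> reg \<sigma> 7 = 1 \<and> qinv a t (reg \<sigma> 2) (reg \<sigma> 4) e \<and> reg \<sigma> 2 \<le> Mx \<and> reg \<sigma> 4 \<le> Mx \<and>
     wmem \<sigma> 0 = W \<and> nmem \<sigma> 0 = ct"

lemma query_body_correct: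
  assumes s: "searching a t e \<sigma>"
  shows "wp B query_body (\<lambda>k \<tau>. k \<le> 100 \<and> ((reg \<tau> 7 = 0 \<and> nmem \<tau> 1 0 = a) \<or>
     (\<exists>t' e'. searching a t' e' \<tau> \<and> qpot t' e' < qpot t e))) \<sigma>"
proof -
  define y lv where "y = reg \<sigma> 2" and "lv = reg \<sigma> 4"
  have r: "reg \<sigma> 3 = t" "reg \<sigma> 7 = 1" "reg \<sigma> 2 = y" "reg \<sigma> 4 = lv" "wmem \<sigma> 0 = W" "nmem \<sigma> 0 = ct"
    and inv: "qinv a t y lv e" and le: "y \<le> Mx" "lv \<le> Mx"
    using s by (simp_all add: searching_def y_def lv_def)
  have t: "t \<in> {1..q}" using inv by (simp add: qinv_def)
  note w = W[OF t]
  have w0: "W (10 * t) = g t" "W (Suc (10 * t)) = Ls t" "W (Suc (Suc (10 * t))) = sh t" "W (10 * t + 3) = g (L t)"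
    "W (10 * t + 4) = M t" "W (10 * t + 5) = bs t" "W (10 * t + 7) = Ls (L t)" "W (10 * t + 9) = Ls (R t)"
    using w by simp_all
  have Lsg: "Ls t < g t" "g t \<le> Mx" using Ls_less[OF t] g_le[OF t] by auto
  have bnd: "10 * t + 9 < B" "y + Ls t < B" "y + Ls t - lv < B" "y < B" "lv < B" "t < B" "10 < B" using t q_le B le Lsg by auto
  have bnds: "10 * t < B" "Suc (10 * t) < B" "10 * t + 2 < B" "10 * t + 3 < B" "10 * t + 4 < B" "10 * t + 5 < B"
    "10 * t + 6 < B" "10 * t + 7 < B" "10 * t + 8 < B" "Suc 0 < B" "0 < B" "2 < B" "3 < B" "4 < B" "5 < B" "6 < B" "7 < B" "8 < B" "9 < B"
    using bnd by linarith+
  have sgo: "searching a t' e' \<tau>" if "reg \<tau> 3 = t'" "reg \<tau> 7 = 1" "reg \<tau> 2 = y'" "reg \<tau> 4 = lv'"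
      "qinv a t' y' lv' e'" "y' \<le> Mx" "lv' \<le> Mx" "wmem \<tau> 0 = W" "nmem \<tau> 0 = ct" for t' e' \<tau> y' lv'
    using that by (simp add: searching_def)
  show ?thesis
  proof (cases "lv \<le> y + Ls t \<and> y + Ls t - lv < g t")
    case False
    have o: "qinv a (sh t) y lv e" "qpot (sh t) e < qpot t e" using q_out[OF inv False] by auto
    have go: "\<exists>t' e'. searching a t' e' \<tau> \<and> qpot t' e' < qpot t e"
      if "reg \<tau> 3 = sh t" "reg \<tau> 7 = 1" "reg \<tau> 2 = y" "reg \<tau> 4 = lv" "wmem \<tau> 0 = W" "nmem \<tau> 0 = ct" for \<tau>
      using sgo[OF that(1-4) o(1) le that(5,6)] o(2) by blast
    show ?thesis using False bnd bnds
      by (cases "y + Ls t < lv") (simp_all add: query_body_def r w0 go)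
  next
    case True
    define Y where "Y = y + Ls t - lv"
    have Y: "Y < g t" "lv \<le> y + Ls t" "\<not> y + Ls t < lv" "Y < B" using True Lsg B by (auto simp: Y_def)
    have i: "y + Ls t - lv < g t" using True by simp
    consider "Y < g (L t)" | "g (L t) \<le> Y" "Y < M t" | "g (L t) \<le> Y" "M t \<le> Y" by linarith
    then show ?thesis
    proof cases
      case 1
      then have "L t \<noteq> 0" using g_0 by (cases "L t = 0") auto
      then have L0: "L t \<noteq> 0" "L t \<in> {1..q}" using L_less[OF t] t by auto
      have w6: "W (10 * t + 6) = (if nxt t = L t then ch t else rt (L t))" using w L0 by auto
      obtain e' where e': "qinv a (W (10 * t + 6)) Y (Ls (L t)) e'" "qpot (W (10 * t + 6)) e' < qpot t e"
        using q_child[OF inv Y(2) i, of "L t" 0 Y] 1 unfolding w6 by (auto simp: Y_def)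
      have le': "Y \<le> Mx" "Ls (L t) \<le> Mx" using 1 g_le[OF L0(2)] Ls_less[OF L0(2)] by auto
      have go: "\<exists>t' e'. searching a t' e' \<tau> \<and> qpot t' e' < qpot t e"
        if "reg \<tau> 3 = W (10 * t + 6)" "reg \<tau> 7 = 1" "reg \<tau> 2 = Y" "reg \<tau> 4 = Ls (L t)" "wmem \<tau> 0 = W" "nmem \<tau> 0 = ct" for \<tau>
        using sgo[OF that(1-4) e'(1) le' that(5,6)] e'(2) by blast
      show ?thesis using 1 Y bnd bnds
        by (simp add: query_body_def r w0 Y_def[symmetric] go)
    next
      case 2
      have e: "bs t + Y - g (L t) = bs t + (Y - g (L t))" using 2 by linarith
      have a: "a = ct (bs t + Y - g (L t))"
        unfolding e using q_hit[OF inv Y(2) i] 2 unfolding Y_def by blast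
      have "bs t + (Y - g (L t)) \<le> Mx" by (rule bs_le[OF t 2])
      then have b: "bs t + Y < B" "g (L t) \<le> bs t + Y" using 2 Lsg(2) gL_less[OF t] B by linarith+
      show ?thesis using 2 Y bnd bnds b
        by (simp add: query_body_def r w0 Y_def[symmetric] a)
    next
      case 3
      define y' where "y' = Y - M t"
      have y': "y' < g (R t)" "Y = M t + y'" using 3 Y(1) gR[OF t] by (auto simp: y'_def)
      then have "R t \<noteq> 0" using g_0 by (cases "R t = 0") auto
      then have R0: "R t \<noteq> 0" "R t \<in> {1..q}" using R_less[OF t] t by auto
      have w8: "W (10 * t + 8) = (if nxt t = R t then ch t else rt (R t))" using w R0 by auto
      obtain e' where e': "qinv a (W (10 * t + 8)) y' (Ls (R t)) e'" "qpot (W (10 * t + 8)) e' < qpot t e"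
        using q_child[OF inv Y(2) i, of "R t" "M t" y'] y' unfolding w8 by (auto simp: Y_def)
      have le': "y' \<le> Mx" "Ls (R t) \<le> Mx" using y' g_le[OF R0(2)] Ls_less[OF R0(2)] by auto
      have go: "\<exists>t' e'. searching a t' e' \<tau> \<and> qpot t' e' < qpot t e"
        if "reg \<tau> 3 = W (10 * t + 8)" "reg \<tau> 7 = 1" "reg \<tau> 2 = y'" "reg \<tau> 4 = Ls (R t)" "wmem \<tau> 0 = W" "nmem \<tau> 0 = ct" for \<tau>
        using sgo[OF that(1-4) e'(1) le' that(5,6)] e'(2) by blast
      show ?thesis using 3 Y bnd bnds
        by (simp add: query_body_def r w0 Y_def[symmetric] y'_def[symmetric] go)
    qed
  qed
qed

lemma query_prog_correct:
  assumes r: "reg \<sigma> 0 = Suc y" "y < g q" and m: "wmem \<sigma> 0 = W" "nmem \<sigma> 0 = ct"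
  shows "wp B query_prog (\<lambda>t \<tau>. t \<le> 330 * bl (g q) + 130 \<and> reg \<tau> 0 = 0 \<and> reg \<tau> 1 = 1 \<and> nmem \<tau> 1 0 = ans q y) \<sigma>"
proof -
  have qq: "q \<in> {1..q}" using q1 by simp
  have b: "g q \<le> Mx" "Ls q < g q" using g_le[OF qq] Ls_less[OF qq] by auto
  have bnd: "Suc y < B" "Suc 0 < B" "0 < B" "6 < B" "7 < B" using r(2) b B by auto
  obtain e where e: "qinv (ans q y) (rt q) y (Ls q) e" "qpot (rt q) e \<le> 3 * bl (g q)" using qpot_start[OF r(2)] by blast
  \<comment> \<open>The ghost value \<open>None\<close> means that the answer has been found. A
    running search carries its exit node, which the machine does not know.\<close>
  define I where "I x \<tau> \<longleftrightarrow> (case x of None \<Rightarrow> reg \<tau> 7 = 0 \<and> nmem \<tau> 1 0 = ans q y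
     | Some (t, e) \<Rightarrow> searching (ans q y) t e \<tau>)" for x :: "(nat \<times> nat) option" and \<tau> :: state
  define \<Phi> where "\<Phi> x = (case x of None \<Rightarrow> 0 | Some (t, e) \<Rightarrow> 110 * qpot t e + 110)" for x :: "(nat \<times> nat) option"
  let ?\<tau> = "set_reg 7 1 (set_reg 4 (Ls q) (set_reg 3 (rt q) (set_reg 2 y \<sigma>)))"
  have "wp B (Whl (K 0) (V 7) query_body) (\<lambda>t \<tau>. t \<le> 330 * bl (g q) + 120 \<and> nmem \<tau> 1 0 = ans q y) ?\<tau>"
  proof (rule wp_Whl_ghost[where I = I and ?g0.0 = "Some (rt q, e)" and \<Phi> = \<Phi>], goal_cases)
    case 1
    then show ?case using e(1) m b r(2) by (simp add: I_def searching_def)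
  next
    case (2 x \<tau>)
    then show ?case using bnd by (auto simp: I_def searching_def split: option.splits)
  next
    case (3 x \<tau>)
    then obtain t e where x: "x = Some (t, e)" and s: "searching (ans q y) t e \<tau>" by (auto simp: I_def split: option.splits)
    show ?case
    proof (rule wp_mono[OF query_body_correct[OF s]], goal_cases)
      case (1 k \<tau>')
      show ?case
      proof (cases "reg \<tau>' 7 = 0 \<and> nmem \<tau>' 1 0 = ans q y")
        case True
        then show ?thesis using 1 by (intro exI[of _ None]) (simp add: I_def \<Phi>_def x)
      next
        case False
        then obtain t' e' where t': "searching (ans q y) t' e' \<tau>'" "qpot t' e' < qpot t e" using 1 by blast
        then show ?thesis using 1 by (intro exI[of _ "Some (t', e')"]) (simp add: I_def \<Phi>_def x)
      qed
    qed
  next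
    case (4 x \<tau> t)
    then have "x = None" by (auto simp: I_def searching_def split: option.splits)
    then show ?case using 4 e(2) by (simp add: I_def \<Phi>_def)
  qed
  note loop = this
  show ?thesis unfolding query_prog_def
    using bnd r(1) by (simp add: m(1) W_start, intro wp_mono[OF loop[unfolded One_nat_def]]) auto
qed

end

section \<open>The representation of the convolution\<close>

definition build_prog :: stm where
  "build_prog = dfs_prog ;; Cnv 1 (K 0) 2 (K 0) (V 3) 0 (V 0) (V 1) ;; occ_prog ;; tree_prog ;; pack_prog"

context slp_pattern
begin

lemma vis_root: "vis_post n dstate0 (vis G m n dstate0)"
  by (rule vis_correct) (use n1 in \<open>simp_all add: dinv_def dstate0_def\<close>)

text \<open>A number is assigned as the last action of the first visit. Hence the root receives the
  largest number.\<close>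

lemma vid_vis:
  assumes "v \<in> {1..n}" "vlen s v = 0" "m \<le> vlen (vis G m v s) v"
  shows "vid (vis G m v s) v = nid (vis G m v s)"
proof -
  have reg: "vid (regi m v l r s') v = nid (regi m v l r s')" if "m \<le> vlen (regi m v l r s') v" for l r s'
    using that by (simp add: regi_def split: if_splits)
  show ?thesis
  proof (cases "rhs_of G v")
    case (Char a)
    then have "vis G m v s = chr m v a s" using assms(2) by (subst vis.simps) simp
    then show ?thesis using assms(3) reg unfolding chr_def by metis
  next
    case (Pair l r)
    note rng = Pair_range[OF Pair assms(1)]
    have "vis G m v s = fin G m v l r (vis G m r (mdl v (vis G m l (opn v s))))"
      using Pair rng assms(2) by (subst vis.simps) simp
    then show ?thesis using assms(3) reg unfolding fin_def by metis
  qed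
qed

lemma vis_root_bounds:
  defines "F \<equiv> vis G m n dstate0"
  shows "clk F + 3 \<le> 4 * length (tx F)" "nid F \<le> clk F" "length (tx F) \<le> 2 * m * length (val G n)"
    "length (tx F) \<le> 10 * (n * m)"
    "2 \<le> m \<Longrightarrow> length (tx F) \<le> 4 * (\<Sum>j=1..n. wd j) + 2 * m"
proof -
  have s0: "seen dstate0 = {}" "ws dstate0 = 0" "tx dstate0 = []" "clk dstate0 = 0" "nid dstate0 = 0"
    by (simp_all add: seen_def ws_def dstate0_def)
  have b: "vis_bounds n dstate0 F" using vis_root by (simp add: vis_post_def F_def)
  show "clk F + 3 \<le> 4 * length (tx F)" "nid F \<le> clk F" "length (tx F) \<le> 2 * m * length (val G n)"
    using b unfolding vis_bounds_def s0 by simp_all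
  \<comment> \<open>There are at most \<open>4 * n + 1\<close> steps, and each emits at most
    \<open>2 * m\<close> characters.\<close>
  have "card (seen F) \<le> card {1..n}" by (rule card_mono) (auto simp: seen_def)
  then have "clk F \<le> 4 * n + 1" using b unfolding vis_bounds_def s0 by simp
  also have "\<dots> \<le> 5 * n" using n1 by simp
  finally have "clk F \<le> 5 * n" .
  have "length (tx F) \<le> 2 * m * clk F" using b unfolding vis_bounds_def s0 by simp
  also have "\<dots> \<le> 2 * m * (5 * n)" using \<open>clk F \<le> 5 * n\<close> by (rule mult_le_mono2)
  finally show "length (tx F) \<le> 10 * (n * m)" by (simp add: algebra_simps)
  have "ws F \<le> (\<Sum>j=1..n. wd j)" unfolding ws_def by (rule sum_mono2) (auto simp: seen_def)
  moreover assume "2 \<le> m"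
  ultimately show "length (tx F) \<le> 4 * (\<Sum>j=1..n. wd j) + 2 * m"
    using b unfolding vis_bounds_def s0 by (auto split: if_splits)
qed

lemma text_size:
  assumes "m \<le> length (val G n)"
  shows "int (length (tx (vis G m n dstate0))) \<le> 10 * min (int n * int m) (int (length (val G n)) - alpha G m)"
proof -
  let ?F = "vis G m n dstate0"
  note b = vis_root_bounds
  have "int (length (tx ?F)) \<le> 10 * (int (length (val G n)) - alpha G m)"
  proof (cases "m = 1")
    case True
    \<comment> \<open>For \<open>m = 1\<close> the crude bound \<open>2 * m * N\<close> is already
      linear in \<open>N\<close>, which equals \<open>N\<close> minus \<alpha>.\<close>
    then show ?thesis using b(3) N_minus_alpha[OF assms] by simp
  next
    case False
    then have "2 \<le> m" using m1 by simp
    define S where "S = (\<Sum>j=1..n. wd j)"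
    have "length (tx ?F) \<le> 4 * S + 2 * m" using b(5)[OF \<open>2 \<le> m\<close>] by (simp add: S_def)
    then have "length (tx ?F) + 10 \<le> 10 * m + 10 * S" using \<open>2 \<le> m\<close> by linarith
    then have "int (length (tx ?F) + 10) \<le> int (10 * m + 10 * S)" by (rule of_nat_mono)
    then have "int (length (tx ?F)) \<le> 10 * (int m - 1 + int S)" by simp
    moreover have "int (length (val G n)) - alpha G m = int m - 1 + int S"
      unfolding S_def using N_minus_alpha[OF assms] False by (simp only: if_False)
    ultimately show ?thesis by simp
  qed
  moreover have "int (length (tx ?F)) \<le> 10 * (int n * int m)" using b(4)
    by (metis of_nat_le_iff of_nat_mult of_nat_numeral)
  ultimately show ?thesis by (simp add: min_def)
qed

end

section \<open>From the finished tables to the query structure\<close>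

context bounded_machine
begin

lemma F_props:
  shows "dinv F" "frag (tx F) (val G n)" "vlen F n = length (val G n)"
  using vis_root unfolding F[symmetric] by (auto simp: vis_post_def dstate0_def)

context
  assumes mN: "m \<le> length (val G n)"
begin

lemma root: "vid F n = nid F" "1 \<le> nid F" "tV F (nid F) = n" "tG F (nid F) = length (val G n) + 1 - m" "m \<le> length (tx F)"
proof -
  have n: "n \<in> {1..n}" using n1 by simp
  show r: "vid F n = nid F" unfolding F by (rule vid_vis[OF n]) (use mN F_props(3) in \<open>simp_all add: F dstate0_def\<close>)
  have nz: "vlen F n \<noteq> 0" using F_props(3) val_nonempty[OF n] by simp
  then have v: "var_inv F n" using F_props(1) n by (simp add: dinv_def)
  then show "1 \<le> nid F" "tV F (nid F) = n" using mN r by (auto simp: var_inv_def)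
  show "tG F (nid F) = length (val G n) + 1 - m" using vid_window_count(2)[OF F_props(1) n nz] r by simp
  show "m \<le> length (tx F)" using F_props(2) mN by (simp add: frag_def)
qed

lemma tab: "i \<in> {1..nid F} \<Longrightarrow> tab_inv F i"
  using F_props(1) by (simp add: dinv_def)

lemma machine: "machine_grammar (nid F) (tL F) (tR F) (tG F) (tM F) B Mx"
proof
  show "tG F 0 = 0" using F_props(1) by (simp add: dinv_def)
  show "nid F \<le> Mx" "100 * Mx + 100 \<le> B" by (rule big)+
  show "1 \<le> nid F" by (rule root)
  fix i assume "i \<in> {1..nid F}"
  note t = tab[OF this, unfolded tab_inv_def]
  show "tL F i < i" "tR F i < i" "1 \<le> tG F i" "tG F (tL F i) \<le> tM F i" "tM F i + tG F (tR F i) = tG F i"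
    "tG F (tL F i) < tG F i" "tG F (tR F i) < tG F i"
    using t by simp_all
  show "tG F i \<le> Mx" using t big m1 by linarith
qed

definition answering :: "(nat \<Rightarrow> nat) \<Rightarrow> (nat \<Rightarrow> int) \<Rightarrow> bool" where
  "answering W ct \<longleftrightarrow> (\<exists>oc sh rt ch ng Ls. query_machine (nid F) (tL F) (tR F) (tG F) (tM F) oc sh rt ch ng Ls (tB F)
     (\<lambda>i y. conv (val G (tV F i)) P (Suc y)) ct B Mx W)"

lemma answeringI:
  assumes bg: "block_grammar (nid F) (tL F) (tR F) (tG F) (tM F) oc"
    and oc: "oc (nid F) = 1" "\<And>i. i \<in> {1..nid F} \<Longrightarrow> oc i \<le> tG F (nid F)"
    and mp: "machine_paths (nid F) (tL F) (tR F) (tG F) (tM F) B Mx oc"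
    and tinv: "machine_paths.tinv (nid F) (tL F) (tR F) (tG F) (tM F) B oc (nid F) c \<sigma>"
    and bs: "wmem \<sigma> 12 = tB F"
    and W: "\<And>v f. v \<le> nid F \<Longrightarrow> f < 10 \<Longrightarrow> W (10 * v + f) =
      ((wmem \<sigma>)(21 := (wmem \<sigma> 21)(0 := wmem \<sigma> 19 (nid F)), 22 := (wmem \<sigma> 22)(0 := wmem \<sigma> 20 (nid F)))) (fields ! f) v"
    and ct: "\<And>k. k + m \<le> length (tx F) \<Longrightarrow> ct k = conv (tx F) P (Suc k)"
  shows "answering W ct"
proof -
  interpret machine_paths "nid F" "tL F" "tR F" "tG F" "tM F" B Mx oc by (rule mp)
  have mem: "wmem \<sigma> 8 = tG F" "wmem \<sigma> 11 = tM F" and sh: "sh_inv (nid F) (wmem \<sigma> 18)"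
    using tinv by (simp_all add: tinv_def tables2_def tables_def)
  have nodes: "node_ok (wmem \<sigma> 15) (wmem \<sigma> 16) (wmem \<sigma> 19) (wmem \<sigma> 20) (wmem \<sigma> 21) (wmem \<sigma> 22)
        (wmem \<sigma> 23) (wmem \<sigma> 24) (wmem \<sigma> 25) c i" if "i \<in> {1..nid F}" for i
    using tinv that by (simp add: tinv_def nodes_ok_def)
  note nd = nodes[unfolded node_ok_def]
  have "query_machine (nid F) (tL F) (tR F) (tG F) (tM F) oc (wmem \<sigma> 18) (wmem \<sigma> 19) c (wmem \<sigma> 16) (wmem \<sigma> 20) (tB F)
     (\<lambda>i y. conv (val G (tV F i)) P (Suc y)) ct B Mx W"
  proof
    show "1 \<le> nid F" by (rule root)
    show "oc (nid F) = 1" by (rule oc)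
    show "100 * Mx + 100 \<le> B" "nid F \<le> Mx" by (rule big)+
    have "W (10 * 0 + 6) = wmem \<sigma> 19 (nid F)" "W (10 * 0 + 7) = wmem \<sigma> 20 (nid F)"
      by (subst W; simp add: fields_def)+
    then show "W 6 = wmem \<sigma> 19 (nid F)" "W 7 = wmem \<sigma> 20 (nid F)" by simp_all
    fix i assume i: "i \<in> {1..nid F}"
    note n = nd[OF i] and t = tab[OF i, unfolded tab_inv_def]
    show "oc i \<le> tG F (nid F)" by (rule oc(2)[OF i])
    show "ng_ok i (wmem \<sigma> 16 i)" "is_top (between i (wmem \<sigma> 16 i)) (c i)" "rt_ok i (wmem \<sigma> 19 i)" "wmem \<sigma> 20 i < tG F i"
      using n by blast+
    show "is_top (above (nid F) i) (wmem \<sigma> 18 i)" using sh i by (simp add: sh_inv_def)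
    show "wmem \<sigma> 20 i = (if nxt i = tL F i then 0 else tM F i) + wmem \<sigma> 20 (nxt i)" if "nxt i \<noteq> 0"
    proof -
      have "wmem \<sigma> 20 i = off (wmem \<sigma> 20) i" using n by blast
      then show ?thesis using that by (simp add: off_def)
    qed
    show "tG F i \<le> Mx" by (rule g_le[OF i])
    have Wi: "W (10 * i + f) = wmem \<sigma> (fields ! f) i" if "f < 10" for f using W[of i f] that i by auto
    have W0: "W (10 * i) = wmem \<sigma> (fields ! 0) i" using Wi[of 0] by simp
    show "W (10 * i) = tG F i \<and> W (10 * i + 1) = wmem \<sigma> 20 i \<and> W (10 * i + 2) = wmem \<sigma> 18 i \<and>
      W (10 * i + 3) = tG F (tL F i) \<and> W (10 * i + 4) = tM F i \<and> W (10 * i + 5) = tB F i \<and>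
      W (10 * i + 6) = (if nxt i \<noteq> 0 \<and> nxt i = tL F i then c i else wmem \<sigma> 19 (tL F i)) \<and>
      W (10 * i + 7) = wmem \<sigma> 20 (tL F i) \<and>
      W (10 * i + 8) = (if nxt i \<noteq> 0 \<and> nxt i = tR F i then c i else wmem \<sigma> 19 (tR F i)) \<and>
      W (10 * i + 9) = wmem \<sigma> 20 (tR F i)"
      unfolding W0 Wi[of 1, simplified] Wi[of 2, simplified] Wi[of 3, simplified] Wi[of 4, simplified] Wi[of 5, simplified]
        Wi[of 6, simplified] Wi[of 7, simplified] Wi[of 8, simplified] Wi[of 9, simplified]
      using n Wi[of 1] Wi[of 2] by (simp add: fields_def mem bs)
    fix y
    show "conv (val G (tV F i)) P (Suc y) = conv (val G (tV F (tL F i))) P (Suc y)" if "y < tG F (tL F i)"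
      using t that by blast
    show "conv (val G (tV F i)) P (Suc (tM F i + y)) = conv (val G (tV F (tR F i))) P (Suc y)" if "y < tG F (tR F i)"
      using t that by blast
    show "conv (val G (tV F i)) P (Suc y) = ct (tB F i + (y - tG F (tL F i)))" if "tG F (tL F i) \<le> y" "y < tM F i"
      using t that ct[of "tB F i + (y - tG F (tL F i))"] by simp
    show "tB F i + (y - tG F (tL F i)) \<le> Mx" if "tG F (tL F i) \<le> y" "y < tM F i"
    proof -
      have "tB F i + (y - tG F (tL F i)) + m \<le> length (tx F)" using t that by blast
      then show ?thesis using big(1) by linarith
    qed
  qed
  then show ?thesis unfolding answering_def by blast
qed

lemma machine_pathsI:
  assumes "grammar_shape.occ_inv (nid F) (tL F) (tR F) (tG F) 0 oc"
  shows "block_grammar (nid F) (tL F) (tR F) (tG F) (tM F) oc" "oc (nid F) = 1"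
    "\<And>i. i \<in> {1..nid F} \<Longrightarrow> oc i \<le> tG F (nid F)" "machine_paths (nid F) (tL F) (tR F) (tG F) (tM F) B Mx oc"
proof -
  interpret mg: machine_grammar "nid F" "tL F" "tR F" "tG F" "tM F" B Mx by (rule machine)
  show bg: "block_grammar (nid F) (tL F) (tR F) (tG F) (tM F) oc" and "oc (nid F) = 1"
    and le: "\<And>i. i \<in> {1..nid F} \<Longrightarrow> oc i \<le> tG F (nid F)"
    using mg.occ_final[OF assms] by blast+
  show "machine_paths (nid F) (tL F) (tR F) (tG F) (tM F) B Mx oc"
  proof (intro machine_paths.intro machine machine_paths_axioms.intro)
    show "block_grammar (nid F) (tL F) (tR F) (tG F) (tM F) oc" by (rule bg)
    show "oc 0 = 0" using assms by (simp add: mg.occ_inv_def)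
    fix i assume "i \<in> {1..nid F}"
    then have "oc i \<le> tG F (nid F)" by (rule le)
    also have "\<dots> \<le> Mx" using mg.g_le[of "nid F"] root(2) by simp
    finally show "oc i \<le> Mx" .
  qed
qed

lemma dfs_prog_sets:
  "wregs dfs_prog \<subseteq> {2..7}" "warrs dfs_prog \<subseteq> {2..12}" "narrs dfs_prog \<subseteq> {2}"
  by (auto simp: dfs_prog_def dfs_body_def fin_prog_def mdl_prog_def rpt_prog_def new_prog_def opn_prog_def chr_prog_def
      children_prog_def regi_prog_def push_def push2_def)

lemma occ_prog_sets: "wregs occ_prog = {5, 6, 7}" "warrs occ_prog = {13}" "narrs occ_prog = {}"
  by (auto simp: occ_prog_def occ_body_def)

lemma tree_prog_sets: "wregs tree_prog = {5..12}" "warrs tree_prog = {15, 16} \<union> {18..25}" "narrs tree_prog = {}"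
  by (auto simp: tree_prog_def tree_body_def path_prog_def path_test_def pop_prog_def link_prog_def)

text \<open>The last conjunct ranges over all arrays that agree with the output, because a query
  starts in a fresh memory in which only the output cells are prescribed.\<close>

lemma build_prog_correct:
  assumes d: "drepr \<sigma> dstate0" and pat: "\<And>j. j < m \<Longrightarrow> nmem \<sigma> 0 (n + j) = P ! j"
    and z: "wmem \<sigma> 13 = (\<lambda>_. 0)" "wmem \<sigma> 18 = (\<lambda>_. 0)"
  shows "wp B build_prog (\<lambda>t \<tau>. t \<le> 310 * clk F + length (tx F) + nat \<lceil>real (length (tx F)) * lg m\<rceil> + 460 * nid F + 220 \<and>
     reg \<tau> 0 = 10 * (nid F + 1) \<and> reg \<tau> 1 = length (tx F) - m + 1 \<and>
     (\<forall>k. k + m \<le> length (tx F) \<longrightarrow> nmem \<tau> 1 k = conv (tx F) P (Suc k)) \<and>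
     (\<forall>W ct. (\<forall>x<10 * (nid F + 1). W x = wmem \<tau> 1 x) \<longrightarrow>
        (\<forall>k. k + m \<le> length (tx F) \<longrightarrow> ct k = conv (tx F) P (Suc k)) \<longrightarrow> answering W ct)) \<sigma>"
  unfolding build_prog_def
proof (rule wp_Sq[OF dfs_prog_correct[OF d]])
  interpret mg: machine_grammar "nid F" "tL F" "tR F" "tG F" "tM F" B Mx by (rule machine)
  let ?T = "length (tx F)" and ?q = "nid F"
  fix t1 \<tau>1 assume 1: "t1 \<le> 310 * clk F + ?T + 20 \<and> drepr \<tau>1 F" and f1: "frame dfs_prog \<sigma> \<tau>1"
  have z1: "wmem \<tau>1 13 = (\<lambda>_. 0)" "wmem \<tau>1 18 = (\<lambda>_. 0)" "nmem \<tau>1 0 = nmem \<sigma> 0"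
  proof -
    have "wmem \<tau>1 a = wmem \<sigma> a" if "a \<notin> {2..12}" for a
      using f1 dfs_prog_sets(2) that unfolding frame_def by blast
    then show "wmem \<tau>1 13 = (\<lambda>_. 0)" "wmem \<tau>1 18 = (\<lambda>_. 0)" using z by simp_all
    have "0 \<notin> narrs dfs_prog" using dfs_prog_sets(3) by auto
    then show "nmem \<tau>1 0 = nmem \<sigma> 0" using f1 unfolding frame_def by blast
  qed
  note r1 = drepr_simps[OF conjunct2[OF 1]]
  have T1: "map (\<lambda>i. nmem \<tau>1 2 (0 + i)) [0..<?T] = tx F"
    using 1 by (intro nth_equalityI) (auto simp: drepr_def)
  have P1: "map (\<lambda>i. nmem \<tau>1 0 (n + i)) [0..<m] = P"
    using pat m_def z1(3) by (intro nth_equalityI) auto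
  have bnd: "n + m < B" "?T + 1 < B" "0 < B" "n < B" "m < B" "10 * ?q + 100 < B" using big root(2) by linarith+
  let ?c = "\<lambda>i. if 0 \<le> i \<and> i < 0 + (?T - m + 1) then conv (tx F) P (i - 0 + 1) else nmem \<tau>1 1 i"
  let ?\<tau>2 = "nset 1 ?c \<tau>1"
  have "wp B (Cnv 1 (K 0) 2 (K 0) (V 3) 0 (V 0) (V 1))
      (\<lambda>t \<tau>. t = 5 + nat \<lceil>real ?T * lg m\<rceil> \<and> \<tau> = ?\<tau>2) \<tau>1"
    unfolding wp.simps ev.simps ok.simps tm.simps r1(1,3) r1(2)[folded One_nat_def] T1 P1
    using bnd m1 root(5) by simp
  note cnv = this
  show "wp B (Cnv 1 (K 0) 2 (K 0) (V 3) 0 (V 0) (V 1) ;; occ_prog ;; tree_prog ;; pack_prog)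
    (\<lambda>t' \<tau>. t1 + t' \<le> 310 * clk F + ?T + nat \<lceil>real ?T * lg m\<rceil> + 460 * ?q + 220 \<and>
     reg \<tau> 0 = 10 * (?q + 1) \<and> reg \<tau> 1 = ?T - m + 1 \<and>
     (\<forall>k. k + m \<le> ?T \<longrightarrow> nmem \<tau> 1 k = conv (tx F) P (Suc k)) \<and>
     (\<forall>W ct. (\<forall>x<10 * (?q + 1). W x = wmem \<tau> 1 x) \<longrightarrow>
        (\<forall>k. k + m \<le> ?T \<longrightarrow> ct k = conv (tx F) P (Suc k)) \<longrightarrow> answering W ct)) \<tau>1"
  proof (rule wp_Sq[OF cnv])
    fix t2 \<tau>2 assume 2: "t2 = 5 + nat \<lceil>real ?T * lg m\<rceil> \<and> \<tau>2 = ?\<tau>2"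
    have r2: "reg \<tau>2 1 = m" "reg \<tau>2 3 = ?T" "reg \<tau>2 4 = ?q" and w2: "wmem \<tau>2 = wmem \<tau>1" and n2: "nmem \<tau>2 1 = ?c"
      using 2 r1 by simp_all
    have tab2: "mg.tables \<tau>2" using r2 w2 1 by (simp add: mg.tables_def drepr_def)
    show "wp B (occ_prog ;; tree_prog ;; pack_prog)
    (\<lambda>t' \<tau>. t1 + (t2 + t') \<le> 310 * clk F + ?T + nat \<lceil>real ?T * lg m\<rceil> + 460 * ?q + 220 \<and>
     reg \<tau> 0 = 10 * (?q + 1) \<and> reg \<tau> 1 = ?T - m + 1 \<and>
     (\<forall>k. k + m \<le> ?T \<longrightarrow> nmem \<tau> 1 k = conv (tx F) P (Suc k)) \<and>
     (\<forall>W ct. (\<forall>x<10 * (?q + 1). W x = wmem \<tau> 1 x) \<longrightarrow>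
        (\<forall>k. k + m \<le> ?T \<longrightarrow> ct k = conv (tx F) P (Suc k)) \<longrightarrow> answering W ct)) \<tau>2"
    proof (rule wp_Sq[OF mg.occ_prog_correct[OF tab2]])
      show "wmem \<tau>2 13 = (\<lambda>_. 0)" unfolding w2 by (rule z1)
      fix t3 \<tau>3 assume 3: "t3 \<le> 60 * ?q + 20 \<and> mg.tables \<tau>3 \<and> mg.occ_inv 0 (wmem \<tau>3 13)" and f3: "frame occ_prog \<tau>2 \<tau>3"
      define oc where "oc = wmem \<tau>3 13"
      have occ: "mg.occ_inv 0 oc" using 3 by (simp add: oc_def)
      note mp = machine_pathsI[OF occ]
      interpret mp: machine_paths ?q "tL F" "tR F" "tG F" "tM F" B Mx oc by (rule mp)
      have w3: "\<And>a. a \<noteq> 13 \<Longrightarrow> wmem \<tau>3 a = wmem \<tau>1 a" "reg \<tau>3 1 = m" "reg \<tau>3 3 = ?T" "reg \<tau>3 4 = ?q" "nmem \<tau>3 1 = ?c"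
        using f3 r2 w2 n2 unfolding frame_def occ_prog_sets by auto
      have tab3: "mp.tables2 \<tau>3" unfolding mp.tables2_def using 3 by (simp add: oc_def)
      show "wp B (tree_prog ;; pack_prog)
    (\<lambda>t' \<tau>. t1 + (t2 + (t3 + t')) \<le> 310 * clk F + ?T + nat \<lceil>real ?T * lg m\<rceil> + 460 * ?q + 220 \<and>
     reg \<tau> 0 = 10 * (?q + 1) \<and> reg \<tau> 1 = ?T - m + 1 \<and>
     (\<forall>k. k + m \<le> ?T \<longrightarrow> nmem \<tau> 1 k = conv (tx F) P (Suc k)) \<and>
     (\<forall>W ct. (\<forall>x<10 * (?q + 1). W x = wmem \<tau> 1 x) \<longrightarrow>
        (\<forall>k. k + m \<le> ?T \<longrightarrow> ct k = conv (tx F) P (Suc k)) \<longrightarrow> answering W ct)) \<tau>3"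
      proof (rule wp_Sq[OF mp.tree_prog_correct[OF tab3]])
        show "wmem \<tau>3 18 = (\<lambda>_. 0)" using w3(1)[of 18] z1 by simp
        fix t4 \<tau>4 assume 4: "t4 \<le> 300 * ?q + 20 \<and> (\<exists>c. mp.tinv ?q c \<tau>4)" and f4: "frame tree_prog \<tau>3 \<tau>4"
        then obtain c where c: "mp.tinv ?q c \<tau>4" by blast
        have w4: "wmem \<tau>4 12 = tB F" "reg \<tau>4 1 = m" "reg \<tau>4 3 = ?T" "reg \<tau>4 4 = ?q" "nmem \<tau>4 1 = ?c"
          using f4 w3 1 unfolding frame_def tree_prog_sets by (auto simp: drepr_def)
        have "wp B pack_prog (\<lambda>t \<tau>. t \<le> 100 * ?q + 150 \<and> reg \<tau> 0 = 10 * (?q + 1) \<and> reg \<tau> 1 = ?T - m + 1 \<and>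
            nmem \<tau> = nmem \<tau>4 \<and> (\<forall>v\<le>?q. \<forall>f<10. wmem \<tau> 1 (10 * v + f) =
            ((wmem \<tau>4)(21 := (wmem \<tau>4 21)(0 := wmem \<tau>4 19 ?q), 22 := (wmem \<tau>4 22)(0 := wmem \<tau>4 20 ?q))) (fields ! f) v)) \<tau>4"
          by (rule pack_prog_correct) (use w4 root(5) bnd in simp_all)
        note pack = this
        show "wp B pack_prog
    (\<lambda>t' \<tau>. t1 + (t2 + (t3 + (t4 + t'))) \<le> 310 * clk F + ?T + nat \<lceil>real ?T * lg m\<rceil> + 460 * ?q + 220 \<and>
     reg \<tau> 0 = 10 * (?q + 1) \<and> reg \<tau> 1 = ?T - m + 1 \<and>
     (\<forall>k. k + m \<le> ?T \<longrightarrow> nmem \<tau> 1 k = conv (tx F) P (Suc k)) \<and>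
     (\<forall>W ct. (\<forall>x<10 * (?q + 1). W x = wmem \<tau> 1 x) \<longrightarrow>
        (\<forall>k. k + m \<le> ?T \<longrightarrow> ct k = conv (tx F) P (Suc k)) \<longrightarrow> answering W ct)) \<tau>4"
        proof (rule wp_mono[OF pack], goal_cases)
          case (1 t5 \<tau>5)
          have "answering W ct" if W: "\<forall>x<10 * (?q + 1). W x = wmem \<tau>5 1 x"
            and ct: "\<forall>k. k + m \<le> ?T \<longrightarrow> ct k = conv (tx F) P (Suc k)" for W ct
          proof (rule answeringI[OF mp(1-4) c w4(1)])
            fix v f :: nat assume vf: "v \<le> ?q" "f < 10"
            then have "10 * v + f < 10 * (?q + 1)" by simp
            then show "W (10 * v + f) = ((wmem \<tau>4)(21 := (wmem \<tau>4 21)(0 := wmem \<tau>4 19 ?q), 22 := (wmem \<tau>4 22)(0 := wmem \<tau>4 20 ?q))) (fields ! f) v"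
              using W 1 vf by metis
          next
            fix k assume "k + m \<le> ?T"
            then show "ct k = conv (tx F) P (Suc k)" using ct by simp
          qed
          moreover have "nmem \<tau>5 1 k = conv (tx F) P (Suc k)" if "k + m \<le> ?T" for k
          proof -
            have "k < 0 + (?T - m + 1)" using that by linarith
            then show ?thesis using 1 w4(5) by simp
          qed
          moreover have "t1 + (t2 + (t3 + (t4 + t5))) \<le> 310 * clk F + ?T + nat \<lceil>real ?T * lg m\<rceil> + 460 * ?q + 220"
            using \<open>t1 \<le> _ \<and> _\<close> 2 3 4 1 by linarith
          ultimately show ?case using 1 by blast
        qed
      qed
    qed
  qed
qed

end

end

lemma concat_pairs:
  assumes "\<And>e. length (f e) = 2"
  shows "length (concat (map f xs)) = 2 * length xs"
    "i < length xs \<Longrightarrow> concat (map f xs) ! (2 * i) = f (xs ! i) ! 0 \<and> concat (map f xs) ! (2 * i + 1) = f (xs ! i) ! 1"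
proof -
  show len: "length (concat (map f xs)) = 2 * length xs" for xs by (induction xs) (simp_all add: assms)
  show "i < length xs \<Longrightarrow> concat (map f xs) ! (2 * i) = f (xs ! i) ! 0 \<and> concat (map f xs) ! (2 * i + 1) = f (xs ! i) ! 1"
  proof (induction xs arbitrary: i)
    case (Cons x xs)
    show ?case
    proof (cases i)
      case 0
      then show ?thesis by (simp add: nth_append assms)
    next
      case (Suc j)
      then show ?thesis using Cons by (simp add: nth_append assms)
    qed
  qed simp
qed

context bounded_machine
begin

lemma drepr_start: "drepr (start [n, m] (encode G P)) dstate0"
proof -
  let ?f = "\<lambda>e. case e of Char a \<Rightarrow> [0, 0] | Pair l r \<Rightarrow> [l, r]"
  have f: "length (?f e) = 2" for e by (cases e) auto
  note c = concat_pairs[of ?f, OF f]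
  have "input (wmem (start [n, m] (encode G P)) 0) (nmem (start [n, m] (encode G P)) 0)"
    unfolding input_def
  proof
    fix v assume v: "v \<in> {1..n}"
    then have i: "v - 1 < length G" "2 * (v - 1) < length (concat (map ?f G))" "2 * (v - 1) + 1 < length (concat (map ?f G))"
      unfolding c(1) n_def by auto
    have w: "wmem (start [n, m] (encode G P)) 0 (2 * (v - 1)) = ?f (rhs_of G v) ! 0"
      "wmem (start [n, m] (encode G P)) 0 (2 * (v - 1) + 1) = ?f (rhs_of G v) ! 1"
      using i c(2)[OF i(1)] by (simp_all add: start_def encode_def)
    have "nmem (start [n, m] (encode G P)) 0 (v - 1) = (case rhs_of G v of Char a \<Rightarrow> a | Pair l r \<Rightarrow> 0)"
      using i(1) by (simp add: start_def encode_def nth_append)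
    then show "case rhs_of G v of Char a \<Rightarrow> wmem (start [n, m] (encode G P)) 0 (2 * (v - 1)) = 0 \<and>
        wmem (start [n, m] (encode G P)) 0 (2 * (v - 1) + 1) = 0 \<and> nmem (start [n, m] (encode G P)) 0 (v - 1) = a
      | Pair l r \<Rightarrow> wmem (start [n, m] (encode G P)) 0 (2 * (v - 1)) = l \<and>
        wmem (start [n, m] (encode G P)) 0 (2 * (v - 1) + 1) = r"
      using w by (cases "rhs_of G v") simp_all
  qed
  then show ?thesis unfolding drepr_def by (simp add: start_def dstate0_def fun_eq_iff)
qed

lemma start_rest:
  "j < m \<Longrightarrow> nmem (start [n, m] (encode G P)) 0 (n + j) = P ! j"
  "a \<noteq> 0 \<Longrightarrow> wmem (start [n, m] (encode G P)) a = (\<lambda>_. 0)"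
  using n_def m_def by (simp_all add: start_def encode_def nth_append)

lemma representation:
  assumes mN: "m \<le> length (val G n)"
  shows "\<exists>R t. run B (comp build_prog) [n, m] (encode G P) t R \<and>
    real t \<le> 4000 * real (length (tx F)) * lg m \<and> mem_size R \<le> 100 * length (tx F) \<and>
    (\<forall>i\<in>{1..length (val G n) - m + 1}. \<exists>t'. run B (comp query_prog) [i] R t' ([], [conv (val G n) P i]) \<and>
       real t' \<le> 1000 * lg (length (val G n)))"
proof -
  let ?T = "length (tx F)" and ?q = "nid F" and ?N = "length (val G n)"
  note root = root[OF mN]
  have bt: "clk F + 3 \<le> 4 * ?T" "?q \<le> clk F" using vis_root_bounds unfolding F by auto
  have T1: "1 \<le> ?T" using root(5) m1 by simp
  obtain t \<tau> where run: "run B (comp build_prog) [n, m] (encode G P) t (result_of \<tau>)"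
    and t: "t \<le> 310 * clk F + ?T + nat \<lceil>real ?T * lg m\<rceil> + 460 * ?q + 220"
    and r: "reg \<tau> 0 = 10 * (?q + 1)" "reg \<tau> 1 = ?T - m + 1"
    and C: "\<And>k. k + m \<le> ?T \<Longrightarrow> nmem \<tau> 1 k = conv (tx F) P (Suc k)"
    and ans: "\<And>W ct. \<forall>x<10 * (?q + 1). W x = wmem \<tau> 1 x \<Longrightarrow>
        \<forall>k. k + m \<le> ?T \<longrightarrow> ct k = conv (tx F) P (Suc k) \<Longrightarrow> answering W ct"
    using run_wp[OF build_prog_correct[OF mN drepr_start start_rest(1) start_rest(2) start_rest(2)]] by (auto simp del: One_nat_def)
  let ?R = "result_of \<tau>"
  have lg1: "1 \<le> lg m" by (simp add: lg_def)
  have pos: "0 \<le> real ?T * lg m" using lg1 by (intro mult_nonneg_nonneg) auto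
  have TL: "real ?T \<le> real ?T * lg m" using lg1 by (simp add: mult_le_cancel_left1)
  have "real t \<le> real (310 * clk F + ?T + nat \<lceil>real ?T * lg m\<rceil> + 460 * ?q + 220)" using t by (rule of_nat_mono)
  also have "\<dots> = real (310 * clk F + ?T + 460 * ?q + 220) + real (nat \<lceil>real ?T * lg m\<rceil>)" by simp
  also have "\<dots> \<le> real (3500 * ?T) + (real ?T * lg m + 1)"
  proof (rule add_mono)
    \<comment> \<open>Both \<open>clk F\<close> and the number of nodes are at most
      \<open>4 * ?T\<close>, and \<open>310 * 4 + 1 + 460 * 4 + 220\<close> is 3301.\<close>
    have "310 * clk F + ?T + 460 * ?q + 220 \<le> 3500 * ?T" using bt T1 by linarith
    then show "real (310 * clk F + ?T + 460 * ?q + 220) \<le> real (3500 * ?T)" by (rule of_nat_mono)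
    show "real (nat \<lceil>real ?T * lg m\<rceil>) \<le> real ?T * lg m + 1" using pos by linarith
  qed
  also have "\<dots> \<le> 4000 * (real ?T * lg m)"
  proof -
    have "1 \<le> real ?T" using T1 by linarith
    moreover have "real (3500 * ?T) = 3500 * real ?T" by simp
    ultimately show ?thesis using TL by linarith
  qed
  finally have time: "real t \<le> 4000 * real ?T * lg m" by simp
  have "mem_size ?R = 10 * (?q + 1) + (?T - m + 1)" by (simp add: result_of_def mem_size_def r del: One_nat_def)
  moreover have "?T - m + 1 \<le> ?T" using root(5) m1 by linarith
  moreover have "10 * (?q + 1) \<le> 10 * (4 * ?T)" using bt by (intro mult_le_mono2) linarith
  ultimately have size: "mem_size ?R \<le> 100 * ?T" by linarith
  have "\<exists>t'. run B (comp query_prog) [i] ?R t' ([], [conv (val G n) P i]) \<and> real t' \<le> 1000 * lg ?N"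
    if i: "i \<in> {1..?N - m + 1}" for i
  proof -
    let ?\<sigma> = "start [i] ?R"
    define W ct where "W = wmem ?\<sigma> 0" and "ct = nmem ?\<sigma> 0"
    have "\<forall>x<10 * (?q + 1). W x = wmem \<tau> 1 x" by (simp add: W_def start_def result_of_def r del: One_nat_def)
    moreover have "\<forall>k. k + m \<le> ?T \<longrightarrow> ct k = conv (tx F) P (Suc k)"
    proof (intro allI impI)
      fix k assume k: "k + m \<le> ?T"
      then have "k < ?T - m + 1" by linarith
      then have "ct k = nmem \<tau> 1 k" by (simp add: ct_def start_def result_of_def r del: One_nat_def)
      then show "ct k = conv (tx F) P (Suc k)" using C[OF k] by simp
    qed
    ultimately have "answering W ct" by (rule ans)
    then obtain oc sh rt ch ng Ls where "query_machine ?q (tL F) (tR F) (tG F) (tM F) oc sh rt ch ng Ls (tB F)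
     (\<lambda>i y. conv (val G (tV F i)) P (Suc y)) ct B Mx W" unfolding answering_def[OF mN] by blast
    then interpret qm: query_machine ?q "tL F" "tR F" "tG F" "tM F" oc sh rt ch ng Ls "tB F"
     "\<lambda>i y. conv (val G (tV F i)) P (Suc y)" ct B Mx W .
    have y: "reg ?\<sigma> 0 = Suc (i - 1)" "i - 1 < tG F ?q" using i mN unfolding root(4) by (auto simp: start_def)
    obtain t' \<tau>' where q: "run B (comp query_prog) [i] ?R t' (result_of \<tau>')"
      "t' \<le> 330 * bl (tG F ?q) + 130" "reg \<tau>' 0 = 0" "reg \<tau>' 1 = 1" "nmem \<tau>' 1 0 = conv (val G (tV F ?q)) P (Suc (i - 1))"
      using run_wp[OF qm.query_prog_correct[OF y W_def[symmetric] ct_def[symmetric]]] by (auto simp del: One_nat_def)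
    have "result_of \<tau>' = ([], [conv (val G n) P i])" using q(3-5) i by (simp add: result_of_def root(3))
    moreover have "real t' \<le> 1000 * lg ?N"
    proof -
      have "1 \<le> ?N" using mN m1 by simp
      have "bl (tG F ?q) \<le> bl ?N" unfolding root(4) using m1 by (intro bl_mono) simp
      then have "real (bl (tG F ?q)) \<le> log 2 (real ?N) + 1" using bl_log[OF \<open>1 \<le> ?N\<close>] by linarith
      moreover have "log 2 (real ?N) \<le> lg ?N" "1 \<le> lg ?N" by (simp_all add: lg_def)
      moreover have "real t' \<le> 330 * real (bl (tG F ?q)) + 130" using of_nat_mono[OF q(2), where 'a = real] by simp
      ultimately show ?thesis by linarith
    qed
    ultimately show ?thesis using q(1) by metis
  qed
  then show ?thesis using run time size by blast
qed

end

theorem theorem5: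
  shows "\<exists>(build :: com) (query :: com) (k :: nat) (c :: real). c > 0 \<and>
    (\<forall>(G :: slp) (P :: int list) (w :: nat) (n :: nat) (m :: nat) (S :: int list) (N :: nat)
       (\<alpha> :: int) (s :: real).
       is_slp G \<and> n = length G \<and> S = slp_string G \<and> N = length S \<and>
       m = length P \<and> 1 \<le> m \<and> m \<le> N \<and>
       \<alpha> = alpha G m \<and> s = min (real n * real m) (real N - real_of_int \<alpha>) \<and>
       1 \<le> w \<and> log 2 (real N) \<le> real w \<and> log 2 (real n) \<le> real w
       \<longrightarrow>
       ((\<forall>j\<in>{1..n}. 1 \<le> vOcc G j) \<longrightarrow> 0 \<le> \<alpha>) \<and>
       (\<exists>R t. run (2 ^ (k * w)) build [n, m] (encode G P) t R \<and>
          real t \<le> c * s * lg m \<and>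
          real (mem_size R) \<le> c * s \<and>
          (\<forall>i\<in>{1..N - m + 1}.
             \<exists>t'. run (2 ^ (k * w)) query [i] R t' ([], [conv S P i]) \<and>
               real t' \<le> c * lg N)))"
proof (rule exI[of _ "comp build_prog"], rule exI[of _ "comp query_prog"], rule exI[of _ 12], rule exI[of _ 40000],
    intro conjI allI impI, goal_cases)
  case 1
  show ?case by simp
next
  case (2 G P w n m S N \<alpha> s)
  then interpret slp_pattern G P n m by unfold_locales auto
  show ?case using 2 alpha_nonneg by auto
next
  case (3 G P w n m S N \<alpha> s)
  then interpret slp_pattern G P n m by unfold_locales auto
  define F where "F = vis G m n dstate0"
  have S: "S = val G n" and mN: "m \<le> length (val G n)" and N: "N = length (val G n)"
    using 3 by (auto simp: slp_string_def)
  \<comment> \<open>\<open>X\<close> bounds \<open>N\<close> and \<open>n\<close>. The text has at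
    most \<open>2 * m * N\<close> characters and the clock stays below four times that, so all
    quantities are at most \<open>8 * (X * X)\<close>.\<close>
  define X where "X = (2::nat) ^ w"
  have X2: "2 \<le> X" using 3 power_increasing[of 1 w "2::nat"] by (simp add: X_def)
  have le: "x \<le> X" if "1 \<le> x" "log 2 (real x) \<le> real w" for x :: nat
  proof -
    have "real x \<le> 2 powr real w" using that by (subst (asm) log_le_iff) auto
    also have "\<dots> = real X" by (simp add: X_def powr_realpow)
    finally show ?thesis by simp
  qed
  have NX: "N \<le> X" and nX: "n \<le> X" using le 3 n1 mN by auto
  note b = vis_root_bounds[folded F_def]
  have XX: "X * 2 \<le> X * X" using X2 by (intro mult_le_mono2)
  have "2 * m * length (val G n) \<le> 2 * X * X" using NX N mN by (intro mult_le_mono) auto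
  then have T: "length (tx F) \<le> 2 * (X * X)" using b(3) by (simp add: mult.assoc)
  \<comment> \<open>The origin of \<open>k = 12\<close>: two factors of \<open>X\<close> for the
    quadratic bound and ten more, worth at least 1024, for the constants; this uses that
    \<open>w\<close> is at least 1.\<close>
  have B: "100 * (8 * (X * X)) + 100 \<le> 2 ^ (12 * w)"
  proof -
    have "(2::nat) ^ 10 \<le> X ^ 10" using X2 by (rule power_mono) simp
    then have "X ^ 2 * 2 ^ 10 \<le> X ^ 2 * X ^ 10" by (rule mult_le_mono2)
    moreover have "X ^ 2 * X ^ 10 = 2 ^ (12 * w)" by (simp add: X_def power_mult[symmetric] power_add[symmetric])
    moreover have "4 \<le> X * X" using XX X2 by linarith
    moreover have "X ^ 2 * 2 ^ 10 = 1024 * (X * X)" by (simp add: power2_eq_square)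
    ultimately show ?thesis by linarith
  qed
  interpret bounded_machine G P n m "2 ^ (12 * w)" "8 * (X * X)" F
  proof
    show "F = vis G m n dstate0" by (rule F_def)
    show "length (tx F) \<le> 8 * (X * X)" "clk F \<le> 8 * (X * X)" "nid F \<le> 8 * (X * X)" using T b(1,2) by linarith+
    show "n \<le> 8 * (X * X)" "m \<le> 8 * (X * X)" "length (val G n) \<le> 8 * (X * X)" using nX NX XX N mN by linarith+
    show "100 * (8 * (X * X)) + 100 \<le> 2 ^ (12 * w)" by (rule B)
    show "good F" using vis_root by (simp add: vis_post_def F_def)
  qed
  obtain R t where R: "run (2 ^ (12 * w)) (comp build_prog) [n, m] (encode G P) t R"
    "real t \<le> 4000 * real (length (tx F)) * lg m" "mem_size R \<le> 100 * length (tx F)"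
    "\<forall>i\<in>{1..length (val G n) - m + 1}. \<exists>t'. run (2 ^ (12 * w)) (comp query_prog) [i] R t' ([], [conv (val G n) P i]) \<and>
       real t' \<le> 1000 * lg (length (val G n))"
    using representation[OF mN] by blast
  have "real_of_int (int (length (tx F))) \<le> real_of_int (10 * min (int n * int m) (int (length (val G n)) - alpha G m))"
    using text_size[OF mN, folded F_def] by (simp only: of_int_le_iff)
  then have Ts: "real (length (tx F)) \<le> 10 * s" using 3 N by (simp add: of_int_min)
  have lg1: "1 \<le> lg x" for x by (simp add: lg_def)
  have "real t \<le> 40000 * s * lg m"
  proof -
    have "4000 * real (length (tx F)) * lg m \<le> 4000 * (10 * s) * lg m"
      using Ts lg1[of m] by (intro mult_right_mono mult_left_mono) auto
    then show ?thesis using R(2) by (simp add: mult.commute mult.left_commute)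
  qed
  moreover have "real (mem_size R) \<le> 40000 * s"
    using of_nat_mono[OF R(3), where 'a = real] Ts by simp
  moreover have "\<forall>i\<in>{1..N - m + 1}. \<exists>t'. run (2 ^ (12 * w)) (comp query_prog) [i] R t' ([], [conv S P i]) \<and>
       real t' \<le> 40000 * lg N"
  proof
    fix i assume "i \<in> {1..N - m + 1}"
    then obtain t' where t': "run (2 ^ (12 * w)) (comp query_prog) [i] R t' ([], [conv S P i])" "real t' \<le> 1000 * lg N"
      using R(4) unfolding S N by blast
    have "real t' \<le> 40000 * lg N" using t'(2) lg1[of N] by linarith
    then show "\<exists>t'. run (2 ^ (12 * w)) (comp query_prog) [i] R t' ([], [conv S P i]) \<and> real t' \<le> 40000 * lg N"
      using t'(1) by blast
  qed
  ultimately show ?case using R(1) by blast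
qed

end
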